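(* Let $f:\{0,1\}^n\times\{0,1\}^n\to\{0,1\}$ be a non-constant Boolean function. Then \[\bar{\mathrm{R}}_\varepsilon(f)\ge\Omega\!\left(\min\!\left(\left(\frac{1/\varepsilon}{\log(1/\varepsilon)}\right)^{2/3},\ \frac{\mathrm{rank}(f)}{\log(\mathrm{rank}(f))}\right)\right).\]
   Context: $\mathrm{rank}(f)$ is the real rank of the $2^n\times2^n$ matrix with $(x,y)$ entry $f(x,y)$. Distributed estimation: Alice holds a probability distribution $p$ on $\{0,1\}^n$, Bob a probability distribution $q$ on $\{0,1\}^n$, and they must output an estimate within additive error $\varepsilon$ of $\mathbb{E}_{x\sim p,y\sim q}[f(x,y)]$. $\bar{\mathrm{R}}_\varepsilon(f)$ is the minimum worst-case communication of a shared-randomness randomized protocol succeeding with probability at least $2/3$ on every input pair. $\Omega$ hides an absolute constant.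
   Formalization: The range is taken as 0 < ε < 1/2, since for ε ≥ 1/2 outputting 1/2 needs no communication and the bound fails; and log(rank(f)) is replaced by max(1, log₂ rank(f)), which differs only at rank(f) = 1, where the original expression is 1/0. *)

theory Defs
  imports
    "HOL-Probability.Probability"
    "Jordan_Normal_Form.DL_Rank"
begin

definition cube :: "nat \<Rightarrow> bool list set" where
  "cube n = {xs. length xs = n}"

definition nth_point :: "nat \<Rightarrow> nat \<Rightarrow> bool list" where
  "nth_point n i = map (bit i) [0..<n]"

lemma bij_betw_nth_point: "bij_betw (nth_point n) {..<2 ^ n} (cube n)"
proof -
  have inj: "inj_on (nth_point n) {..<2 ^ n}"
  proof (rule inj_onI)
    fix i j :: nat
    assume ij: "i \<in> {..<2 ^ n}" "j \<in> {..<2 ^ n}" and eq: "nth_point n i = nth_point n j"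
    have "bit i k = bit j k" if "k < n" for k
      using arg_cong[OF eq, of "\<lambda>xs. xs ! k"] that by (simp add: nth_point_def)
    then have "take_bit n i = take_bit n j"
      by (auto simp: bit_eq_iff bit_take_bit_iff)
    then show "i = j"
      using ij by (simp add: take_bit_nat_eq_self)
  qed
  have fin: "finite (cube n)" and card: "card (cube n) = 2 ^ n"
    using finite_lists_length_eq[of "UNIV :: bool set" n] card_lists_length_eq[of "UNIV :: bool set" n]
    by (simp_all add: cube_def)
  have "nth_point n ` {..<2 ^ n} \<subseteq> cube n"
    by (auto simp: nth_point_def cube_def)
  then have "nth_point n ` {..<2 ^ n} = cube n"
    using card_image[OF inj] fin card by (simp add: card_subset_eq)
  with inj show ?thesis
    by (simp add: bij_betw_def)
qed

definition comm_matrix :: "nat \<Rightarrow> (bool list \<Rightarrow> bool list \<Rightarrow> bool) \<Rightarrow> real mat" where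
  "comm_matrix n f =
     mat (2 ^ n) (2 ^ n) (\<lambda>(i, j). of_bool (f (nth_point n i) (nth_point n j)))"

definition fun_rank :: "nat \<Rightarrow> (bool list \<Rightarrow> bool list \<Rightarrow> bool) \<Rightarrow> nat" where
  "fun_rank n f = vec_space.rank (2 ^ n) (comm_matrix n f)"

text \<open>
  Deterministic two-party protocols: at an inner node one party announces a bit depending on its
  own input, and the estimate is determined by the leaf reached, i.e. by the transcript.
\<close>

datatype ('a, 'b) protocol =
    Output real
  | Alice "'a \<Rightarrow> bool" "('a, 'b) protocol" "('a, 'b) protocol"
  | Bob "'b \<Rightarrow> bool" "('a, 'b) protocol" "('a, 'b) protocol"

primrec run :: "('a, 'b) protocol \<Rightarrow> 'a \<Rightarrow> 'b \<Rightarrow> real" where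
  "run (Output v) a b = v"
| "run (Alice s t u) a b = (if s a then run t a b else run u a b)"
| "run (Bob s t u) a b = (if s b then run t a b else run u a b)"

primrec comm_cost :: "('a, 'b) protocol \<Rightarrow> nat" where
  "comm_cost (Output v) = 0"
| "comm_cost (Alice s t u) = Suc (max (comm_cost t) (comm_cost u))"
| "comm_cost (Bob s t u) = Suc (max (comm_cost t) (comm_cost u))"

definition mean :: "(bool list \<Rightarrow> bool list \<Rightarrow> bool) \<Rightarrow> bool list pmf \<Rightarrow> bool list pmf \<Rightarrow> real" where
  "mean f p q = measure_pmf.expectation (pair_pmf p q) (\<lambda>(x, y). of_bool (f x y))"

text \<open>
  A shared-randomness protocol is a probability measure on deterministic protocols, over an
  arbitrary \<open>\<sigma>\<close>-algebra; any shared random seed induces one by pushing its law forward.  Since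
  \<open>measure\<close> is 0 on non-measurable sets, the bound 2/3 also forces the success event to be
  measurable.
\<close>

definition estimates ::
  "nat \<Rightarrow> (bool list \<Rightarrow> bool list \<Rightarrow> bool) \<Rightarrow> real \<Rightarrow>
   (bool list pmf, bool list pmf) protocol measure \<Rightarrow> bool" where
  "estimates n f \<epsilon> M \<longleftrightarrow> prob_space M \<and>
     (\<forall>p q. set_pmf p \<subseteq> cube n \<longrightarrow> set_pmf q \<subseteq> cube n \<longrightarrow>
        measure M {t \<in> space M. \<bar>run t p q - mean f p q\<bar> \<le> \<epsilon>} \<ge> 2 / 3)"

definition est_complexity :: "nat \<Rightarrow> (bool list \<Rightarrow> bool list \<Rightarrow> bool) \<Rightarrow> real \<Rightarrow> enat" where
  "est_complexity n f \<epsilon> =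
     (INF M \<in> {M. estimates n f \<epsilon> M}. SUP t \<in> space M. enat (comm_cost t))"

end

theory Submission
  imports Defs
begin

text \<open>
  Differences of probability distributions see only the mixed second difference of the communication
  matrix, an integer matrix with entries of modulus at most 2 whose rank is at least the rank of \<open>f\<close>
  minus 2. A nonsingular \<open>k \<times> k\<close> minor \<open>B\<close> of it has determinant of modulus at least 1, so by Hadamard's
  inequality it contracts strongly only on a subspace of codimension \<open>m\<close> of order at least \<open>k / log k\<close>.
  Off that subspace there are orthonormal \<open>u\<^sub>c = B y\<^sub>c\<close>, \<open>c < m\<close>, with \<open>y\<^sub>c\<close> of norm at most 2, and with
  \<open>x = \<Sum>\<^sub>c g\<^sub>c u\<^sub>c\<close> and \<open>y = \<Sum>\<^sub>c h\<^sub>c y\<^sub>c\<close> the form \<open>x\<^sup>T B y\<close> is the inner product of \<open>g\<close> and \<open>h\<close>. As the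
  \<open>l\<^sub>1\<close>-norms of \<open>x\<close> and \<open>y\<close> are of order \<open>sqrt (k m)\<close>, four runs of an estimation protocol on the normalised
  positive and negative parts determine this inner product up to \<open>O(\<epsilon> k m)\<close>, a small multiple of \<open>sqrt m\<close>
  when \<open>\<epsilon> k sqrt m\<close> is small.

  That takes \<open>\<Omega>(m)\<close> bits when \<open>h\<close> is a random sign vector and \<open>g\<close> is nearly Gaussian: if
  \<open>cos (\<theta> (\<langle>g, h\<rangle> - v))\<close> with \<open>\<theta>\<close> of order \<open>1 / sqrt m\<close> had noticeable mean over a large rectangle, one
  could choose many \<open>h\<^sub>i\<close> in it, each far from the span of its predecessors, and the Riesz product
  \<open>\<Prod>\<^sub>i (1 + \<beta> cos (\<theta> (\<langle>g, h\<^sub>i\<rangle> - v)))\<close> would be exponentially large on the \<open>g\<close>-side of the rectangle although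
  its mean is close to 1. A Fejer kernel combines the frequencies, so that a constant success probability
  suffices.
\<close>

section \<open>Sign vectors\<close>

lemma two_power_fact_le: "2 ^ n * fact n \<le> (fact (2 * n) :: real)"
proof (induction n)
  case (Suc n)
  have "(2::real) ^ Suc n * fact (Suc n) = (2 * real (Suc n)) * (2 ^ n * fact n)"
    by simp
  also have "\<dots> \<le> (2 * real (Suc n)) * fact (2 * n)"
    using Suc by (intro mult_left_mono) auto
  also have "\<dots> \<le> (2 * real (Suc n)) * (real (2 * n + 1) * fact (2 * n))"
    by (intro mult_left_mono) auto
  also have "\<dots> = fact (2 * Suc n)"
    by (simp add: algebra_simps)
  finally show ?case .
qed simp

text \<open>The Taylor series are compared term by term, by the factorial inequality above. This is
  the sub-Gaussian bound for one random sign.\<close>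

lemma cosh_le_exp_half_square:
  fixes x :: real
  shows "cosh x \<le> exp (x\<^sup>2 / 2)"
proof -
  have "(\<lambda>n. if even n then x ^ n /\<^sub>R fact n else 0) sums cosh x"
    by (rule cosh_converges)
  moreover have "strict_mono (\<lambda>n::nat. 2 * n)"
    by (auto intro: strict_monoI)
  moreover have "(if even n then x ^ n /\<^sub>R fact n else 0) = 0" if "n \<notin> range (\<lambda>n::nat. 2 * n)" for n
  proof -
    have "odd n" using that by (metis dvdE rangeI)
    then show ?thesis by simp
  qed
  ultimately have "(\<lambda>n. (\<lambda>n. if even n then x ^ n /\<^sub>R fact n else 0) (2 * n)) sums cosh x"
    using sums_mono_reindex[of "\<lambda>n::nat. 2 * n" "\<lambda>n. if even n then x ^ n /\<^sub>R fact n else 0" "cosh x"]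
    by blast
  then have c: "(\<lambda>n. x ^ (2 * n) / fact (2 * n)) sums cosh x"
    by (simp add: divide_inverse mult.commute)
  have "(\<lambda>n. (x\<^sup>2 / 2) ^ n /\<^sub>R fact n) sums exp (x\<^sup>2 / 2)"
    by (rule exp_converges)
  moreover have "(x\<^sup>2 / 2) ^ n /\<^sub>R fact n = x ^ (2 * n) / (2 ^ n * fact n)" for n
    by (simp add: power_mult[symmetric] power_divide field_simps)
  ultimately have e: "(\<lambda>n. x ^ (2 * n) / (2 ^ n * fact n)) sums exp (x\<^sup>2 / 2)"
    by (simp only:)
  show ?thesis
  proof (rule sums_le[OF _ c e])
    fix n
    have "0 \<le> x ^ (2 * n)" by (simp add: power_mult)
    then show "x ^ (2 * n) / fact (2 * n) \<le> x ^ (2 * n) / (2 ^ n * fact n)"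
      by (intro divide_left_mono two_power_fact_le mult_pos_pos) auto
  qed
qed

text \<open>\<open>cos x\<close> is \<open>1 - 2 * (sin (x / 2))\<^sup>2\<close>, and by the mean
  value theorem the sine is \<open>x / 2\<close> times a cosine whose square is at least 1/2. This
  yields the decay of the characteristic function of one random sign.\<close>

lemma abs_cos_le_exp_neg_quarter_square:
  fixes x :: real
  assumes "\<bar>x\<bar> \<le> 1"
  shows "\<bar>cos x\<bar> \<le> exp (- (x\<^sup>2 / 4))"
proof -
  have *: "0 \<le> cos x \<and> cos x \<le> exp (- (x\<^sup>2 / 4))" if x: "0 < x" "x \<le> 1" for x :: real
  proof -
    have pi: "pi > 3" by (rule pi_gt3)
    obtain \<xi> where \<xi>: "0 < \<xi>" "\<xi> < x / 2" "sin (x / 2) - sin 0 = (x / 2 - 0) * cos \<xi>"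
      using MVT2[of 0 "x / 2" sin cos] x by auto
    have s: "0 \<le> sin \<xi>" "sin \<xi> \<le> 1 / 2"
      using \<xi> x pi sin_x_le_x[of \<xi>] sin_ge_zero[of \<xi>] by linarith+
    have "(sin \<xi>)\<^sup>2 \<le> (1 / 2)\<^sup>2"
      using s by (intro power_mono) auto
    then have "(cos \<xi>)\<^sup>2 \<ge> 1 / 2"
      using sin_cos_squared_add[of \<xi>] by (simp add: power2_eq_square)
    then have "(x / 2)\<^sup>2 * (cos \<xi>)\<^sup>2 \<ge> (x / 2)\<^sup>2 * (1 / 2)"
      by (intro mult_left_mono) auto
    then have "(sin (x / 2))\<^sup>2 \<ge> x\<^sup>2 / 8"
      using arg_cong[OF \<xi>(3), of "\<lambda>t. t\<^sup>2"] by (simp add: power_mult_distrib power_divide)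
    moreover have "cos x = 1 - 2 * (sin (x / 2))\<^sup>2"
      using cos_double_sin[of "x / 2"] by simp
    ultimately have "cos x \<le> 1 + (- (x\<^sup>2 / 4))" by simp
    then have "cos x \<le> exp (- (x\<^sup>2 / 4))"
      using exp_ge_add_one_self[of "- (x\<^sup>2 / 4)"] by linarith
    moreover have "0 \<le> cos x"
      using x pi by (intro cos_ge_zero) auto
    ultimately show ?thesis by blast
  qed
  consider "x = 0" | "x > 0" | "x < 0" by linarith
  then show ?thesis
  proof cases
    case 2
    then show ?thesis using *[of x] assms by auto
  next
    case 3
    then show ?thesis using *[of "- x"] assms by auto
  qed auto
qed

definition signs :: "'i set \<Rightarrow> ('i \<Rightarrow> real) set" where
  "signs I = (\<Pi>\<^sub>E i\<in>I. {-1, 1})"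

lemma finite_signs [simp]: "finite I \<Longrightarrow> finite (signs I)"
  by (simp add: signs_def finite_PiE)

lemma card_signs: "finite I \<Longrightarrow> card (signs I) = 2 ^ card I"
  by (simp add: signs_def card_PiE numeral_2_eq_2)

lemma signs_cases: "g \<in> signs I \<Longrightarrow> i \<in> I \<Longrightarrow> g i = -1 \<or> g i = 1"
  by (auto simp: signs_def PiE_def Pi_def)

lemma sum_signs_prod:
  fixes F :: "'i \<Rightarrow> real \<Rightarrow> 'b::comm_ring_1"
  assumes "finite I"
  shows "(\<Sum>g\<in>signs I. \<Prod>i\<in>I. F i (g i)) = (\<Prod>i\<in>I. F i (-1) + F i 1)"
proof -
  have "(\<Prod>i\<in>I. \<Sum>s\<in>{-1, 1}. F i s) = (\<Sum>g\<in>signs I. \<Prod>i\<in>I. F i (g i))"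
    unfolding signs_def by (rule prod_sum_PiE) (use assms in auto)
  then show ?thesis by simp
qed

text \<open>Characteristic function of a sign vector. In complex form the sum factorises, each
  factor being \<open>2 * cos (b i)\<close>; the real part gives the claim.\<close>

lemma sum_signs_cos:
  assumes "finite I"
  shows "(\<Sum>g\<in>signs I. cos (a + (\<Sum>i\<in>I. b i * g i))) = 2 ^ card I * (cos a * (\<Prod>i\<in>I. cos (b i)))"
proof -
  have cis_sum: "cis (sum f J) = (\<Prod>i\<in>J. cis (f i))" if "finite J" for f :: "'a \<Rightarrow> real" and J
    using that by (induction J rule: finite_induct) (auto simp: cis_mult[symmetric])
  have "(\<Sum>g\<in>signs I. cis (a + (\<Sum>i\<in>I. b i * g i))) = cis a * (\<Sum>g\<in>signs I. \<Prod>i\<in>I. cis (b i * g i))"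
    using assms by (simp add: cis_mult[symmetric] cis_sum sum_distrib_left)
  also have "\<dots> = cis a * (\<Prod>i\<in>I. cis (- b i) + cis (b i))"
    using sum_signs_prod[OF assms, of "\<lambda>i s. cis (b i * s)"] by simp
  also have "(\<Prod>i\<in>I. cis (- b i) + cis (b i)) = (\<Prod>i\<in>I. complex_of_real (2 * cos (b i)))"
    by (intro prod.cong refl) (simp add: complex_eq_iff)
  also have "\<dots> = complex_of_real (\<Prod>i\<in>I. 2 * cos (b i))"
    by simp
  also have "(\<Prod>i\<in>I. 2 * cos (b i)) = 2 ^ card I * (\<Prod>i\<in>I. cos (b i))"
    by (simp add: prod.distrib)
  finally have "(\<Sum>g\<in>signs I. cis (a + (\<Sum>i\<in>I. b i * g i)))
      = cis a * complex_of_real (2 ^ card I * (\<Prod>i\<in>I. cos (b i)))" (is "_ = cis a * complex_of_real ?R") .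
  then have "Re (\<Sum>g\<in>signs I. cis (a + (\<Sum>i\<in>I. b i * g i))) = Re (cis a * complex_of_real ?R)"
    by (rule arg_cong)
  also have "\<dots> = cos a * ?R"
    by (simp only: times_complex.sel Re_complex_of_real Im_complex_of_real cis.sel mult_zero_right diff_zero)
  finally show ?thesis
    by (simp only: Re_sum cis.sel mult.left_commute)
qed

lemma sum_signs_exp_le:
  assumes "finite I"
  shows "(\<Sum>g\<in>signs I. exp (\<Sum>i\<in>I. b i * g i)) \<le> 2 ^ card I * exp ((\<Sum>i\<in>I. (b i)\<^sup>2) / 2)"
proof -
  have "(\<Sum>g\<in>signs I. exp (\<Sum>i\<in>I. b i * g i)) = (\<Prod>i\<in>I. exp (- b i) + exp (b i))"
    using sum_signs_prod[OF assms, of "\<lambda>i s. exp (b i * s)"] assms by (simp add: exp_sum)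
  also have "\<dots> \<le> (\<Prod>i\<in>I. 2 * exp ((b i)\<^sup>2 / 2))"
  proof (intro prod_mono conjI)
    fix i
    show "0 \<le> exp (- b i) + exp (b i)" by (simp add: add_nonneg_nonneg)
    show "exp (- b i) + exp (b i) \<le> 2 * exp ((b i)\<^sup>2 / 2)"
      using cosh_le_exp_half_square[of "b i"] by (simp add: cosh_field_def)
  qed
  also have "\<dots> = 2 ^ card I * exp ((\<Sum>i\<in>I. (b i)\<^sup>2) / 2)"
    using assms by (simp add: prod.distrib exp_sum sum_divide_distrib)
  finally show ?thesis .
qed

text \<open>Distinct coordinates of a random sign vector are orthogonal, so only the diagonal of the
  expanded square survives.\<close>

lemma sum_signs_square:
  assumes "finite I"
  shows "(\<Sum>g\<in>signs I. (\<Sum>i\<in>I. b i * g i)\<^sup>2) = 2 ^ card I * (\<Sum>i\<in>I. (b i)\<^sup>2)"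
proof -
  have pair: "(\<Sum>g\<in>signs I. g i * g j) = (if i = j then 2 ^ card I else 0)" if "i \<in> I" "j \<in> I" for i j
  proof (cases "i = j")
    case True
    have "g i * g j = 1" if "g \<in> signs I" for g
      using signs_cases[OF that \<open>i \<in> I\<close>] True by auto
    then have "(\<Sum>g\<in>signs I. g i * g j) = (\<Sum>g\<in>signs I. 1)"
      by (intro sum.cong) auto
    then show ?thesis using True assms by (simp add: card_signs)
  next
    case False
    let ?F = "\<lambda>k t. (if k = i then t else 1) * (if k = j then t else (1::real))"
    have "(\<Prod>k\<in>I. ?F k (g k)) = g i * g j" for g
      using that assms by (simp add: prod.distrib prod.delta)
    then have "(\<Sum>g\<in>signs I. g i * g j) = (\<Prod>k\<in>I. ?F k (-1) + ?F k 1)"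
      using sum_signs_prod[OF assms, of ?F] by simp
    also have "\<dots> = 0"
      using that False assms by (auto intro!: prod_zero bexI[of _ i])
    finally show ?thesis using False by simp
  qed
  have "(\<Sum>g\<in>signs I. (\<Sum>i\<in>I. b i * g i)\<^sup>2)
      = (\<Sum>g\<in>signs I. \<Sum>i\<in>I. \<Sum>j\<in>I. b i * b j * (g i * g j))"
    by (simp add: power2_eq_square sum_product mult_ac)
  also have "\<dots> = (\<Sum>i\<in>I. \<Sum>g\<in>signs I. \<Sum>j\<in>I. b i * b j * (g i * g j))"
    by (rule sum.swap)
  also have "\<dots> = (\<Sum>i\<in>I. \<Sum>j\<in>I. b i * b j * (\<Sum>g\<in>signs I. g i * g j))"
    by (subst sum.swap) (simp add: sum_distrib_left)
  also have "\<dots> = (\<Sum>i\<in>I. \<Sum>j\<in>I. if i = j then 2 ^ card I * (b i)\<^sup>2 else 0)"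
    by (intro sum.cong refl) (simp add: pair power2_eq_square)
  also have "\<dots> = 2 ^ card I * (\<Sum>i\<in>I. (b i)\<^sup>2)"
    using assms by (simp add: sum_distrib_left)
  finally show ?thesis .
qed

section \<open>Riesz products\<close>

text \<open>Vectors are functions on all of \<open>nat\<close> of which only the first
  \<open>m\<close> entries count; the dimension is thus an ordinary argument that can be fixed
  inside a proof.\<close>

definition ip :: "nat \<Rightarrow> (nat \<Rightarrow> real) \<Rightarrow> (nat \<Rightarrow> real) \<Rightarrow> real" where
  "ip m u v = (\<Sum>c<m. u c * v c)"

lemma ip_commute: "ip m u v = ip m v u"
  by (simp add: ip_def mult.commute)

lemma ip_add_scale_right: "ip m u (\<lambda>c. v c + e * w c) = ip m u v + e * ip m u w"
  by (simp add: ip_def algebra_simps sum.distrib sum_distrib_left)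

lemma ip_scale_right: "ip m u (\<lambda>c. e * w c) = e * ip m u w"
  by (simp add: ip_def algebra_simps sum_distrib_left)

lemma ip_sum_right: "ip m u (\<lambda>c. \<Sum>j\<in>J. a j * v j c) = (\<Sum>j\<in>J. a j * ip m u (v j))"
  unfolding ip_def by (simp add: sum_distrib_left mult_ac) (rule sum.swap)

lemma ip_cong: "(\<And>c. c < m \<Longrightarrow> v c = w c) \<Longrightarrow> ip m u v = ip m u w"
  by (auto simp: ip_def intro!: sum.cong)

lemma ip_self_nonneg: "ip m u u \<ge> 0"
  by (simp add: ip_def sum_nonneg)

lemma ip_Cauchy_Schwarz: "(ip m u v)\<^sup>2 \<le> ip m u u * ip m v v"
  using Cauchy_Schwarz_ineq_sum[of u v "{..<m}"] by (simp add: ip_def power2_eq_square)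

text \<open>\<open>lin m N b\<close> evaluates \<open>b\<close> on the vector whose \<open>c\<close>-th entry is a normalised sum of \<open>N\<close> signs,
  a finite substitute for a Gaussian vector.\<close>

definition lin :: "nat \<Rightarrow> nat \<Rightarrow> (nat \<Rightarrow> real) \<Rightarrow> (nat \<times> nat \<Rightarrow> real) \<Rightarrow> real" where
  "lin m N b g = (\<Sum>i\<in>{..<m} \<times> {..<N}. b (fst i) / sqrt N * g i)"

lemma lin_add_scale: "lin m N (\<lambda>c. b c + e * d c) g = lin m N b g + e * lin m N d g"
  by (simp add: lin_def sum.distrib sum_distrib_left add_divide_distrib algebra_simps)

lemma lin_scale: "lin m N (\<lambda>c. e * d c) g = e * lin m N d g"
  by (simp add: lin_def sum_distrib_left algebra_simps)

text \<open>Every frequency \<open>b c / sqrt N\<close> lies in the range where the cosine is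
  dominated by a Gaussian, and the \<open>N\<close> copies of a coordinate together contribute
  \<open>(b c)\<^sup>2\<close>.\<close>

lemma abs_sum_cos_lin_le:
  assumes N: "N > 0" and b: "\<And>c. c < m \<Longrightarrow> \<bar>b c\<bar> \<le> sqrt N"
  shows "\<bar>\<Sum>g\<in>signs ({..<m} \<times> {..<N}). cos (a + lin m N b g)\<bar> \<le> 2 ^ (m * N) * exp (- (ip m b b / 4))"
proof -
  let ?I = "{..<m} \<times> {..<N}"
  have "\<bar>\<Sum>g\<in>signs ?I. cos (a + lin m N b g)\<bar> = 2 ^ (m * N) * (\<bar>cos a\<bar> * (\<Prod>i\<in>?I. \<bar>cos (b (fst i) / sqrt N)\<bar>))"
    unfolding lin_def by (subst sum_signs_cos) (auto simp: abs_mult abs_prod)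
  also have "\<dots> \<le> 2 ^ (m * N) * (1 * (\<Prod>i\<in>?I. exp (- ((b (fst i) / sqrt N)\<^sup>2 / 4))))"
    using N b by (intro mult_left_mono mult_mono prod_mono conjI abs_cos_le_exp_neg_quarter_square prod_nonneg)
      (auto simp: abs_divide)
  also have "(\<Prod>i\<in>?I. exp (- ((b (fst i) / sqrt N)\<^sup>2 / 4))) = exp (\<Sum>i\<in>?I. - ((b (fst i) / sqrt N)\<^sup>2 / 4))"
    by (simp add: exp_sum)
  also have "(\<Sum>i\<in>?I. - ((b (fst i) / sqrt N)\<^sup>2 / 4)) = (\<Sum>c<m. \<Sum>s<N. - ((b c / sqrt N)\<^sup>2 / 4))"
    unfolding sum.cartesian_product by (simp add: case_prod_beta)
  also have "\<dots> = - (ip m b b / 4)"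
    using N by (simp add: ip_def power_divide sum_negf sum_divide_distrib[symmetric] power2_eq_square)
  finally show ?thesis by simp
qed

text \<open>The bumps are centred at 0, \<open>-r\<close> and \<open>r\<close>, so at any
  \<open>s\<close> at most one of them exceeds \<open>\<kappa>\<close>. If it is the central one,
  the outer ones cost \<open>\<beta> * \<kappa>\<close>; otherwise its weight
  \<open>\<beta> / 2\<close> leaves enough room, since \<open>\<kappa> \<le> 1 / 4\<close>.\<close>

lemma three_bumps_le:
  fixes s r \<beta> \<kappa> :: real
  assumes \<beta>: "0 \<le> \<beta>" "\<beta> \<le> 1" and \<kappa>: "exp (- (r\<^sup>2 / 16)) \<le> \<kappa>" "\<kappa> \<le> 1 / 4"
  shows "exp (- (s\<^sup>2 / 4)) + \<beta> / 2 * (exp (- ((s + r)\<^sup>2 / 4)) + exp (- ((s - r)\<^sup>2 / 4))) \<le> 1 + \<beta> * \<kappa>"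
proof -
  have far: "exp (- (t\<^sup>2 / 4)) \<le> \<kappa>" if "\<bar>t\<bar> \<ge> \<bar>r\<bar> / 2" for t
  proof -
    have "(\<bar>r\<bar> / 2)\<^sup>2 \<le> \<bar>t\<bar>\<^sup>2" using that by (intro power_mono) auto
    then have "exp (- (t\<^sup>2 / 4)) \<le> exp (- (r\<^sup>2 / 16))" by (simp add: power_divide)
    then show ?thesis using \<kappa>(1) by linarith
  qed
  have le1: "exp (- (t\<^sup>2 / 4)) \<le> 1" for t :: real by simp
  have \<kappa>0: "0 \<le> \<kappa>" using \<kappa>(1) order_trans[OF exp_ge_zero] by blast
  show ?thesis
  proof (cases "\<bar>s\<bar> \<le> \<bar>r\<bar> / 2")
    case True
    then have "exp (- ((s + r)\<^sup>2 / 4)) \<le> \<kappa>" "exp (- ((s - r)\<^sup>2 / 4)) \<le> \<kappa>"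
      by (intro far; linarith)+
    then have "\<beta> / 2 * (exp (- ((s + r)\<^sup>2 / 4)) + exp (- ((s - r)\<^sup>2 / 4))) \<le> \<beta> / 2 * (\<kappa> + \<kappa>)"
      using \<beta> by (intro mult_left_mono add_mono) auto
    moreover have "\<beta> / 2 * (\<kappa> + \<kappa>) = \<beta> * \<kappa>" by simp
    ultimately show ?thesis using le1[of s] by linarith
  next
    case False
    then have "exp (- (s\<^sup>2 / 4)) \<le> \<kappa>" by (intro far) auto
    moreover have "exp (- ((s + r)\<^sup>2 / 4)) + exp (- ((s - r)\<^sup>2 / 4)) \<le> 1 + \<kappa>"
    proof (cases "\<bar>s + r\<bar> \<ge> \<bar>r\<bar> / 2")
      case True
      then show ?thesis using far[of "s + r"] le1[of "s - r"] by linarith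
    next
      case False
      then have "\<bar>s - r\<bar> \<ge> \<bar>r\<bar> / 2" by linarith
      then show ?thesis using far[of "s - r"] le1[of "s + r"] by linarith
    qed
    then have "\<beta> / 2 * (exp (- ((s + r)\<^sup>2 / 4)) + exp (- ((s - r)\<^sup>2 / 4))) \<le> 1 / 2 * (1 + \<kappa>)"
      using \<beta> \<kappa>0 by (intro mult_mono) (auto simp: add_nonneg_nonneg)
    moreover have "0 \<le> \<beta> * \<kappa>" using \<beta> \<kappa>0 by simp
    moreover have "x + y \<le> 1 + z" if "x \<le> \<kappa>" "y \<le> 1 / 2 * (1 + \<kappa>)" "0 \<le> z" for x y z
      using that \<kappa>(2) by simp
    ultimately show ?thesis by blast
  qed
qed

text \<open>For orthonormal \<open>q\<close> this is the squared distance of \<open>b\<close> from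
  the span of \<open>q 0\<close>, ..., \<open>q (l - 1)\<close>.\<close>

definition residual :: "nat \<Rightarrow> (nat \<Rightarrow> nat \<Rightarrow> real) \<Rightarrow> nat \<Rightarrow> (nat \<Rightarrow> real) \<Rightarrow> real" where
  "residual m q l b = ip m b b - (\<Sum>j<l. (ip m (q j) b)\<^sup>2)"

text \<open>Translation by a vector of the span does not change the distance to it: the expansion of
  \<open>d\<close> produces the same cross and square terms in both parts of the residual.\<close>

lemma residual_shift:
  assumes d: "\<And>c. c < m \<Longrightarrow> d c = (\<Sum>j<l. ip m (q j) d * q j c)"
  shows "residual m q l (\<lambda>c. b c + e * d c) = residual m q l b"
proof -
  have ud: "ip m u d = (\<Sum>j<l. ip m (q j) d * ip m u (q j))" for u
  proof -
    have "ip m u d = ip m u (\<lambda>c. \<Sum>j<l. ip m (q j) d * q j c)"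
      using d by (intro ip_cong) auto
    then show ?thesis by (simp add: ip_sum_right)
  qed
  have bd: "ip m b d = (\<Sum>j<l. ip m (q j) d * ip m (q j) b)"
    using ud[of b] by (simp add: ip_commute[of m b "q j" for j])
  have dd: "ip m d d = (\<Sum>j<l. (ip m (q j) d)\<^sup>2)"
    using ud[of d] by (simp add: ip_commute[of m d "q j" for j] power2_eq_square)
  have "ip m (\<lambda>c. b c + e * d c) (\<lambda>c. b c + e * d c) = ip m b b + 2 * e * ip m b d + e\<^sup>2 * ip m d d"
    by (simp add: ip_def algebra_simps sum.distrib sum_distrib_left power2_eq_square)
  moreover have "(\<Sum>j<l. (ip m (q j) (\<lambda>c. b c + e * d c))\<^sup>2)
      = (\<Sum>j<l. (ip m (q j) b)\<^sup>2) + 2 * e * ip m b d + e\<^sup>2 * ip m d d"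
    unfolding bd dd ip_add_scale_right
    by (simp add: power2_sum sum.distrib sum_distrib_left power_mult_distrib algebra_simps)
  ultimately show ?thesis by (simp add: residual_def)
qed

text \<open>Induction on the number of factors. The last cosine, multiplied into the leading one,
  splits the sum into three sums with frequencies \<open>b\<close> and \<open>b\<close> plus or
  minus \<open>d l\<close>. Their residuals differ only in the component along \<open>q l\<close>,
  so the estimate for three bumps yields one more factor \<open>1 + \<beta> * \<kappa>\<close>. The
  leading phase \<open>a\<close> and frequency \<open>b\<close> are there for this
  induction.\<close>

lemma Riesz_product_bound:
  assumes N: "N > 0" and \<beta>: "0 \<le> \<beta>" "\<beta> \<le> 1" and \<kappa>: "exp (- (\<rho> / 16)) \<le> \<kappa>" "\<kappa> \<le> 1 / 4"
    and d: "\<And>i c. i < l \<Longrightarrow> c < m \<Longrightarrow> d i c = (\<Sum>j<Suc i. ip m (q j) (d i) * q j c)"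
    and \<rho>: "\<And>i. i < l \<Longrightarrow> \<rho> \<le> (ip m (q i) (d i))\<^sup>2"
    and b: "\<And>c. c < m \<Longrightarrow> \<bar>b c\<bar> + (\<Sum>i<l. \<bar>d i c\<bar>) \<le> sqrt N"
  shows "\<bar>\<Sum>g\<in>signs ({..<m} \<times> {..<N}). cos (a + lin m N b g) * (\<Prod>i<l. 1 + \<beta> * cos (lin m N (d i) g + \<alpha> i))\<bar>
    \<le> 2 ^ (m * N) * (1 + \<beta> * \<kappa>) ^ l * exp (- (residual m q l b / 4))"
  using d \<rho> b
proof (induction l arbitrary: a b)
  case 0
  then show ?case
    using abs_sum_cos_lin_le[OF N, of m b a] by (simp add: residual_def)
next
  case (Suc l)
  let ?S = "signs ({..<m} \<times> {..<N})"
  let ?P = "\<lambda>g. \<Prod>i<l. 1 + \<beta> * cos (lin m N (d i) g + \<alpha> i)"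
  let ?T = "\<lambda>a b. \<Sum>g\<in>?S. cos (a + lin m N b g) * ?P g"
  let ?b = "\<lambda>e c. b c + e * d l c"
  let ?M = "2 ^ (m * N) * (1 + \<beta> * \<kappa>) ^ l"
  define s where "s = ip m (q l) b"
  define r where "r = ip m (q l) (d l)"
  have \<kappa>0: "0 \<le> \<kappa>" using \<kappa>(1) order_trans[OF exp_ge_zero] by blast
  have M0: "0 \<le> ?M" using \<beta> \<kappa>0 by (intro mult_nonneg_nonneg zero_le_power) auto
  have IH: "\<bar>?T a (?b e)\<bar> \<le> ?M * exp (- (residual m q l (?b e) / 4))" if "\<bar>e\<bar> \<le> 1" for a e
  proof (rule Suc.IH)
    fix c assume "c < m"
    have "\<bar>e * d l c\<bar> \<le> 1 * \<bar>d l c\<bar>"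
      unfolding abs_mult using that by (intro mult_right_mono) auto
    then show "\<bar>?b e c\<bar> + (\<Sum>i<l. \<bar>d i c\<bar>) \<le> sqrt N"
      using Suc.prems(3)[OF \<open>c < m\<close>] abs_triangle_ineq[of "b c" "e * d l c"] by simp
  qed (use Suc.prems(1,2) in auto)
  \<comment> \<open>The direction \<open>q l\<close> is split off; what remains does not see the
    shift, because \<open>d l\<close> lies in the span of \<open>q 0\<close>, ...,
    \<open>q l\<close>.\<close>
  have res: "residual m q l (?b e) = residual m q (Suc l) b + (s + e * r)\<^sup>2" for e
  proof -
    have "residual m q l (?b e) = residual m q (Suc l) (?b e) + (s + e * r)\<^sup>2"
      by (simp add: residual_def ip_add_scale_right s_def r_def)
    moreover have "residual m q (Suc l) (?b e) = residual m q (Suc l) b"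
      using Suc.prems(1)[of l] by (intro residual_shift) auto
    ultimately show ?thesis by simp
  qed
  have IH': "\<bar>?T a (?b e)\<bar> \<le> ?M * (exp (- (residual m q (Suc l) b / 4)) * exp (- ((s + e * r)\<^sup>2 / 4)))"
    if "\<bar>e\<bar> \<le> 1" for a e
    using IH[OF that, of a] unfolding res by (simp add: add_divide_distrib exp_add[symmetric])
  have split: "(\<Sum>g\<in>?S. cos (a + lin m N b g) * (\<Prod>i<Suc l. 1 + \<beta> * cos (lin m N (d i) g + \<alpha> i)))
      = ?T a (?b 0) + \<beta> / 2 * (?T (a + \<alpha> l) (?b 1) + ?T (a - \<alpha> l) (?b (- 1)))"
  proof -
    have eq: "cos (a + lin m N b g) * (\<Prod>i<Suc l. 1 + \<beta> * cos (lin m N (d i) g + \<alpha> i))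
      = cos (a + lin m N (?b 0) g) * ?P g
        + \<beta> / 2 * (cos (a + \<alpha> l + lin m N (?b 1) g) * ?P g + cos (a - \<alpha> l + lin m N (?b (- 1)) g) * ?P g)" for g
    proof -
      have "2 * (cos (a + lin m N b g) * cos (lin m N (d l) g + \<alpha> l))
        = cos (a + \<alpha> l + lin m N (?b 1) g) + cos (a - \<alpha> l + lin m N (?b (- 1)) g)"
        unfolding lin_add_scale cos_times_cos by (simp add: algebra_simps)
      moreover have "x * (p * (1 + \<beta> * y)) = x * p + \<beta> / 2 * (u * p + v * p)" if "2 * (x * y) = u + v" for x y u v p :: real
      proof -
        have "x * (p * (1 + \<beta> * y)) = x * p + \<beta> / 2 * (2 * (x * y)) * p" by (simp add: algebra_simps)
        then show ?thesis unfolding that by (simp add: algebra_simps)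
      qed
      ultimately show ?thesis by simp
    qed
    show ?thesis
      unfolding sum.distrib[symmetric] sum_distrib_left by (intro sum.cong refl eq)
  qed
  let ?E = "exp (- (residual m q (Suc l) b / 4))"
  have "\<bar>?T a (?b 0) + \<beta> / 2 * (?T (a + \<alpha> l) (?b 1) + ?T (a - \<alpha> l) (?b (- 1)))\<bar>
      \<le> \<bar>?T a (?b 0)\<bar> + \<beta> / 2 * (\<bar>?T (a + \<alpha> l) (?b 1)\<bar> + \<bar>?T (a - \<alpha> l) (?b (- 1))\<bar>)"
  proof -
    have "\<bar>\<beta> / 2 * (x + y)\<bar> \<le> \<beta> / 2 * (\<bar>x\<bar> + \<bar>y\<bar>)" for x y :: real
      unfolding abs_mult using \<beta> by (intro mult_mono) auto
    then show ?thesis by (meson abs_triangle_ineq add_left_mono order_trans)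
  qed
  also have "\<dots> \<le> ?M * (?E * exp (- ((s + 0 * r)\<^sup>2 / 4))) + \<beta> / 2 *
      (?M * (?E * exp (- ((s + 1 * r)\<^sup>2 / 4))) + ?M * (?E * exp (- ((s + (- 1) * r)\<^sup>2 / 4))))"
    using \<beta> by (intro add_mono mult_left_mono IH') auto
  also have "\<dots> = ?M * ?E * (exp (- (s\<^sup>2 / 4)) + \<beta> / 2 * (exp (- ((s + r)\<^sup>2 / 4)) + exp (- ((s - r)\<^sup>2 / 4))))"
    by (simp add: algebra_simps)
  also have "\<dots> \<le> ?M * ?E * (1 + \<beta> * \<kappa>)"
  proof (intro mult_left_mono three_bumps_le)
    have "\<rho> \<le> r\<^sup>2" using Suc.prems(2)[of l] by (simp add: r_def)
    then have "exp (- (r\<^sup>2 / 16)) \<le> exp (- (\<rho> / 16))" by simp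
    then show "exp (- (r\<^sup>2 / 16)) \<le> \<kappa>" using \<kappa>(1) by linarith
  qed (use \<beta> \<kappa> M0 in auto)
  finally show ?case unfolding split by (simp add: mult_ac)
qed

section \<open>Sign vectors far from subspaces\<close>

lemma sum_exp_neg_half_square_le:
  "(\<Sum>n\<in>{- int Z..int Z}. exp (- ((real_of_int n)\<^sup>2 / 2))) \<le> 21 / 5"
proof -
  have e: "exp (- (1 / 2 :: real)) \<le> 8 / 13"
  proof -
    have "(13 / 8 :: real) \<le> exp (1 / 2)"
      using exp_lower_Taylor_quadratic[of "1 / 2 :: real"] by (simp add: power2_eq_square)
    then have "inverse (exp (1 / 2 :: real)) \<le> inverse (13 / 8)"
      by (intro le_imp_inverse_le) auto
    then show ?thesis by (simp add: exp_minus)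
  qed
  have term_le: "exp (- ((real (Suc Z))\<^sup>2 / 2)) \<le> (8 / 13) ^ Suc Z" for Z
  proof -
    have "real (Suc Z) \<le> (real (Suc Z))\<^sup>2" by (simp add: power2_eq_square)
    then have "exp (- ((real (Suc Z))\<^sup>2 / 2)) \<le> exp (real (Suc Z) * (- (1 / 2)))" by simp
    also have "\<dots> = exp (- (1 / 2)) ^ Suc Z" by (rule exp_of_nat_mult)
    also have "\<dots> \<le> (8 / 13) ^ Suc Z" by (intro power_mono e) auto
    finally show ?thesis .
  qed
  \<comment> \<open>The right-hand side is 1 plus twice the partial sum of the geometric series of
    ratio 8/13.\<close>
  have "(\<Sum>n\<in>{- int Z..int Z}. exp (- ((real_of_int n)\<^sup>2 / 2))) \<le> 21 / 5 - 16 / 5 * (8 / 13) ^ Z"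
  proof (induction Z)
    case (Suc Z)
    have "{- int (Suc Z)..int (Suc Z)} = insert (int (Suc Z)) (insert (- int (Suc Z)) {- int Z..int Z})"
      by auto
    then have "(\<Sum>n\<in>{- int (Suc Z)..int (Suc Z)}. exp (- ((real_of_int n)\<^sup>2 / 2)))
        = 2 * exp (- ((real (Suc Z))\<^sup>2 / 2)) + (\<Sum>n\<in>{- int Z..int Z}. exp (- ((real_of_int n)\<^sup>2 / 2)))"
      by (simp add: power2_eq_square algebra_simps)
    also have "\<dots> \<le> 2 * (8 / 13) ^ Suc Z + (21 / 5 - 16 / 5 * (8 / 13) ^ Z)"
      by (intro add_mono mult_left_mono term_le Suc.IH) auto
    also have "\<dots> = 21 / 5 - 16 / 5 * (8 / 13) ^ Suc Z" by simp
    finally show ?case .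
  qed simp
  moreover have "0 \<le> 16 / 5 * (8 / 13 :: real) ^ Z" by simp
  ultimately show ?thesis by linarith
qed

text \<open>Completing the square at the integer nearest to \<open>a / 2\<close>.\<close>

lemma exp_quarter_square_le_sum:
  assumes a: "\<bar>a\<bar> \<le> real Z" and Z: "Z > 0"
  shows "exp (a\<^sup>2 / 4) \<le> exp (1 / 4) * (\<Sum>n\<in>{- int Z..int Z}. exp (real_of_int n * a - (real_of_int n)\<^sup>2))"
proof -
  define n where "n = round (a / 2)"
  have n: "\<bar>real_of_int n - a / 2\<bar> \<le> 1 / 2"
    unfolding n_def by (rule of_int_round_abs_le)
  then have "\<bar>real_of_int n\<bar> \<le> real Z"
    using a Z by linarith
  then have "n \<in> {- int Z..int Z}" by auto
  then have "exp (real_of_int n * a - (real_of_int n)\<^sup>2)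
      \<le> (\<Sum>n\<in>{- int Z..int Z}. exp (real_of_int n * a - (real_of_int n)\<^sup>2))"
    by (intro member_le_sum) auto
  moreover have "exp (a\<^sup>2 / 4) \<le> exp (1 / 4) * exp (real_of_int n * a - (real_of_int n)\<^sup>2)"
  proof -
    have "(real_of_int n - a / 2)\<^sup>2 \<le> (1 / 2)\<^sup>2"
      using n by (metis abs_ge_zero power2_abs power_mono)
    then have "a\<^sup>2 / 4 \<le> 1 / 4 + (real_of_int n * a - (real_of_int n)\<^sup>2)"
      by (simp add: power2_eq_square field_simps)
    then show ?thesis by (simp add: exp_add[symmetric])
  qed
  ultimately show ?thesis
    by (meson exp_ge_zero mult_left_mono order_trans)
qed

lemma ip_orthonormal_sum:
  fixes q :: "nat \<Rightarrow> nat \<Rightarrow> real"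
  assumes "\<And>i j. i < p \<Longrightarrow> j < p \<Longrightarrow> ip m (q i) (q j) = of_bool (i = j)"
  shows "ip m (\<lambda>c. \<Sum>j<p. a j * q j c) (\<lambda>c. \<Sum>j<p. a j * q j c) = (\<Sum>j<p. (a j)\<^sup>2)"
proof -
  have "ip m (\<lambda>c. \<Sum>j<p. a j * q j c) (\<lambda>c. \<Sum>j<p. a j * q j c)
      = (\<Sum>i<p. a i * ip m (q i) (\<lambda>c. \<Sum>j<p. a j * q j c))"
    by (subst ip_sum_right) (simp only: ip_commute[of m "\<lambda>c. \<Sum>j<p. a j * q j c" "q i" for i])
  also have "\<dots> = (\<Sum>i<p. a i * (\<Sum>j<p. a j * ip m (q i) (q j)))"
    by (simp only: ip_sum_right)
  also have "\<dots> = (\<Sum>i<p. a i * (\<Sum>j<p. if i = j then a j else 0))"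
    using assms by (intro sum.cong refl arg_cong2[where f = "(*)"]) auto
  also have "\<dots> = (\<Sum>j<p. (a j)\<^sup>2)"
    by (intro sum.cong) (auto simp: power2_eq_square)
  finally show ?thesis .
qed

text \<open>The quadratic exponent is linearised: each \<open>exp (a\<^sup>2 / 4)\<close> is
  dominated by a sum over integers of exponentials linear in \<open>a\<close>. For fixed integers
  \<open>\<nu> j\<close> the sub-Gaussian bound applies to the combination of the \<open>q j\<close>
  with these coefficients, whose squared norm is the sum of the \<open>(\<nu> j)\<^sup>2\<close>.
  The remaining sum factorises into \<open>p\<close> equal factors.\<close>

lemma sum_signs_exp_projection_le:
  assumes m: "m > 0" and q: "\<And>i j. i < p \<Longrightarrow> j < p \<Longrightarrow> ip m (q i) (q j) = of_bool (i = j)"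
  shows "(\<Sum>h\<in>signs {..<m}. exp ((\<Sum>j<p. (ip m (q j) h)\<^sup>2) / 4)) \<le> 2 ^ m * 6 ^ p"
proof -
  let ?Z = "{- int m..int m}"
  let ?e = "\<lambda>n a. exp (real_of_int n * a - (real_of_int n)\<^sup>2)"
  have hh: "ip m h h = m" if "h \<in> signs {..<m}" for h
  proof -
    have "h c * h c = 1" if "c < m" for c
      using signs_cases[OF \<open>h \<in> signs {..<m}\<close>, of c] that by auto
    then show ?thesis by (simp add: ip_def)
  qed
  \<comment> \<open>Integers up to \<open>m\<close> in modulus suffice for the linearisation, as the
    projections are bounded by \<open>m\<close>.\<close>
  have qh: "\<bar>ip m (q j) h\<bar> \<le> m" if "j < p" "h \<in> signs {..<m}" for j h
  proof -
    have "(ip m (q j) h)\<^sup>2 \<le> 1 * real m"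
      using ip_Cauchy_Schwarz[of m "q j" h] q[of j j] hh that by simp
    also have "\<dots> \<le> (real m)\<^sup>2" using m by (simp add: power2_eq_square)
    finally show ?thesis by (simp add: abs_le_square_iff[symmetric] power2_abs)
  qed
  have "exp ((\<Sum>j<p. (ip m (q j) h)\<^sup>2) / 4)
      \<le> exp (1 / 4) ^ p * (\<Sum>\<nu>\<in>{..<p} \<rightarrow>\<^sub>E ?Z. \<Prod>j<p. ?e (\<nu> j) (ip m (q j) h))"
    if h: "h \<in> signs {..<m}" for h
  proof -
    have "exp ((\<Sum>j<p. (ip m (q j) h)\<^sup>2) / 4) = (\<Prod>j<p. exp ((ip m (q j) h)\<^sup>2 / 4))"
      by (simp add: exp_sum sum_divide_distrib)
    also have "\<dots> \<le> (\<Prod>j<p. exp (1 / 4) * (\<Sum>n\<in>?Z. ?e n (ip m (q j) h)))"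
      using qh h m by (intro prod_mono conjI exp_quarter_square_le_sum) auto
    also have "\<dots> = exp (1 / 4) ^ p * (\<Prod>j<p. \<Sum>n\<in>?Z. ?e n (ip m (q j) h))"
      by (simp add: prod.distrib)
    also have "(\<Prod>j<p. \<Sum>n\<in>?Z. ?e n (ip m (q j) h)) = (\<Sum>\<nu>\<in>{..<p} \<rightarrow>\<^sub>E ?Z. \<Prod>j<p. ?e (\<nu> j) (ip m (q j) h))"
      by (rule prod_sum_PiE) auto
    finally show ?thesis .
  qed
  then have "(\<Sum>h\<in>signs {..<m}. exp ((\<Sum>j<p. (ip m (q j) h)\<^sup>2) / 4))
      \<le> (\<Sum>h\<in>signs {..<m}. exp (1 / 4) ^ p * (\<Sum>\<nu>\<in>{..<p} \<rightarrow>\<^sub>E ?Z. \<Prod>j<p. ?e (\<nu> j) (ip m (q j) h)))"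
    by (rule sum_mono)
  also have "\<dots> = exp (1 / 4) ^ p * (\<Sum>\<nu>\<in>{..<p} \<rightarrow>\<^sub>E ?Z. \<Sum>h\<in>signs {..<m}. \<Prod>j<p. ?e (\<nu> j) (ip m (q j) h))"
    unfolding sum_distrib_left[symmetric] by (subst sum.swap) (rule refl)
  also have "\<dots> \<le> exp (1 / 4) ^ p * (\<Sum>\<nu>\<in>{..<p} \<rightarrow>\<^sub>E ?Z. 2 ^ m * (\<Prod>j<p. exp (- ((real_of_int (\<nu> j))\<^sup>2 / 2))))"
  proof (intro mult_left_mono sum_mono)
    fix \<nu> :: "nat \<Rightarrow> int"
    let ?w = "\<lambda>c. \<Sum>j<p. real_of_int (\<nu> j) * q j c"
    have "(\<Prod>j<p. ?e (\<nu> j) (ip m (q j) h)) = exp (- (\<Sum>j<p. (real_of_int (\<nu> j))\<^sup>2)) * exp (\<Sum>c<m. ?w c * h c)" for h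
    proof -
      have "(\<Sum>c<m. ?w c * h c) = ip m h ?w"
        by (simp add: ip_def mult.commute)
      then have "(\<Sum>c<m. ?w c * h c) = (\<Sum>j<p. real_of_int (\<nu> j) * ip m (q j) h)"
        by (simp add: ip_sum_right ip_commute[of m h "q j" for j])
      then show ?thesis
        by (simp add: exp_sum[symmetric] exp_add[symmetric] sum_subtractf)
    qed
    then have "(\<Sum>h\<in>signs {..<m}. \<Prod>j<p. ?e (\<nu> j) (ip m (q j) h))
        = exp (- (\<Sum>j<p. (real_of_int (\<nu> j))\<^sup>2)) * (\<Sum>h\<in>signs {..<m}. exp (\<Sum>c<m. ?w c * h c))"
      by (simp add: sum_distrib_left)
    also have "\<dots> \<le> exp (- (\<Sum>j<p. (real_of_int (\<nu> j))\<^sup>2)) * (2 ^ card {..<m} * exp ((\<Sum>c<m. (?w c)\<^sup>2) / 2))"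
      by (intro mult_left_mono sum_signs_exp_le) auto
    also have "(\<Sum>c<m. (?w c)\<^sup>2) = (\<Sum>j<p. (real_of_int (\<nu> j))\<^sup>2)"
      using ip_orthonormal_sum[where a = "\<lambda>j. real_of_int (\<nu> j)", OF q] by (simp add: ip_def power2_eq_square)
    also have "exp (- (\<Sum>j<p. (real_of_int (\<nu> j))\<^sup>2)) * (2 ^ card {..<m} * exp ((\<Sum>j<p. (real_of_int (\<nu> j))\<^sup>2) / 2))
        = 2 ^ m * exp (- (\<Sum>j<p. (real_of_int (\<nu> j))\<^sup>2) / 2)"
    proof -
      have "exp (- x) * (M * exp (x / 2)) = M * exp (- x / 2)" for x M :: real
      proof -
        have "exp (- x) * (M * exp (x / 2)) = M * exp (- x + x / 2)" by (simp only: exp_add) simp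
        then show ?thesis by simp
      qed
      then show ?thesis by (simp only: card_lessThan)
    qed
    also have "exp (- (\<Sum>j<p. (real_of_int (\<nu> j))\<^sup>2) / 2) = (\<Prod>j<p. exp (- ((real_of_int (\<nu> j))\<^sup>2 / 2)))"
      by (simp add: exp_sum[symmetric] sum_divide_distrib sum_negf)
    finally show "(\<Sum>h\<in>signs {..<m}. \<Prod>j<p. ?e (\<nu> j) (ip m (q j) h)) \<le> 2 ^ m * (\<Prod>j<p. exp (- ((real_of_int (\<nu> j))\<^sup>2 / 2)))" .
  qed auto
  also have "\<dots> = 2 ^ m * (exp (1 / 4) ^ p * (\<Prod>j<p. \<Sum>n\<in>?Z. exp (- ((real_of_int n)\<^sup>2 / 2))))"
    by (subst prod_sum_PiE) (auto simp: sum_distrib_left mult_ac)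
  also have "\<dots> = 2 ^ m * (exp (1 / 4) * (\<Sum>n\<in>?Z. exp (- ((real_of_int n)\<^sup>2 / 2)))) ^ p"
    by (simp add: power_mult_distrib)
  also have "\<dots> \<le> 2 ^ m * 6 ^ p"
  proof (intro mult_left_mono power_mono)
    have "exp (1 / 4 :: real) \<le> 21 / 16"
      using exp_bound[of "1 / 4 :: real"] by (simp add: power2_eq_square)
    then have "exp (1 / 4) * (\<Sum>n\<in>?Z. exp (- ((real_of_int n)\<^sup>2 / 2))) \<le> 21 / 16 * (21 / 5)"
      using sum_exp_neg_half_square_le by (intro mult_mono) (auto intro: sum_nonneg)
    then show "exp (1 / 4) * (\<Sum>n\<in>?Z. exp (- ((real_of_int n)\<^sup>2 / 2))) \<le> 6" by simp
  qed (auto intro!: mult_nonneg_nonneg sum_nonneg)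
  finally show ?thesis .
qed

text \<open>Markov's inequality for the exponential moment: \<open>6 ^ p\<close> is at most
  \<open>exp (m / 10)\<close>, while each counted vector contributes at least
  \<open>exp (3 * m / 16)\<close>.\<close>

lemma card_signs_near_subspace_le:
  assumes m: "m > 0" and q: "\<And>i j. i < p \<Longrightarrow> j < p \<Longrightarrow> ip m (q i) (q j) = of_bool (i = j)"
    and p: "20 * p \<le> m"
  shows "card {h \<in> signs {..<m}. (\<Sum>j<p. (ip m (q j) h)\<^sup>2) > 3 / 4 * m} \<le> exp (- (m / 20)) * 2 ^ m"
proof -
  let ?A = "{h \<in> signs {..<m}. (\<Sum>j<p. (ip m (q j) h)\<^sup>2) > 3 / 4 * m}"
  have "real (card ?A) * exp (3 * m / 16) = (\<Sum>h\<in>?A. exp (3 * m / 16))" by simp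
  also have "\<dots> \<le> (\<Sum>h\<in>?A. exp ((\<Sum>j<p. (ip m (q j) h)\<^sup>2) / 4))"
    by (intro sum_mono) auto
  also have "\<dots> \<le> (\<Sum>h\<in>signs {..<m}. exp ((\<Sum>j<p. (ip m (q j) h)\<^sup>2) / 4))"
    by (intro sum_mono2) auto
  also have "\<dots> \<le> 2 ^ m * 6 ^ p"
    by (rule sum_signs_exp_projection_le[OF m q])
  also have "\<dots> \<le> 2 ^ m * exp (m / 10)"
  proof (intro mult_left_mono)
    have "(13 / 8) ^ 4 \<le> exp (1 / 2 :: real) ^ 4"
      using exp_lower_Taylor_quadratic[of "1 / 2 :: real"] by (intro power_mono) (auto simp: power2_eq_square)
    also have "exp (1 / 2 :: real) ^ 4 = exp 2"
      by (simp add: exp_of_nat_mult[symmetric])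
    finally have "(6::real) ^ p \<le> exp 2 ^ p"
      by (intro power_mono) (auto simp: power4_eq_xxxx)
    also have "\<dots> = exp (2 * real p)"
      by (simp add: exp_of_nat_mult[symmetric] mult.commute)
    also have "\<dots> \<le> exp (m / 10)"
      using p by simp
    finally show "(6::real) ^ p \<le> exp (m / 10)" .
  qed auto
  finally have "real (card ?A) \<le> 2 ^ m * exp (m / 10) / exp (3 * m / 16)"
    by (simp add: pos_le_divide_eq)
  also have "\<dots> = 2 ^ m * exp (m / 10 - 3 * m / 16)"
    by (simp only: exp_diff times_divide_eq_right)
  also have "\<dots> \<le> 2 ^ m * exp (- (m / 20))"
    by (intro mult_left_mono) auto
  finally show ?thesis by (simp add: mult.commute)
qed

text \<open>Greedy choice: \<open>H\<close> is too large to consist of vectors close to the span of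
  those already chosen, so it contains one at squared distance at least \<open>m / 4\<close> from
  it. Gram-Schmidt turns this vector into the next \<open>q\<close>, and the distance is its
  coefficient there.\<close>

lemma exists_spread_family:
  assumes m: "m > 0" and H: "H \<subseteq> signs {..<m}" and card: "real (card H) > exp (- (m / 20)) * 2 ^ m"
    and l: "20 * l \<le> m"
  shows "\<exists>h q. (\<forall>i<l. h i \<in> H) \<and>
    (\<forall>i<l. \<forall>j<l. ip m (q i) (q j) = of_bool (i = j)) \<and>
    (\<forall>i<l. \<forall>c<m. h i c = (\<Sum>j<Suc i. ip m (q j) (h i) * q j c)) \<and>
    (\<forall>i<l. real m / 4 \<le> (ip m (q i) (h i))\<^sup>2)"
  using l
proof (induction l)
  case 0
  then show ?case by simp
next
  case (Suc l)
  then obtain h q where hq: "\<forall>i<l. h i \<in> H" "\<forall>i<l. \<forall>j<l. ip m (q i) (q j) = of_bool (i = j)"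
    "\<forall>i<l. \<forall>c<m. h i c = (\<Sum>j<Suc i. ip m (q j) (h i) * q j c)"
    "\<forall>i<l. real m / 4 \<le> (ip m (q i) (h i))\<^sup>2"
    by auto
  let ?A = "{h \<in> signs {..<m}. (\<Sum>j<l. (ip m (q j) h)\<^sup>2) > 3 / 4 * m}"
  have "\<not> H \<subseteq> ?A"
  proof
    assume "H \<subseteq> ?A"
    then have "card H \<le> card ?A" by (intro card_mono) auto
    moreover have "real (card ?A) \<le> exp (- (m / 20)) * 2 ^ m"
      using hq(2) Suc.prems by (intro card_signs_near_subspace_le m) auto
    ultimately show False using card by linarith
  qed
  then obtain x where x: "x \<in> H" "x \<in> signs {..<m}" "(\<Sum>j<l. (ip m (q j) x)\<^sup>2) \<le> 3 / 4 * m"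
    using H by fastforce
  \<comment> \<open>The component of \<open>x\<close> orthogonal to the earlier directions; its
    squared length is \<open>m\<close> minus that of the projection.\<close>
  define w where "w = (\<lambda>c. x c - (\<Sum>j<l. ip m (q j) x * q j c))"
  have "x c * x c = 1" if "c < m" for c
    using signs_cases[OF x(2), of c] that by auto
  then have xx: "ip m x x = m" by (simp add: ip_def)
  have w_alt: "w = (\<lambda>c. x c + (-1) * (\<Sum>j<l. ip m (q j) x * q j c))"
    by (simp add: w_def)
  have yw: "ip m y w = ip m y x - (\<Sum>j<l. ip m (q j) x * ip m y (q j))" for y
    unfolding w_alt ip_add_scale_right ip_sum_right by simp
  have qw: "ip m (q i) w = 0" if "i < l" for i
  proof -
    have "ip m (q i) w = ip m (q i) x - (\<Sum>j<l. ip m (q j) x * ip m (q i) (q j))"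
      by (rule yw)
    also have "(\<Sum>j<l. ip m (q j) x * ip m (q i) (q j)) = (\<Sum>j<l. if i = j then ip m (q j) x else 0)"
      using hq(2) that by (intro sum.cong) auto
    finally show ?thesis using that by simp
  qed
  have xw: "ip m x w = ip m w w"
  proof -
    have "ip m w w = ip m w x - (\<Sum>j<l. ip m (q j) x * ip m w (q j))"
      by (rule yw)
    also have "(\<Sum>j<l. ip m (q j) x * ip m w (q j)) = 0"
      using qw by (intro sum.neutral) (auto simp: ip_commute[of m w "q j" for j])
    finally show ?thesis by (simp add: ip_commute)
  qed
  have "ip m x w = ip m x x - (\<Sum>j<l. (ip m (q j) x)\<^sup>2)"
    unfolding yw by (simp add: ip_commute[of m x "q j" for j] power2_eq_square)
  then have ww: "ip m w w \<ge> m / 4" using x(3) xx xw by simp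
  then have ww0: "ip m w w > 0" using m by (simp add: less_le_trans)
  define u where "u = (\<lambda>c. (1 / sqrt (ip m w w)) * w c)"
  have yu: "ip m y u = (1 / sqrt (ip m w w)) * ip m y w" for y
    unfolding u_def ip_scale_right ..
  have qu: "ip m (q i) u = 0" if "i < l" for i
    unfolding yu using qw[OF that] by simp
  have uu: "ip m u u = 1"
    unfolding yu[of u] ip_commute[of m u w] yu[of w] using ww0 by (simp add: field_simps)
  have ux: "ip m u x = sqrt (ip m w w)"
    unfolding ip_commute[of m u x] yu[of x] xw using ww0 by (simp add: real_div_sqrt)
  have x_exp: "x c = (\<Sum>j<l. ip m (q j) x * q j c) + ip m u x * u c" for c
    unfolding ux using ww0 by (simp add: u_def w_def)
  let ?h = "h(l := x)" and ?q = "q(l := u)"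
  have "\<forall>i<Suc l. ?h i \<in> H" using hq(1) x(1) by (auto simp: less_Suc_eq)
  moreover have "\<forall>i<Suc l. \<forall>j<Suc l. ip m (?q i) (?q j) = of_bool (i = j)"
    using hq(2) qu uu by (auto simp: less_Suc_eq ip_commute[of m u "q j" for j])
  moreover have "\<forall>i<Suc l. \<forall>c<m. ?h i c = (\<Sum>j<Suc i. ip m (?q j) (?h i) * ?q j c)"
  proof (intro allI impI)
    fix i c assume "i < Suc l" "c < m"
    show "?h i c = (\<Sum>j<Suc i. ip m (?q j) (?h i) * ?q j c)"
    proof (cases "i = l")
      case True
      have "(\<Sum>j<l. ip m (?q j) x * ?q j c) = (\<Sum>j<l. ip m (q j) x * q j c)"
        by (intro sum.cong) auto
      then show ?thesis using True x_exp[of c] by simp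
    next
      case False
      then have "i < l" using \<open>i < Suc l\<close> by simp
      have "(\<Sum>j<Suc i. ip m (?q j) (?h i) * ?q j c) = (\<Sum>j<Suc i. ip m (q j) (h i) * q j c)"
        using \<open>i < l\<close> by (intro sum.cong) auto
      then show ?thesis using hq(3) \<open>i < l\<close> \<open>c < m\<close> by simp
    qed
  qed
  moreover have "\<forall>i<Suc l. real m / 4 \<le> (ip m (?q i) (?h i))\<^sup>2"
    using hq(4) ux ww ww0 by (auto simp: less_Suc_eq)
  ultimately show ?case by blast
qed

section \<open>Anticoncentration of the inner product on rectangles\<close>

text \<open>For negative \<open>x = - t\<close> one has \<open>exp x \<le> 1 / (1 + t)\<close>, and
  \<open>(1 - t + t\<^sup>2) * (1 + t) = 1 + t ^ 3\<close>.\<close>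

lemma exp_le_one_plus_square:
  fixes x :: real
  assumes "\<bar>x\<bar> \<le> 1"
  shows "exp x \<le> 1 + x + x\<^sup>2"
proof (cases "x \<ge> 0")
  case True
  then show ?thesis using exp_bound assms by auto
next
  case False
  define t where "t = - x"
  have t: "0 \<le> t" using False by (simp add: t_def)
  have "exp x \<le> inverse (1 + t)"
  proof -
    have "inverse (exp t) \<le> inverse (1 + t)"
      using exp_ge_add_one_self[of t] t by (intro le_imp_inverse_le) auto
    then show ?thesis by (simp add: t_def exp_minus)
  qed
  also have "\<dots> \<le> 1 - t + t\<^sup>2"
  proof -
    have "1 \<le> (1 - t + t\<^sup>2) * (1 + t)"
      using t by (simp add: algebra_simps power2_eq_square)
    then have "1 / (1 + t) \<le> 1 - t + t\<^sup>2"
      using t by (simp add: pos_divide_le_eq)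
    then show ?thesis by (simp add: inverse_eq_divide)
  qed
  finally show ?thesis by (simp add: t_def)
qed

text \<open>If few columns have a mean over \<open>A\<close> above \<open>\<tau>\<close>, the
  trivial bound serves for them. Otherwise they contain a spread family of \<open>l\<close> vectors,
  whose cosines have a sum with large mean over \<open>A\<close>. A Riesz product controls the
  exponential of that sum over all sign vectors, so \<open>A\<close> must be small.\<close>

lemma sum_cos_rectangle_le:
  fixes l m N :: nat and f \<tau> \<alpha> :: real
  assumes l: "l > 0" and m: "m = 20 * l" and N: "N > 0" and \<tau>: "0 < \<tau>" "\<tau> \<le> 1" and f: "0 \<le> f"
    and freq: "exp (- (f\<^sup>2 * m / 64)) \<le> \<tau> / 4" and fN: "l * f \<le> sqrt N"
    and A: "A \<subseteq> signs ({..<m} \<times> {..<N})" and B: "B \<subseteq> signs {..<m}"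
  shows "(\<Sum>g\<in>A. \<Sum>h\<in>B. cos (f * lin m N h g + \<alpha>))
    \<le> \<tau> * (card A * card B) + exp (- (\<tau>\<^sup>2 * l / 8)) * (2 ^ (m * N) * 2 ^ m)"
proof -
  let ?G = "signs ({..<m} \<times> {..<N})"
  define c where "c = (\<lambda>h g. cos (f * lin m N h g + \<alpha>))"
  define B' where "B' = {h \<in> B. (\<Sum>g\<in>A. c h g) > \<tau> * card A}"
  have finA: "finite A" using A by (rule finite_subset) simp
  have finB: "finite B" using B by (rule finite_subset) simp
  have "card A \<le> 2 ^ (m * N)" using card_mono[OF _ A] by (simp add: card_signs)
  then have "real (card A) \<le> real (2 ^ (m * N))" by (simp only: of_nat_le_iff)
  then have cardA: "real (card A) \<le> 2 ^ (m * N)" by simp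
  have "card B \<le> 2 ^ m" using card_mono[OF _ B] by (simp add: card_signs)
  then have "real (card B) \<le> real (2 ^ m)" by (simp only: of_nat_le_iff)
  then have cardB: "real (card B) \<le> 2 ^ m" by simp
  have c_le: "(\<Sum>g\<in>A. c h g) \<le> card A" for h
    using sum_bounded_above[of A "c h" 1] by (simp add: c_def)
  have swap: "(\<Sum>g\<in>A. \<Sum>h\<in>B. c h g) = (\<Sum>h\<in>B. \<Sum>g\<in>A. c h g)"
    by (rule sum.swap)
  have sq: "\<tau>\<^sup>2 \<le> 1" using \<tau> by (simp add: power_le_one)
  show ?thesis
  proof (cases "real (card B') \<le> exp (- (m / 20)) * 2 ^ m")
    case True
    have "(\<Sum>h\<in>B. \<Sum>g\<in>A. c h g) = (\<Sum>h\<in>B - B'. \<Sum>g\<in>A. c h g) + (\<Sum>h\<in>B'. \<Sum>g\<in>A. c h g)"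
      using finB by (intro sum.subset_diff) (auto simp: B'_def)
    also have "\<dots> \<le> (\<Sum>h\<in>B - B'. \<tau> * card A) + (\<Sum>h\<in>B'. real (card A))"
      by (intro add_mono sum_mono c_le) (auto simp: B'_def)
    also have "\<dots> = \<tau> * (card A * card (B - B')) + card A * card B'"
      by (simp add: mult_ac)
    also have "\<dots> \<le> \<tau> * (card A * card B) + 2 ^ (m * N) * (exp (- (m / 20)) * 2 ^ m)"
    proof (intro add_mono mult_left_mono)
      have "real (card A) * real (card B') \<le> 2 ^ (m * N) * (exp (- (m / 20)) * 2 ^ m)"
        using True cardA by (intro mult_mono) auto
      then show "real (card A * card B') \<le> 2 ^ (m * N) * (exp (- (m / 20)) * 2 ^ m)" by simp
      show "real (card A * card (B - B')) \<le> real (card A * card B)"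
        using finB by (auto intro!: mult_left_mono card_mono)
    qed (use \<tau> in auto)
    also have "2 ^ (m * N) * (exp (- (m / 20)) * 2 ^ m) \<le> exp (- (\<tau>\<^sup>2 * l / 8)) * (2 ^ (m * N) * 2 ^ m)"
    proof -
      have "\<tau>\<^sup>2 * l \<le> 1 * real l" using sq by (intro mult_right_mono) auto
      then have "exp (- (m / 20)) \<le> exp (- (\<tau>\<^sup>2 * l / 8))"
        using m by simp
      then have "exp (- (m / 20)) * (2 ^ (m * N) * 2 ^ m) \<le> exp (- (\<tau>\<^sup>2 * l / 8)) * (2 ^ (m * N) * 2 ^ m)"
        by (intro mult_right_mono) auto
      then show ?thesis by (simp only: mult_ac)
    qed
    finally show ?thesis using swap by (simp add: c_def)
  next
    case False
    have m0: "m > 0" "20 * l \<le> m" and B'_sub: "B' \<subseteq> signs {..<m}" using l m B by (auto simp: B'_def)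
    have "exp (- (m / 20)) * 2 ^ m < real (card B')" using False by simp
    from exists_spread_family[OF m0(1) B'_sub this m0(2)]
    obtain h q where hq: "\<forall>i<l. h i \<in> B'"
      "\<forall>i<l. \<forall>c<m. h i c = (\<Sum>j<Suc i. ip m (q j) (h i) * q j c)"
      "\<forall>i<l. real m / 4 \<le> (ip m (q i) (h i))\<^sup>2"
      by blast
    \<comment> \<open>This size makes the gain \<open>\<mu> * \<tau>\<close> per vector twice the
      loss \<open>\<mu>\<^sup>2 + \<mu> * \<tau> / 4\<close>. The choice of \<open>\<beta>\<close>
      turns \<open>1 + \<mu> * c + \<mu>\<^sup>2\<close> into
      \<open>(1 + \<mu>\<^sup>2) * (1 + \<beta> * c)\<close>.\<close>
    define \<mu> where "\<mu> = \<tau> / 4"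
    define \<beta> where "\<beta> = \<mu> / (1 + \<mu>\<^sup>2)"
    have \<mu>: "0 < \<mu>" "\<mu> \<le> 1" using \<tau> by (auto simp: \<mu>_def)
    have \<mu>1: "1 + \<mu>\<^sup>2 > 0" by (simp add: add_pos_nonneg)
    have \<beta>: "0 \<le> \<beta>" "\<beta> \<le> \<mu>" using \<mu> \<mu>1 by (auto simp: \<beta>_def pos_divide_le_eq)
    define d where "d = (\<lambda>i c. f * h i c)"
    let ?Y = "\<lambda>g. \<Sum>i<l. c (h i) g"
    let ?u = "\<mu> * (\<tau> * l)"
    have lower: "exp ?u * card A \<le> (\<Sum>g\<in>A. exp (\<mu> * ?Y g))"
    proof -
      have "\<tau> * card A * l = (\<Sum>i<l. \<tau> * card A)" by simp
      also have "\<dots> \<le> (\<Sum>i<l. \<Sum>g\<in>A. c (h i) g)"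
        using hq(1) by (intro sum_mono) (auto simp: B'_def less_imp_le)
      also have "\<dots> = (\<Sum>g\<in>A. ?Y g)" by (rule sum.swap)
      finally have Y: "\<tau> * card A * l \<le> (\<Sum>g\<in>A. ?Y g)" .
      \<comment> \<open>Tangent line of the exponential at \<open>?u\<close>: a large mean of the
        sum gives a large mean of its exponential.\<close>
      have "exp ?u * card A \<le> exp ?u * (card A + (\<mu> * (\<Sum>g\<in>A. ?Y g) - \<mu> * (\<tau> * card A * l)))"
        using \<mu> Y by (intro mult_left_mono) (auto intro: mult_left_mono)
      also have "\<dots> = (\<Sum>g\<in>A. exp ?u * (1 + (\<mu> * ?Y g - ?u)))"
        unfolding sum_distrib_left[symmetric] sum.distrib sum_subtractf by simp
      also have "\<dots> \<le> (\<Sum>g\<in>A. exp (\<mu> * ?Y g))"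
      proof (intro sum_mono)
        fix g
        have "exp ?u * (1 + (\<mu> * ?Y g - ?u)) \<le> exp ?u * exp (\<mu> * ?Y g - ?u)"
          by (intro mult_left_mono exp_ge_add_one_self) auto
        then show "exp ?u * (1 + (\<mu> * ?Y g - ?u)) \<le> exp (\<mu> * ?Y g)"
          by (simp add: exp_add[symmetric])
      qed
      finally show ?thesis .
    qed
    have "exp (\<mu> * ?Y g) \<le> (1 + \<mu>\<^sup>2) ^ l * (\<Prod>i<l. 1 + \<beta> * cos (lin m N (d i) g + \<alpha>))" for g
    proof -
      have "exp (\<mu> * ?Y g) = (\<Prod>i<l. exp (\<mu> * c (h i) g))"
        by (simp add: exp_sum sum_distrib_left)
      also have "\<dots> \<le> (\<Prod>i<l. (1 + \<mu>\<^sup>2) * (1 + \<beta> * c (h i) g))"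
      proof (intro prod_mono conjI)
        fix i
        have c1: "\<bar>c (h i) g\<bar> \<le> 1" by (simp add: c_def)
        have "\<bar>\<mu> * c (h i) g\<bar> \<le> 1"
          unfolding abs_mult using \<mu> c1 mult_le_one[of \<mu> "\<bar>c (h i) g\<bar>"] by simp
        then have "exp (\<mu> * c (h i) g) \<le> 1 + \<mu> * c (h i) g + (\<mu> * c (h i) g)\<^sup>2"
          by (rule exp_le_one_plus_square)
        also have "(\<mu> * c (h i) g)\<^sup>2 \<le> \<mu>\<^sup>2"
          unfolding power_mult_distrib using c1 by (intro mult_left_le) (auto simp: abs_square_le_1)
        also have "1 + \<mu> * c (h i) g + \<mu>\<^sup>2 = (1 + \<mu>\<^sup>2) * (1 + \<beta> * c (h i) g)"
          using \<mu>1 by (simp add: \<beta>_def field_simps)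
        finally show "exp (\<mu> * c (h i) g) \<le> (1 + \<mu>\<^sup>2) * (1 + \<beta> * c (h i) g)" by simp
      qed auto
      also have "\<dots> = (1 + \<mu>\<^sup>2) ^ l * (\<Prod>i<l. 1 + \<beta> * cos (lin m N (d i) g + \<alpha>))"
        by (simp add: prod.distrib c_def d_def lin_scale)
      finally show ?thesis .
    qed
    then have "(\<Sum>g\<in>?G. exp (\<mu> * ?Y g))
        \<le> (1 + \<mu>\<^sup>2) ^ l * (\<Sum>g\<in>?G. \<Prod>i<l. 1 + \<beta> * cos (lin m N (d i) g + \<alpha>))"
      unfolding sum_distrib_left by (intro sum_mono)
    also have "\<dots> \<le> (1 + \<mu>\<^sup>2) ^ l * (2 ^ (m * N) * (1 + \<beta> * (\<tau> / 4)) ^ l)"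
    proof (intro mult_left_mono)
      \<comment> \<open>The Riesz product alone is the case of leading phase and frequency
        0.\<close>
      have "\<bar>\<Sum>g\<in>?G. cos (0 + lin m N (\<lambda>_. 0) g) * (\<Prod>i<l. 1 + \<beta> * cos (lin m N (d i) g + \<alpha>))\<bar>
        \<le> 2 ^ (m * N) * (1 + \<beta> * (\<tau> / 4)) ^ l * exp (- (residual m q l (\<lambda>_. 0) / 4))"
      proof (rule Riesz_product_bound[where \<rho> = "f\<^sup>2 * m / 4"])
        show "exp (- (f\<^sup>2 * m / 4 / 16)) \<le> \<tau> / 4" using freq by simp
        show "d i c = (\<Sum>j<Suc i. ip m (q j) (d i) * q j c)" if "i < l" "c < m" for i c
        proof -
          have "h i c = (\<Sum>j<Suc i. ip m (q j) (h i) * q j c)" using hq(2) that by blast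
          then have "d i c = f * (\<Sum>j<Suc i. ip m (q j) (h i) * q j c)" by (simp add: d_def)
          then show ?thesis by (simp only: d_def ip_scale_right sum_distrib_left mult.assoc)
        qed
        show "f\<^sup>2 * m / 4 \<le> (ip m (q i) (d i))\<^sup>2" if "i < l" for i
        proof -
          have "f\<^sup>2 * (m / 4) \<le> f\<^sup>2 * (ip m (q i) (h i))\<^sup>2"
            using hq(3) that by (intro mult_left_mono) auto
          then show ?thesis by (simp add: d_def ip_scale_right power_mult_distrib)
        qed
        show "\<bar>0\<bar> + (\<Sum>i<l. \<bar>d i c\<bar>) \<le> sqrt N" if "c < m" for c
        proof -
          have "\<bar>d i c\<bar> = f" if "i < l" for i
          proof -
            have "h i \<in> signs {..<m}" using hq(1) that B by (auto simp: B'_def)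
            then show ?thesis using signs_cases[of "h i" "{..<m}" c] \<open>c < m\<close> f by (auto simp: d_def abs_mult)
          qed
          then show ?thesis using fN by simp
        qed
      qed (use N \<beta> \<mu> \<tau> in auto)
      then show "(\<Sum>g\<in>?G. \<Prod>i<l. 1 + \<beta> * cos (lin m N (d i) g + \<alpha>)) \<le> 2 ^ (m * N) * (1 + \<beta> * (\<tau> / 4)) ^ l"
        by (simp add: lin_def residual_def ip_def)
    qed (use \<mu>1 in simp)
    also have "(1 + \<mu>\<^sup>2) ^ l * (2 ^ (m * N) * (1 + \<beta> * (\<tau> / 4)) ^ l)
        \<le> exp (\<mu>\<^sup>2) ^ l * (2 ^ (m * N) * exp (\<mu> * (\<tau> / 4)) ^ l)"
    proof (intro mult_mono power_mono)
      have "\<beta> * (\<tau> / 4) \<le> \<mu> * (\<tau> / 4)" using \<beta> \<tau> by (intro mult_right_mono) auto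
      then show "1 + \<beta> * (\<tau> / 4) \<le> exp (\<mu> * (\<tau> / 4))"
        using exp_ge_add_one_self[of "\<mu> * (\<tau> / 4)"] by linarith
    qed (use \<beta> \<tau> \<mu>1 in \<open>auto intro!: exp_ge_add_one_self mult_nonneg_nonneg add_nonneg_nonneg\<close>)
    also have "\<dots> = 2 ^ (m * N) * exp (\<tau>\<^sup>2 * l / 8)"
      by (simp add: \<mu>_def exp_of_nat_mult[symmetric] exp_add[symmetric] power2_eq_square algebra_simps)
    finally have upper: "(\<Sum>g\<in>?G. exp (\<mu> * ?Y g)) \<le> 2 ^ (m * N) * exp (\<tau>\<^sup>2 * l / 8)"
      by simp
    have "exp ?u * card A \<le> 2 ^ (m * N) * exp (\<tau>\<^sup>2 * l / 8)"
      using lower upper sum_mono2[of ?G A "\<lambda>g. exp (\<mu> * ?Y g)"] A by simp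
    then have "card A \<le> 2 ^ (m * N) * exp (\<tau>\<^sup>2 * l / 8) / exp ?u"
      by (simp add: pos_le_divide_eq mult.commute)
    also have "\<dots> = 2 ^ (m * N) * exp (\<tau>\<^sup>2 * l / 8 - ?u)"
      by (simp only: exp_diff times_divide_eq_right)
    also have "\<tau>\<^sup>2 * l / 8 - ?u = - (\<tau>\<^sup>2 * l / 8)"
      by (simp add: \<mu>_def power2_eq_square)
    finally have "real (card A) * card B \<le> (2 ^ (m * N) * exp (- (\<tau>\<^sup>2 * l / 8))) * 2 ^ m"
      using cardB by (intro mult_mono) auto
    moreover have "(\<Sum>h\<in>B. \<Sum>g\<in>A. c h g) \<le> real (card A) * card B"
      using sum_bounded_above[of B "\<lambda>h. \<Sum>g\<in>A. c h g" "real (card A)"] c_le by (simp add: mult.commute)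
    moreover have "0 \<le> \<tau> * (card A * card B)" using \<tau> by simp
    ultimately show ?thesis using swap by (simp add: c_def mult_ac)
  qed
qed

section \<open>Smoothing with the Fejer kernel\<close>

definition fejer :: "nat \<Rightarrow> real \<Rightarrow> real \<Rightarrow> real" where
  "fejer L \<theta> s = (\<Sum>a<L. \<Sum>b<L. cos ((real a - real b) * \<theta> * s)) / (real L)\<^sup>2"

text \<open>The kernel is the squared modulus of the exponential sum with phases
  \<open>a * \<theta> * s\<close>, divided by \<open>L\<^sup>2\<close>.\<close>

lemma fejer_alt: "fejer L \<theta> s = ((\<Sum>a<L. cos (real a * \<theta> * s))\<^sup>2 + (\<Sum>a<L. sin (real a * \<theta> * s))\<^sup>2) / (real L)\<^sup>2"
  unfolding fejer_def power2_eq_square[of "sum _ _"] sum_product sum.distrib[symmetric]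
  by (simp add: cos_diff left_diff_distrib)

lemma fejer_nonneg: "fejer L \<theta> s \<ge> 0"
  unfolding fejer_alt by simp

text \<open>All phases are at most 1/2 in modulus, where the cosine is at least 7/8, and the square
  of 7/8 exceeds 3/4.\<close>

lemma fejer_ge:
  assumes L: "L > 0" and s: "real L * \<theta> * \<bar>s\<bar> \<le> 1 / 2" and \<theta>: "\<theta> \<ge> 0"
  shows "fejer L \<theta> s \<ge> 3 / 4"
proof -
  have cos_ge: "cos x \<ge> 7 / 8" if "\<bar>x\<bar> \<le> 1 / 2" for x :: real
  proof -
    have "\<bar>sin (x / 2)\<bar> \<le> 1 / 4"
      using abs_sin_x_le_abs_x[of "x / 2"] that by simp
    then have "(sin (x / 2))\<^sup>2 \<le> (1 / 4)\<^sup>2"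
      by (metis abs_ge_zero power2_abs power_mono)
    then show ?thesis
      using cos_double_sin[of "x / 2"] by (simp add: power2_eq_square)
  qed
  have "\<bar>real a * \<theta> * s\<bar> \<le> 1 / 2" if "a < L" for a
  proof -
    have "real a * (\<theta> * \<bar>s\<bar>) \<le> real L * (\<theta> * \<bar>s\<bar>)"
      using that \<theta> by (intro mult_right_mono) auto
    then show ?thesis using s \<theta> by (simp add: abs_mult mult.assoc)
  qed
  then have "(\<Sum>a<L. 7 / 8) \<le> (\<Sum>a<L. cos (real a * \<theta> * s))"
    by (intro sum_mono cos_ge) auto
  then have "7 / 8 * real L \<le> (\<Sum>a<L. cos (real a * \<theta> * s))"
    by simp
  then have "(7 / 8 * real L)\<^sup>2 \<le> (\<Sum>a<L. cos (real a * \<theta> * s))\<^sup>2"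
    by (intro power_mono) auto
  then have "(7 / 8 * real L)\<^sup>2 / (real L)\<^sup>2 \<le> fejer L \<theta> s"
    unfolding fejer_alt by (intro divide_right_mono add_increasing2) auto
  moreover have "3 / 4 \<le> (7 / 8 * real L)\<^sup>2 / (real L)\<^sup>2"
    using L by (simp add: power_mult_distrib power2_eq_square)
  ultimately show ?thesis by linarith
qed

text \<open>The diagonal terms of the kernel contribute the density \<open>1 / L\<close>. Each other
  frequency lies between \<open>\<theta>\<close> and \<open>L * \<theta>\<close> in modulus, so the
  cosine bound on rectangles applies to it.\<close>

lemma sum_fejer_rectangle_le:
  fixes l m N L :: nat and \<theta> \<tau> v :: real
  assumes l: "l > 0" and m: "m = 20 * l" and N: "N > 0" and \<tau>: "0 < \<tau>" "\<tau> \<le> 1" and L: "L > 0" and \<theta>: "0 \<le> \<theta>"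
    and freq: "exp (- (\<theta>\<^sup>2 * m / 64)) \<le> \<tau> / 4" and fN: "l * (L * \<theta>) \<le> sqrt N"
    and A: "A \<subseteq> signs ({..<m} \<times> {..<N})" and B: "B \<subseteq> signs {..<m}"
  shows "(\<Sum>g\<in>A. \<Sum>h\<in>B. fejer L \<theta> (lin m N h g - v))
    \<le> (1 / L + \<tau>) * (card A * card B) + exp (- (\<tau>\<^sup>2 * l / 8)) * (2 ^ (m * N) * 2 ^ m)"
proof -
  let ?n = "real (card A * card B)"
  let ?E = "exp (- (\<tau>\<^sup>2 * l / 8)) * (2 ^ (m * N) * 2 ^ m)"
  let ?S = "\<lambda>a b. \<Sum>g\<in>A. \<Sum>h\<in>B. cos ((real a - real b) * \<theta> * (lin m N h g - v))"
  have E0: "0 \<le> ?E" by simp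
  have S: "?S a b \<le> (if a = b then ?n else 0) + (\<tau> * ?n + ?E)" if "a < L" "b < L" for a b
  proof (cases "a = b")
    case True
    then show ?thesis using \<tau> by simp
  next
    case False
    define f where "f = \<bar>real a - real b\<bar> * \<theta>"
    have ab: "1 \<le> \<bar>real a - real b\<bar>" "\<bar>real a - real b\<bar> \<le> L" using that False by linarith+
    have f: "\<theta> \<le> f" "f \<le> L * \<theta>" using mult_right_mono[OF ab(1) \<theta>] mult_right_mono[OF ab(2) \<theta>] by (auto simp: f_def)
    have "cos ((real a - real b) * \<theta> * (lin m N h g - v)) = cos (f * lin m N h g + - (f * v))" for h g
    proof -
      have "cos ((real a - real b) * \<theta> * x) = cos (f * x)" for x
      proof (cases "real a \<ge> real b")
        case False
        then have "f * x = - ((real a - real b) * \<theta> * x)" by (simp add: f_def algebra_simps)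
        then show ?thesis by (metis cos_minus)
      qed (simp add: f_def)
      then show ?thesis by (metis right_diff_distrib diff_conv_add_uminus)
    qed
    then have "?S a b = (\<Sum>g\<in>A. \<Sum>h\<in>B. cos (f * lin m N h g + - (f * v)))" by simp
    also have "\<dots> \<le> \<tau> * ?n + ?E"
    proof -
      have "exp (- (f\<^sup>2 * m / 64)) \<le> exp (- (\<theta>\<^sup>2 * m / 64))"
        using f \<theta> by (auto intro!: divide_right_mono mult_right_mono power_mono)
      then have 1: "exp (- (f\<^sup>2 * m / 64)) \<le> \<tau> / 4" using freq by linarith
      have "l * f \<le> l * (L * \<theta>)" using f by (intro mult_left_mono) auto
      then have 2: "l * f \<le> sqrt N" using fN by linarith
      show ?thesis
        using sum_cos_rectangle_le[OF l m N \<tau> _ 1 2 A B, of "- (f * v)"] f \<theta> by linarith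
    qed
    finally show ?thesis using False by simp
  qed
  have "(\<Sum>g\<in>A. \<Sum>h\<in>B. fejer L \<theta> (lin m N h g - v)) = (\<Sum>a<L. \<Sum>b<L. ?S a b) / (real L)\<^sup>2"
  proof -
    have "(\<Sum>g\<in>A. \<Sum>h\<in>B. fejer L \<theta> (lin m N h g - v))
      = (\<Sum>g\<in>A. \<Sum>h\<in>B. \<Sum>a<L. \<Sum>b<L. cos ((real a - real b) * \<theta> * (lin m N h g - v))) / (real L)\<^sup>2"
      by (simp add: fejer_def sum_divide_distrib)
    also have "(\<Sum>g\<in>A. \<Sum>h\<in>B. \<Sum>a<L. \<Sum>b<L. cos ((real a - real b) * \<theta> * (lin m N h g - v)))
      = (\<Sum>g\<in>A. \<Sum>a<L. \<Sum>h\<in>B. \<Sum>b<L. cos ((real a - real b) * \<theta> * (lin m N h g - v)))"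
      by (intro sum.cong refl sum.swap)
    also have "\<dots> = (\<Sum>a<L. \<Sum>g\<in>A. \<Sum>h\<in>B. \<Sum>b<L. cos ((real a - real b) * \<theta> * (lin m N h g - v)))"
      by (rule sum.swap)
    also have "\<dots> = (\<Sum>a<L. \<Sum>g\<in>A. \<Sum>b<L. \<Sum>h\<in>B. cos ((real a - real b) * \<theta> * (lin m N h g - v)))"
      by (intro sum.cong refl sum.swap)
    also have "\<dots> = (\<Sum>a<L. \<Sum>b<L. ?S a b)"
      by (intro sum.cong refl sum.swap)
    finally show ?thesis .
  qed
  also have "\<dots> \<le> (\<Sum>a<L. \<Sum>b<L. (if a = b then ?n else 0) + (\<tau> * ?n + ?E)) / (real L)\<^sup>2"
    by (intro divide_right_mono sum_mono S) auto
  also have "(\<Sum>a<L. \<Sum>b<L. (if a = b then ?n else 0) + (\<tau> * ?n + ?E)) = L * ?n + (real L)\<^sup>2 * (\<tau> * ?n + ?E)"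
    by (simp add: sum.distrib power2_eq_square algebra_simps)
  also have "(L * ?n + (real L)\<^sup>2 * (\<tau> * ?n + ?E)) / (real L)\<^sup>2 = (1 / L + \<tau>) * ?n + ?E"
  proof -
    have "(L * x + (real L)\<^sup>2 * y) / (real L)\<^sup>2 = x / L + y" for x y :: real
      using L by (simp add: power2_eq_square field_simps)
    then have "(L * ?n + (real L)\<^sup>2 * (\<tau> * ?n + ?E)) / (real L)\<^sup>2 = ?n / L + (\<tau> * ?n + ?E)"
      by (simp only:)
    then show ?thesis by (simp add: distrib_right)
  qed
  finally show ?thesis .
qed

section \<open>Well-conditioned subspaces\<close>

text \<open>Padded with zero rows, the \<open>p\<close> conditions form a singular square matrix,
  and a kernel vector of it is normalised.\<close>

lemma exists_unit_orthogonal: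
  assumes "p < k"
  shows "\<exists>y. ip k y y = 1 \<and> (\<forall>j<p. ip k (v j) y = 0)"
proof -
  define M where "M = mat k k (\<lambda>(i, c). if i < p then v i c else (0::real))"
  have M: "M \<in> carrier_mat k k" by (simp add: M_def)
  have "det M = (\<Sum>j<k. M $$ (p, j) * cofactor M p j)"
    by (rule laplace_expansion_row[OF M assms])
  also have "\<dots> = 0"
    using assms by (intro sum.neutral) (auto simp: M_def)
  finally obtain w where w: "w \<in> carrier_vec k" "w \<noteq> 0\<^sub>v k" "M *\<^sub>v w = 0\<^sub>v k"
    using det_0_iff_vec_prod_zero_field[OF M] by blast
  define z where "z = (\<lambda>c. w $ c)"
  have vz: "ip k (v j) z = 0" if "j < p" for j
  proof -
    have "(M *\<^sub>v w) $ j = 0" using w(3) that assms by simp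
    moreover have "(M *\<^sub>v w) $ j = ip k (v j) z"
      using that assms w(1) by (auto simp: M_def ip_def z_def scalar_prod_def lessThan_atLeast0 intro!: sum.cong)
    ultimately show ?thesis by simp
  qed
  have "\<exists>c<k. w $ c \<noteq> 0"
    using w(1,2) by (metis carrier_vecD eq_vecI index_zero_vec(1) index_zero_vec(2))
  then obtain c where "c < k" "z c \<noteq> 0" by (auto simp: z_def)
  then have zz: "ip k z z > 0"
    unfolding ip_def by (intro sum_pos2[of _ c]) (auto simp: zero_less_mult_iff)
  define y where "y = (\<lambda>c. (1 / sqrt (ip k z z)) * z c)"
  have uy: "ip k u y = (1 / sqrt (ip k z z)) * ip k u z" for u
    unfolding y_def by (rule ip_scale_right)
  have "ip k y y = 1"
    unfolding uy[of y] ip_commute[of k y z] uy[of z] using zz by (simp add: field_simps)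
  moreover have "\<forall>j<p. ip k (v j) y = 0" using vz by (simp add: uy)
  ultimately show ?thesis by blast
qed

definition orthonormal :: "nat \<Rightarrow> nat \<Rightarrow> (nat \<Rightarrow> nat \<Rightarrow> real) \<Rightarrow> bool" where
  "orthonormal k n e \<longleftrightarrow> (\<forall>i<n. \<forall>j<n. ip k (e i) (e j) = of_bool (i = j))"

lemma orthonormal_extend:
  assumes "orthonormal k n e" "ip k y y = 1" "\<forall>j<n. ip k (e j) y = 0"
  shows "orthonormal k (Suc n) (e(n := y))"
  using assms by (auto simp: orthonormal_def less_Suc_eq ip_commute[of k y "e j" for j])

lemma orthonormal_extend_basis:
  assumes "orthonormal k r s" "r \<le> k"
  shows "\<exists>e. orthonormal k k e \<and> (\<forall>j<r. e j = s j)"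
proof -
  have "\<exists>e. orthonormal k (r + d) e \<and> (\<forall>j<r. e j = s j)" if "r + d \<le> k" for d
    using that
  proof (induction d)
    case 0
    then show ?case using assms(1) by auto
  next
    case (Suc d)
    then obtain e where e: "orthonormal k (r + d) e" "\<forall>j<r. e j = s j" by auto
    obtain y where y: "ip k y y = 1" "\<forall>j<r + d. ip k (e j) y = 0"
      using exists_unit_orthogonal[of "r + d" k e] Suc.prems by auto
    have "orthonormal k (r + Suc d) (e(r + d := y))"
      using orthonormal_extend[OF e(1) y] by (simp only: add_Suc_right)
    moreover have "\<forall>j<r. (e(r + d := y)) j = s j" using e(2) by auto
    ultimately show ?case by blast
  qed
  from this[of "k - r"] assms(2) show ?thesis by simp
qed

section \<open>Determinants and Hadamard's inequality\<close>

lemma det_square_orthonormal_rows: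
  assumes "orthonormal k k e"
  shows "(det (mat k k (\<lambda>(i, c). e i c)))\<^sup>2 = 1"
proof -
  define U where "U = mat k k (\<lambda>(i, c). e i c)"
  have U: "U \<in> carrier_mat k k" by (simp add: U_def)
  have "U * transpose_mat U = 1\<^sub>m k"
  proof (rule eq_matI)
    fix i j assume "i < dim_row (1\<^sub>m k :: real mat)" "j < dim_col (1\<^sub>m k :: real mat)"
    then have ij: "i < k" "j < k" by auto
    then have "(U * transpose_mat U) $$ (i, j) = ip k (e i) (e j)"
      by (auto simp: U_def ip_def scalar_prod_def lessThan_atLeast0 intro!: sum.cong)
    then show "(U * transpose_mat U) $$ (i, j) = 1\<^sub>m k $$ (i, j)"
      using assms ij by (auto simp: orthonormal_def)
  qed (auto simp: U_def)
  then have "det U * det (transpose_mat U) = 1"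
    using det_mult[OF U, of "transpose_mat U"] U by simp
  then show ?thesis using det_transpose[OF U] by (simp add: U_def power2_eq_square)
qed

text \<open>Hadamard's inequality: an orthonormal basis chosen from the last column backwards makes the
  matrix triangular.\<close>

lemma det_square_le_prod_columns:
  assumes M: "M \<in> carrier_mat k k"
  shows "(det M)\<^sup>2 \<le> (\<Prod>j<k. ip k (\<lambda>i. M $$ (i, j)) (\<lambda>i. M $$ (i, j)))"
proof -
  define c where "c = (\<lambda>j i. M $$ (i, j))"
  \<comment> \<open>The vector \<open>v t\<close> is made orthogonal to all columns before column
    \<open>k - 1 - t\<close>. In reversed order these vectors are the rows of \<open>U\<close>,
    which makes \<open>U * M\<close> upper triangular.\<close>
  have "\<exists>v. orthonormal k n v \<and> (\<forall>t<n. \<forall>j. t + j + 1 < k \<longrightarrow> ip k (c j) (v t) = 0)" if "n \<le> k" for n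
    using that
  proof (induction n)
    case 0
    then show ?case by (simp add: orthonormal_def)
  next
    case (Suc n)
    then obtain v where v: "orthonormal k n v" "\<forall>t<n. \<forall>j. t + j + 1 < k \<longrightarrow> ip k (c j) (v t) = 0"
      by auto
    \<comment> \<open>There are \<open>n\<close> earlier vectors and \<open>k - 1 - n\<close>
      columns to avoid, \<open>k - 1\<close> conditions in all.\<close>
    obtain y where y: "ip k y y = 1" "\<forall>j<k - 1. ip k (if j < n then v j else c (j - n)) y = 0"
      using exists_unit_orthogonal[of "k - 1" k "\<lambda>j. if j < n then v j else c (j - n)"] Suc.prems by auto
    have "ip k (v j) y = 0" if "j < n" for j
      using y(2)[rule_format, of j] that Suc.prems by simp
    then have "orthonormal k (Suc n) (v(n := y))"
      using v(1) y(1) by (intro orthonormal_extend) auto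
    moreover have "ip k (c j) y = 0" if "n + j + 1 < k" for j
      using y(2)[rule_format, of "n + j"] that by simp
    then have "\<forall>t<Suc n. \<forall>j. t + j + 1 < k \<longrightarrow> ip k (c j) ((v(n := y)) t) = 0"
      using v(2) by (auto simp: less_Suc_eq)
    ultimately show ?case by blast
  qed
  from this[of k] obtain v where v: "orthonormal k k v"
    "\<And>t j. t + j + 1 < k \<Longrightarrow> ip k (c j) (v t) = 0" by force
  define u where "u = (\<lambda>i. v (k - 1 - i))"
  have u: "orthonormal k k u"
    using v(1) by (auto simp: orthonormal_def u_def)
  define U where "U = mat k k (\<lambda>(i, c). u i c)"
  have U: "U \<in> carrier_mat k k" by (simp add: U_def)
  have UM: "(U * M) $$ (i, j) = ip k (u i) (c j)" if "i < k" "j < k" for i j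
    using that M by (auto simp: U_def c_def ip_def scalar_prod_def lessThan_atLeast0 intro!: sum.cong)
  have "upper_triangular (U * M)"
  proof (rule upper_triangularI)
    fix i j assume "j < i" "i < dim_row (U * M)"
    then have "i < k" "j < k" using U by auto
    moreover have "ip k (c j) (u i) = 0"
      using \<open>j < i\<close> \<open>i < k\<close> by (auto simp: u_def intro!: v(2))
    ultimately show "(U * M) $$ (i, j) = 0" by (simp add: UM ip_commute)
  qed
  then have "det (U * M) = prod_list (diag_mat (U * M))"
    using U M by (intro det_upper_triangular[of _ k]) auto
  also have "\<dots> = (\<Prod>i<k. (U * M) $$ (i, i))"
    using U prod.distinct_set_conv_list[of "[0..<k]" "\<lambda>i. (U * M) $$ (i, i)"]
    by (simp add: diag_mat_def lessThan_atLeast0)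
  also have "\<dots> = (\<Prod>i<k. ip k (u i) (c i))"
    by (intro prod.cong) (auto simp: UM)
  finally have detUM: "det U * det M = (\<Prod>i<k. ip k (u i) (c i))"
    using det_mult[OF U M] by simp
  have "(det M)\<^sup>2 = (det U)\<^sup>2 * (det M)\<^sup>2"
    using det_square_orthonormal_rows[OF u] by (simp add: U_def)
  also have "\<dots> = (\<Prod>i<k. (ip k (u i) (c i))\<^sup>2)"
    unfolding power_mult_distrib[symmetric] detUM prod_power_distrib ..
  also have "\<dots> \<le> (\<Prod>i<k. ip k (c i) (c i))"
  proof (intro prod_mono conjI)
    fix i assume "i \<in> {..<k}"
    then show "(ip k (u i) (c i))\<^sup>2 \<le> ip k (c i) (c i)"
      using ip_Cauchy_Schwarz[of k "u i" "c i"] u by (simp add: orthonormal_def)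
  qed auto
  finally show ?thesis by (simp add: c_def)
qed

section \<open>Contracted and well-conditioned directions\<close>

definition mv :: "nat \<Rightarrow> (nat \<Rightarrow> nat \<Rightarrow> real) \<Rightarrow> (nat \<Rightarrow> real) \<Rightarrow> nat \<Rightarrow> real" where
  "mv k B y = (\<lambda>i. ip k (B i) y)"

lemma mv_scale: "mv k B (\<lambda>c. e * y c) = (\<lambda>i. e * mv k B y i)"
  by (simp add: mv_def ip_scale_right)

text \<open>Passing to the transpose makes orthogonality of \<open>mv k B y\<close> to a given
  vector a linear condition on \<open>y\<close>.\<close>

lemma ip_mv_right: "ip k x (mv k B y) = ip k (\<lambda>c. \<Sum>i<k. x i * B i c) y"
proof -
  have "ip k x (mv k B y) = (\<Sum>i<k. \<Sum>c<k. x i * B i c * y c)"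
    by (simp add: ip_def mv_def sum_distrib_left mult.assoc)
  also have "\<dots> = (\<Sum>c<k. \<Sum>i<k. x i * B i c * y c)"
    by (rule sum.swap)
  finally show ?thesis by (simp add: ip_def sum_distrib_right)
qed

text \<open>If \<open>r\<close> orthonormal vectors are strongly contracted, Hadamard's inequality forces \<open>r\<close> to be
  small compared with \<open>k\<close>, because the determinant is at least 1.\<close>

lemma card_contracted_le:
  assumes k: "k > 0" and B: "\<And>i j. i < k \<Longrightarrow> j < k \<Longrightarrow> \<bar>B i j\<bar> \<le> 2"
    and det: "1 \<le> (det (mat k k (\<lambda>(i, j). B i j)))\<^sup>2"
    and s: "orthonormal k r s" "r \<le> k" "\<And>j. j < r \<Longrightarrow> ip k (mv k B (s j)) (mv k B (s j)) \<le> 1 / 4"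
  shows "real k \<le> real (k - r) * (2 + log 2 k)"
proof -
  obtain e where e: "orthonormal k k e" "\<And>j. j < r \<Longrightarrow> e j = s j"
    using orthonormal_extend_basis[OF s(1,2)] by blast
  define BM where "BM = mat k k (\<lambda>(i, j). B i j)"
  define E where "E = transpose_mat (mat k k (\<lambda>(i, c). e i c))"
  have BM: "BM \<in> carrier_mat k k" and E: "E \<in> carrier_mat k k" by (simp_all add: BM_def E_def)
  have entry: "(BM * E) $$ (i, j) = mv k B (e j) i" if "i < k" "j < k" for i j
    using that by (auto simp: BM_def E_def mv_def ip_def scalar_prod_def lessThan_atLeast0 intro!: sum.cong)
  \<comment> \<open>Crude bound for the other columns: each row of \<open>B\<close> has squared norm
    at most \<open>4 * k\<close>, and there are \<open>k\<close> rows.\<close>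
  have big: "ip k (mv k B (e j)) (mv k B (e j)) \<le> (2 * real k)\<^sup>2" if "j < k" for j
  proof -
    have "(mv k B (e j) i)\<^sup>2 \<le> 4 * real k" if "i < k" for i
    proof -
      have "B i c * B i c \<le> 4" if "c < k" for c
        using B[OF \<open>i < k\<close> that] abs_le_square_iff[of "B i c" 2] by (simp add: power2_eq_square)
      then have "ip k (B i) (B i) \<le> (\<Sum>c<k. 4)"
        unfolding ip_def by (intro sum_mono) auto
      then have "ip k (B i) (B i) * ip k (e j) (e j) \<le> 4 * real k"
        using e(1) \<open>j < k\<close> by (simp add: orthonormal_def)
      then show ?thesis
        using ip_Cauchy_Schwarz[of k "B i" "e j"] by (simp add: mv_def)
    qed
    then have "ip k (mv k B (e j)) (mv k B (e j)) \<le> (\<Sum>i<k. 4 * real k)"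
      unfolding ip_def by (intro sum_mono) (auto simp: power2_eq_square)
    then show ?thesis by (simp add: power2_eq_square)
  qed
  have "1 \<le> (det BM)\<^sup>2 * (det E)\<^sup>2"
    using det det_square_orthonormal_rows[OF e(1)] det_transpose[of "mat k k (\<lambda>(i, c). e i c)" k]
    by (simp add: BM_def E_def)
  also have "\<dots> = (det (BM * E))\<^sup>2"
    using det_mult[OF BM E] by (simp add: power_mult_distrib)
  also have "\<dots> \<le> (\<Prod>j<k. ip k (\<lambda>i. (BM * E) $$ (i, j)) (\<lambda>i. (BM * E) $$ (i, j)))"
    using BM E by (intro det_square_le_prod_columns) auto
  also have "\<dots> = (\<Prod>j<k. ip k (mv k B (e j)) (mv k B (e j)))"
    by (intro prod.cong) (auto simp: ip_def entry)
  \<comment> \<open>A contracted column has length at most 1/2, any other at most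
    \<open>2 * k\<close>; taking logarithms then bounds \<open>r\<close>.\<close>
  also have "\<dots> \<le> (\<Prod>j<k. if j < r then (1 / 2)\<^sup>2 else (2 * real k)\<^sup>2)"
    using s(3) e(2) big by (intro prod_mono) (auto simp: ip_self_nonneg power2_eq_square)
  also have "\<dots> = ((1 / 2) ^ r * (2 * real k) ^ (k - r))\<^sup>2"
  proof -
    have k_eq: "{..<k} = {..<r} \<union> {r..<k}" using s(2) by auto
    have "(\<Prod>j<k. if j < r then (1 / 2)\<^sup>2 else (2 * real k)\<^sup>2)
      = (\<Prod>j<r. if j < r then (1 / 2)\<^sup>2 else (2 * real k)\<^sup>2) * (\<Prod>j=r..<k. if j < r then (1 / 2)\<^sup>2 else (2 * real k)\<^sup>2)"
      unfolding k_eq by (intro prod.union_disjoint) auto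
    also have "\<dots> = ((1 / 2)\<^sup>2) ^ r * ((2 * real k)\<^sup>2) ^ (k - r)"
      by simp
    also have "(x\<^sup>2) ^ a * (y\<^sup>2) ^ b = (x ^ a * y ^ b)\<^sup>2" for x y :: real and a b :: nat
      by (simp add: power_mult_distrib power_mult[symmetric] mult.commute)
    finally show ?thesis .
  qed
  finally have "1 \<le> (1 / 2) ^ r * (2 * real k) ^ (k - r)"
    using power2_le_imp_le[of 1 "(1 / 2) ^ r * (2 * real k) ^ (k - r)"] by simp
  then have "2 ^ r \<le> (2 * real k) ^ (k - r)"
    by (simp add: power_one_over field_simps)
  then have "log 2 (2 ^ r) \<le> log 2 ((2 * real k) ^ (k - r))"
    using k by (intro log_mono) auto
  moreover have "log 2 ((2 * real k) ^ d) = real d * (1 + log 2 k)" for d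
    using k by (simp add: log_nat_power log_mult distrib_left)
  moreover have "log 2 (2 ^ r) = real r" by simp
  ultimately have "real r \<le> real (k - r) * (1 + log 2 k)"
    by (simp only:)
  moreover have "real k = real r + real (k - r)" using s(2) by simp
  ultimately show ?thesis by (simp only: distrib_left)
qed

text \<open>A maximal orthonormal family of contracted vectors leaves at least \<open>m\<close>
  dimensions, by the determinant bound. On its orthogonal complement \<open>B\<close> shrinks
  lengths by a factor of at most 2; there the \<open>y j\<close> are chosen one by one and rescaled
  so that their images are orthonormal.\<close>

lemma exists_well_conditioned_subspace:
  assumes k: "k > 0" and B: "\<And>i j. i < k \<Longrightarrow> j < k \<Longrightarrow> \<bar>B i j\<bar> \<le> 2"
    and det: "1 \<le> (det (mat k k (\<lambda>(i, j). B i j)))\<^sup>2"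
    and m: "real m * (2 + log 2 k) \<le> k"
  shows "\<exists>u y. orthonormal k m u \<and> (\<forall>j<m. u j = mv k B (y j)) \<and> (\<forall>j<m. ip k (y j) (y j) \<le> 4)"
proof -
  define P where "P = (\<lambda>r. r \<le> k \<and> (\<exists>s. orthonormal k r s \<and>
    (\<forall>j<r. ip k (mv k B (s j)) (mv k B (s j)) \<le> 1 / 4)))"
  define r where "r = (GREATEST r. P r)"
  have P0: "P 0" by (simp add: P_def orthonormal_def)
  have Pk: "\<forall>r. P r \<longrightarrow> r \<le> k" by (simp add: P_def)
  have Pr: "P r" unfolding r_def using P0 Pk by (intro GreatestI_nat[of P 0 k]) auto
  then obtain s where s: "orthonormal k r s" "r \<le> k" "\<And>j. j < r \<Longrightarrow> ip k (mv k B (s j)) (mv k B (s j)) \<le> 1 / 4"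
    by (auto simp: P_def)
  have "real k \<le> real (k - r) * (2 + log 2 k)"
    by (rule card_contracted_le[OF k B det s])
  then have "real m * (2 + log 2 k) \<le> real (k - r) * (2 + log 2 k)" using m by linarith
  moreover have "2 + log 2 k > 0"
    using k by (intro add_pos_nonneg) auto
  ultimately have mr: "m \<le> k - r" by simp
  \<comment> \<open>A unit vector violating this would enlarge the maximal family.\<close>
  have expand: "1 / 4 \<le> ip k (mv k B y) (mv k B y)"
    if "r < k" "ip k y y = 1" "\<forall>j<r. ip k (s j) y = 0" for y
  proof (rule ccontr)
    assume "\<not> ?thesis"
    then have "P (Suc r)"
      unfolding P_def using that orthonormal_extend[OF s(1) that(2,3)] s(3)
      by (intro conjI exI[of _ "s(r := y)"]) (auto simp: less_Suc_eq)
    then have "Suc r \<le> r" unfolding r_def using Pk by (intro Greatest_le_nat[of P _ k]) auto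
    then show False by simp
  qed
  have "\<exists>u y. orthonormal k n u \<and> (\<forall>j<n. u j = mv k B (y j)) \<and> (\<forall>j<n. ip k (y j) (y j) \<le> 4)"
    if "n \<le> m" for n
    using that
  proof (induction n)
    case 0
    then show ?case by (simp add: orthonormal_def)
  next
    case (Suc n)
    then obtain u y where uy: "orthonormal k n u" "\<forall>j<n. u j = mv k B (y j)" "\<forall>j<n. ip k (y j) (y j) \<le> 4"
      by auto
    have nr: "r + n < k" using Suc.prems mr by simp
    \<comment> \<open>The new vector has to be orthogonal to the contracted family and its image to
      the earlier images; through the transpose these are \<open>r + n\<close> linear conditions,
      fewer than \<open>k\<close>.\<close>
    define v where "v = (\<lambda>j. if j < r then s j else (\<lambda>c. \<Sum>i<k. u (j - r) i * B i c))"
    from exists_unit_orthogonal[OF nr, of v]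
    obtain x where x: "ip k x x = 1" "\<forall>j<r + n. ip k (v j) x = 0"
      by blast
    have sx: "\<forall>j<r. ip k (s j) x = 0"
    proof (intro allI impI)
      fix j assume "j < r"
      then show "ip k (s j) x = 0" using x(2)[rule_format, of j] by (simp add: v_def)
    qed
    have ux: "ip k (u j) (mv k B x) = 0" if "j < n" for j
      using x(2)[rule_format, of "r + j"] that by (simp add: ip_mv_right v_def)
    define w where "w = ip k (mv k B x) (mv k B x)"
    have w: "1 / 4 \<le> w" unfolding w_def using nr by (intro expand x(1) sx) auto
    define x' where "x' = (\<lambda>c. (1 / sqrt w) * x c)"
    have mvx': "mv k B x' = (\<lambda>i. (1 / sqrt w) * mv k B x i)"
      unfolding x'_def by (rule mv_scale)
    have "ip k (mv k B x') (mv k B x') = 1"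
    proof -
      have "ip k (mv k B x') (mv k B x') = (1 / sqrt w) * ((1 / sqrt w) * w)"
        unfolding mvx' ip_scale_right w_def
        by (subst ip_commute) (simp only: ip_scale_right)
      then show ?thesis using w by (simp add: field_simps)
    qed
    moreover have "\<forall>j<n. ip k (u j) (mv k B x') = 0"
      unfolding mvx' ip_scale_right using ux by simp
    ultimately have "orthonormal k (Suc n) (u(n := mv k B x'))"
      using uy(1) by (intro orthonormal_extend)
    moreover have "ip k x' x' \<le> 4"
    proof -
      have "ip k x' x' = (1 / sqrt w) * ((1 / sqrt w) * ip k x x)"
        unfolding x'_def ip_scale_right by (subst ip_commute) (simp only: ip_scale_right)
      then have "ip k x' x' = 1 / w" using w x(1) by (simp add: field_simps)
      also have "\<dots> \<le> 1 / (1 / 4)" using w by (intro divide_left_mono) auto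
      finally show ?thesis by simp
    qed
    then have "\<forall>j<Suc n. ip k ((y(n := x')) j) ((y(n := x')) j) \<le> 4"
      using uy(3) by (auto simp: less_Suc_eq)
    moreover have "\<forall>j<Suc n. (u(n := mv k B x')) j = mv k B ((y(n := x')) j)"
      using uy(2) by (auto simp: less_Suc_eq)
    ultimately show ?case by blast
  qed
  then show ?thesis by blast
qed

section \<open>Minors and rank\<close>

definition nonsingular_minor :: "nat \<Rightarrow> (nat \<Rightarrow> nat \<Rightarrow> real) \<Rightarrow> nat \<Rightarrow> (nat \<Rightarrow> nat) \<Rightarrow> (nat \<Rightarrow> nat) \<Rightarrow> bool" where
  "nonsingular_minor d C k r c \<longleftrightarrow>
     (\<forall>i<k. r i < d \<and> c i < d) \<and> det (mat k k (\<lambda>(i, j). C (r i) (c j))) \<noteq> 0"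

lemma mat_delete_mat:
  "mat_delete (mat (Suc k) (Suc k) (\<lambda>(i, j). F i j)) i j
    = mat k k (\<lambda>(i', j'). F (if i' < i then i' else Suc i') (if j' < j then j' else Suc j'))"
  by (rule eq_matI) (auto simp: mat_delete_def)

text \<open>Some cofactor in the expansion along the first row is nonzero.\<close>

lemma nonsingular_minor_decrease:
  assumes "nonsingular_minor d C (Suc k) r c"
  shows "\<exists>r c. nonsingular_minor d C k r c"
proof -
  let ?M = "mat (Suc k) (Suc k) (\<lambda>(i, j). C (r i) (c j))"
  have "det ?M = (\<Sum>j<Suc k. ?M $$ (0, j) * cofactor ?M 0 j)"
    by (rule laplace_expansion_row) auto
  then have "(\<Sum>j<Suc k. ?M $$ (0, j) * cofactor ?M 0 j) \<noteq> 0"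
    using assms by (simp only: nonsingular_minor_def) simp
  then obtain j where j: "j < Suc k" "cofactor ?M 0 j \<noteq> 0"
    by (metis (no_types, lifting) lessThan_iff mult_zero_right sum.neutral)
  let ?c = "\<lambda>j'. c (if j' < j then j' else Suc j')"
  have "det (mat k k (\<lambda>(i', j'). C (r (Suc i')) (?c j'))) \<noteq> 0"
    using j(2) mat_delete_mat[of k "\<lambda>i j. C (r i) (c j)" 0 j] by (simp add: cofactor_def)
  then have "nonsingular_minor d C k (\<lambda>i. r (Suc i)) ?c"
    using assms by (auto simp: nonsingular_minor_def)
  then show ?thesis by blast
qed

lemma nonsingular_minor_le:
  assumes "nonsingular_minor d C K r c" "k \<le> K"
  shows "\<exists>r c. nonsingular_minor d C k r c"
  using assms(2)
proof (induction rule: inc_induct)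
  case base
  then show ?case using assms(1) by blast
next
  case (step n)
  then show ?case using nonsingular_minor_decrease by blast
qed

text \<open>If no minor of size \<open>K + 1\<close> is nonsingular, the vanishing of the bordered minors expresses every
  column through the columns of a nonsingular minor of size \<open>K\<close>.\<close>

lemma column_combination_of_maximal_minor:
  assumes "nonsingular_minor d C K r c" and max: "\<And>r c. \<not> nonsingular_minor d C (Suc K) r c"
  shows "\<exists>b. \<forall>i<d. \<forall>j<d. C i j = (\<Sum>t<K. C i (c t) * b t j)"
proof -
  define D where "D = det (mat K K (\<lambda>(i, j). C (r i) (c j)))"
  have D: "D \<noteq> 0" using assms(1) by (simp add: nonsingular_minor_def D_def)
  \<comment> \<open>The minor bordered by row \<open>i\<close> and column \<open>j\<close>. Its
    cofactors along the last row do not depend on \<open>i\<close>, and the corner one is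
    \<open>D\<close>.\<close>
  define M where "M = (\<lambda>i j. mat (Suc K) (Suc K) (\<lambda>(a, b). C ((r(K := i)) a) ((c(K := j)) b)))"
  have cof: "cofactor (M i j) K t = cofactor (M 0 j) K t" if "t < Suc K" for i j t
  proof -
    have "mat_delete (M i j) K t = mat_delete (M 0 j) K t"
      unfolding M_def mat_delete_mat by (rule eq_matI) auto
    then show ?thesis by (simp add: cofactor_def)
  qed
  have cofK: "cofactor (M i j) K K = D" for i j
  proof -
    have "mat_delete (M i j) K K = mat K K (\<lambda>(i, j). C (r i) (c j))"
      unfolding M_def mat_delete_mat by (rule eq_matI) auto
    then show ?thesis by (simp add: cofactor_def D_def)
  qed
  have "C i j = (\<Sum>t<K. C i (c t) * (- cofactor (M 0 j) K t / D))" if ij: "i < d" "j < d" for i j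
  proof -
    have "\<not> nonsingular_minor d C (Suc K) (r(K := i)) (c(K := j))" by (rule max)
    then have "det (M i j) = 0"
      using assms(1) ij by (auto simp: nonsingular_minor_def M_def less_Suc_eq)
    moreover have "det (M i j) = (\<Sum>t<Suc K. M i j $$ (K, t) * cofactor (M i j) K t)"
      by (rule laplace_expansion_row) (auto simp: M_def)
    moreover have "(\<Sum>t<K. M i j $$ (K, t) * cofactor (M i j) K t) = (\<Sum>t<K. C i (c t) * cofactor (M 0 j) K t)"
      by (intro sum.cong refl) (use cof[of _ i j] in \<open>auto simp: M_def\<close>)
    moreover have "M i j $$ (K, K) = C i j" by (simp add: M_def)
    ultimately have "(\<Sum>t<K. C i (c t) * cofactor (M 0 j) K t) + C i j * D = 0"
      using cofK by simp
    then have "C i j = - (\<Sum>t<K. C i (c t) * cofactor (M 0 j) K t) / D"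
      using D by (simp add: field_simps)
    then show ?thesis by (simp add: sum_negf sum_divide_distrib)
  qed
  then show ?thesis by (intro exI[of _ "\<lambda>t j. - cofactor (M 0 j) K t / D"]) blast
qed

lemma rank_sum_products_le:
  fixes a b :: "nat \<Rightarrow> nat \<Rightarrow> real"
  shows "vec_space.rank d (mat d d (\<lambda>(i, j). \<Sum>t<K. a t i * b t j)) \<le> K"
proof (induction K)
  case 0
  have "mat d d (\<lambda>(i, j). \<Sum>t<0. a t i * b t j) = 0\<^sub>m d d" by (rule eq_matI) auto
  then show ?case by (simp only: vec_space.rank_0I)
next
  case (Suc K)
  let ?A = "mat d d (\<lambda>(i, j). \<Sum>t<K. a t i * b t j)" and ?B = "mat d d (\<lambda>(i, j). a K i * b K j)"
  have "mat d d (\<lambda>(i, j). \<Sum>t<Suc K. a t i * b t j) = ?A + ?B" by (rule eq_matI) auto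
  moreover have "vec_space.rank d (?A + ?B) \<le> vec_space.rank d ?A + vec_space.rank d ?B"
    by (rule vec_space.rank_subadditive) auto
  moreover have "vec_space.rank d ?B \<le> 1"
    by (rule vec_space.rank_le_1_product_entries[of _ _ d "a K" "b K"]) auto
  ultimately show ?case using Suc by simp
qed

section \<open>The mixed second difference matrix\<close>

definition fmat :: "nat \<Rightarrow> (bool list \<Rightarrow> bool list \<Rightarrow> bool) \<Rightarrow> nat \<Rightarrow> nat \<Rightarrow> int" where
  "fmat n f i j = of_bool (f (nth_point n i) (nth_point n j))"

text \<open>The mixed second difference of the communication matrix, based at row and column 0: it is what
  differences of probability distributions see.\<close>

definition fdiff :: "nat \<Rightarrow> (bool list \<Rightarrow> bool list \<Rightarrow> bool) \<Rightarrow> nat \<Rightarrow> nat \<Rightarrow> int" where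
  "fdiff n f i j = fmat n f i j - fmat n f 0 j - fmat n f i 0 + fmat n f 0 0"

lemma abs_fdiff_le: "\<bar>fdiff n f i j\<bar> \<le> 2"
  by (auto simp: fdiff_def fmat_def)

text \<open>A nonsingular minor of size \<open>K\<close> that cannot be enlarged makes the
  difference matrix a sum of \<open>K\<close> products, and the communication matrix a sum of
  \<open>K + 2\<close>. Were the claim false, nonsingular minors of every size would therefore
  exist, in particular of size \<open>fun_rank n f\<close>, where the inequality is trivial.\<close>

lemma exists_large_minor:
  "\<exists>K r c. nonsingular_minor (2 ^ n) (\<lambda>i j. fdiff n f i j) K r c \<and> fun_rank n f \<le> K + 2"
proof (rule ccontr)
  let ?C = "\<lambda>i j. real_of_int (fdiff n f i j)"
  let ?A = "\<lambda>i j. real_of_int (fmat n f i j)"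
  assume neg: "\<not> ?thesis"
  have step: "\<exists>r c. nonsingular_minor (2 ^ n) ?C (Suc K) r c" if "nonsingular_minor (2 ^ n) ?C K r c" for K r c
  proof (rule ccontr)
    assume "\<not> ?thesis"
    then have "\<And>r c. \<not> nonsingular_minor (2 ^ n) ?C (Suc K) r c" by blast
    from column_combination_of_maximal_minor[OF that this]
    obtain b where b: "\<And>i j. i < 2 ^ n \<Longrightarrow> j < 2 ^ n \<Longrightarrow> ?C i j = (\<Sum>t<K. ?C i (c t) * b t j)" by blast
    \<comment> \<open>The products with index \<open>K\<close> and \<open>K + 1\<close> restore what
      the second difference removes: row 0, and column 0 minus its corner.\<close>
    define a where "a = (\<lambda>t i. if t < K then ?C i (c t) else if t = K then 1 else ?A i 0 - ?A 0 0)"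
    define b' where "b' = (\<lambda>t j. if t < K then b t j else if t = K then ?A 0 j else 1)"
    have "comm_matrix n f = mat (2 ^ n) (2 ^ n) (\<lambda>(i, j). \<Sum>t<K + 2. a t i * b' t j)"
    proof (rule eq_matI)
      fix i j assume "i < dim_row (mat (2 ^ n) (2 ^ n) (\<lambda>(i, j). \<Sum>t<K + 2. a t i * b' t j))"
        "j < dim_col (mat (2 ^ n) (2 ^ n) (\<lambda>(i, j). \<Sum>t<K + 2. a t i * b' t j))"
      then have ij: "i < 2 ^ n" "j < 2 ^ n" by auto
      have "(\<Sum>t<K. a t i * b' t j) = ?C i j"
        unfolding b[OF ij] by (intro sum.cong) (auto simp: a_def b'_def)
      then have "(\<Sum>t<K + 2. a t i * b' t j) = ?C i j + ?A 0 j + (?A i 0 - ?A 0 0)"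
        by (simp add: a_def b'_def numeral_2_eq_2)
      also have "\<dots> = ?A i j" by (simp add: fdiff_def)
      finally show "comm_matrix n f $$ (i, j) = mat (2 ^ n) (2 ^ n) (\<lambda>(i, j). \<Sum>t<K + 2. a t i * b' t j) $$ (i, j)"
        using ij by (simp add: comm_matrix_def fmat_def)
    qed (auto simp: comm_matrix_def)
    then have "fun_rank n f \<le> K + 2"
      unfolding fun_rank_def using rank_sum_products_le[where d = "2 ^ n" and K = "K + 2" and a = a and b = b'] by simp
    then show False using neg that by blast
  qed
  have "\<exists>r c. nonsingular_minor (2 ^ n) ?C K r c" for K
  proof (induction K)
    case 0
    have "nonsingular_minor (2 ^ n) ?C 0 id id" by (simp add: nonsingular_minor_def)
    then show ?case by blast
  next
    case (Suc K)
    then show ?case using step by blast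
  qed
  then show False using neg by (metis le_add1)
qed

text \<open>The determinant of an integer matrix is an integer.\<close>

lemma det_int_minor_square_ge:
  fixes D :: "nat \<Rightarrow> nat \<Rightarrow> int"
  assumes "det (mat k k (\<lambda>(i, j). real_of_int (D i j))) \<noteq> 0"
  shows "1 \<le> (det (mat k k (\<lambda>(i, j). real_of_int (D i j))))\<^sup>2"
proof -
  have "mat k k (\<lambda>(i, j). real_of_int (D i j)) = map_mat real_of_int (mat k k (\<lambda>(i, j). D i j))"
    by (rule eq_matI) auto
  then have eq: "det (mat k k (\<lambda>(i, j). real_of_int (D i j))) = real_of_int (det (mat k k (\<lambda>(i, j). D i j)))"
    by (simp add: of_int_hom.hom_det)
  then have "(det (mat k k (\<lambda>(i, j). D i j)))\<^sup>2 > 0"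
    using assms by simp
  then have "1 \<le> (det (mat k k (\<lambda>(i, j). D i j)))\<^sup>2" by linarith
  then show ?thesis unfolding eq by (simp flip: of_int_power)
qed

section \<open>Protocols\<close>

text \<open>Sequential composition: the value at a leaf is known to both parties, so the
  continuation may depend on it.\<close>

primrec graft :: "('a, 'b) protocol \<Rightarrow> (real \<Rightarrow> ('a, 'b) protocol) \<Rightarrow> ('a, 'b) protocol" where
  "graft (Output v) k = k v"
| "graft (Alice s t u) k = Alice s (graft t k) (graft u k)"
| "graft (Bob s t u) k = Bob s (graft t k) (graft u k)"

lemma run_graft: "run (graft t k) a b = run (k (run t a b)) a b"
  by (induction t) auto

lemma comm_cost_graft: "(\<And>v. comm_cost (k v) \<le> d) \<Longrightarrow> comm_cost (graft t k) \<le> comm_cost t + d"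
  by (induction t) (auto simp: max_def)

text \<open>Local preprocessing of both inputs, which costs no communication.\<close>

primrec pull :: "('g \<Rightarrow> 'a) \<Rightarrow> ('h \<Rightarrow> 'b) \<Rightarrow> ('a, 'b) protocol \<Rightarrow> ('g, 'h) protocol" where
  "pull \<alpha> \<beta> (Output v) = Output v"
| "pull \<alpha> \<beta> (Alice s t u) = Alice (s \<circ> \<alpha>) (pull \<alpha> \<beta> t) (pull \<alpha> \<beta> u)"
| "pull \<alpha> \<beta> (Bob s t u) = Bob (s \<circ> \<beta>) (pull \<alpha> \<beta> t) (pull \<alpha> \<beta> u)"

lemma run_pull: "run (pull \<alpha> \<beta> t) g h = run t (\<alpha> g) (\<beta> h)"
  by (induction t) auto

lemma comm_cost_pull: "comm_cost (pull \<alpha> \<beta> t) = comm_cost t"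
  by (induction t) auto

text \<open>The leaves cut the rectangle into at most \<open>2 ^ comm_cost T\<close> rectangles with
  constant output. The main terms add up to that of the whole rectangle, and the error
  \<open>E\<close> is paid once per leaf.\<close>

lemma sum_protocol_le:
  fixes F :: "'g \<Rightarrow> 'h \<Rightarrow> real \<Rightarrow> real" and \<kappa> E :: real
  assumes fin: "finite G" "finite H" and E: "0 \<le> E"
    and R: "\<And>A B v. A \<subseteq> G \<Longrightarrow> B \<subseteq> H \<Longrightarrow> (\<Sum>g\<in>A. \<Sum>h\<in>B. F g h v) \<le> \<kappa> * (card A * card B) + E"
    and "A \<subseteq> G" "B \<subseteq> H"
  shows "(\<Sum>g\<in>A. \<Sum>h\<in>B. F g h (run T g h)) \<le> \<kappa> * (card A * card B) + 2 ^ comm_cost T * E"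
  using assms(5,6)
proof (induction T arbitrary: A B)
  case (Output v)
  then show ?case using R by simp
next
  case (Alice s t u)
  have finA: "finite A" using Alice.prems fin finite_subset by blast
  let ?A1 = "{g \<in> A. s g}" and ?A2 = "{g \<in> A. \<not> s g}"
  have A: "A = ?A1 \<union> ?A2" "?A1 \<inter> ?A2 = {}" by auto
  have card: "card A = card ?A1 + card ?A2"
    using finA card_Un_disjoint[of ?A1 ?A2] A by simp
  have "(\<Sum>g\<in>A. \<Sum>h\<in>B. F g h (run (Alice s t u) g h))
      = (\<Sum>g\<in>?A1. \<Sum>h\<in>B. F g h (run (Alice s t u) g h)) + (\<Sum>g\<in>?A2. \<Sum>h\<in>B. F g h (run (Alice s t u) g h))"
    using finA by (subst A(1), intro sum.union_disjoint) auto
  also have "\<dots> = (\<Sum>g\<in>?A1. \<Sum>h\<in>B. F g h (run t g h)) + (\<Sum>g\<in>?A2. \<Sum>h\<in>B. F g h (run u g h))"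
    by (intro arg_cong2[where f = "(+)"] sum.cong) auto
  also have "\<dots> \<le> (\<kappa> * (card ?A1 * card B) + 2 ^ comm_cost t * E) + (\<kappa> * (card ?A2 * card B) + 2 ^ comm_cost u * E)"
    using Alice.prems by (intro add_mono Alice.IH) auto
  also have "\<dots> = \<kappa> * (card A * card B) + (2 ^ comm_cost t + 2 ^ comm_cost u) * E"
    by (simp add: card algebra_simps)
  also have "\<dots> \<le> \<kappa> * (card A * card B) + (2 ^ max (comm_cost t) (comm_cost u) + 2 ^ max (comm_cost t) (comm_cost u)) * E"
    using E by (intro add_left_mono mult_right_mono add_mono power_increasing) auto
  finally show ?case by simp
next
  case (Bob s t u)
  have finB: "finite B" using Bob.prems fin finite_subset by blast
  let ?B1 = "{h \<in> B. s h}" and ?B2 = "{h \<in> B. \<not> s h}"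
  have B: "B = ?B1 \<union> ?B2" "?B1 \<inter> ?B2 = {}" by auto
  have card: "card B = card ?B1 + card ?B2"
    using finB card_Un_disjoint[of ?B1 ?B2] B by simp
  have "(\<Sum>h\<in>B. F g h (run (Bob s t u) g h))
      = (\<Sum>h\<in>?B1. F g h (run t g h)) + (\<Sum>h\<in>?B2. F g h (run u g h))" for g
  proof -
    have "(\<Sum>h\<in>B. F g h (run (Bob s t u) g h))
        = (\<Sum>h\<in>?B1. F g h (run (Bob s t u) g h)) + (\<Sum>h\<in>?B2. F g h (run (Bob s t u) g h))"
      using finB by (subst B(1), intro sum.union_disjoint) auto
    also have "\<dots> = (\<Sum>h\<in>?B1. F g h (run t g h)) + (\<Sum>h\<in>?B2. F g h (run u g h))"
      by (intro arg_cong2[where f = "(+)"] sum.cong) auto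
    finally show ?thesis .
  qed
  then have "(\<Sum>g\<in>A. \<Sum>h\<in>B. F g h (run (Bob s t u) g h))
      = (\<Sum>g\<in>A. \<Sum>h\<in>?B1. F g h (run t g h)) + (\<Sum>g\<in>A. \<Sum>h\<in>?B2. F g h (run u g h))"
    by (simp only: sum.distrib)
  also have "\<dots> \<le> (\<kappa> * (card A * card ?B1) + 2 ^ comm_cost t * E) + (\<kappa> * (card A * card ?B2) + 2 ^ comm_cost u * E)"
    using Bob.prems by (intro add_mono Bob.IH) auto
  also have "\<dots> = \<kappa> * (card A * card B) + (2 ^ comm_cost t + 2 ^ comm_cost u) * E"
    by (simp add: card algebra_simps)
  also have "\<dots> \<le> \<kappa> * (card A * card B) + (2 ^ max (comm_cost t) (comm_cost u) + 2 ^ max (comm_cost t) (comm_cost u)) * E"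
    using E by (intro add_left_mono mult_right_mono add_mono power_increasing) auto
  finally show ?case by simp
qed

text \<open>Averaging over the shared randomness. The weights allow iteration: inputs on which an
  earlier run failed receive weight 0.\<close>

lemma exists_good_protocol:
  fixes w :: "'i \<Rightarrow> real"
  assumes est: "estimates n f \<epsilon> M" and S: "finite S"
    and w: "\<And>i. i \<in> S \<Longrightarrow> 0 \<le> w i"
    and p: "\<And>i. i \<in> S \<Longrightarrow> set_pmf (p i) \<subseteq> cube n" and q: "\<And>i. i \<in> S \<Longrightarrow> set_pmf (q i) \<subseteq> cube n"
  shows "\<exists>t\<in>space M. 2 / 3 * (\<Sum>i\<in>S. w i)
    \<le> (\<Sum>i\<in>S. w i * of_bool (\<bar>run t (p i) (q i) - mean f (p i) (q i)\<bar> \<le> \<epsilon>))"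
proof (rule ccontr)
  interpret prob_space M using est by (simp add: estimates_def)
  define ev where "ev = (\<lambda>i. {t \<in> space M. \<bar>run t (p i) (q i) - mean f (p i) (q i)\<bar> \<le> \<epsilon>})"
  have ev: "measure M (ev i) \<ge> 2 / 3" if "i \<in> S" for i
    using est p[OF that] q[OF that] by (auto simp: estimates_def ev_def)
  \<comment> \<open>A set that is not measurable would have measure 0, below 2/3.\<close>
  have meas: "ev i \<in> sets M" if "i \<in> S" for i
    using ev[OF that] measure_notin_sets[of "ev i" M] by fastforce
  let ?F = "\<lambda>t. \<Sum>i\<in>S. w i * indicator (ev i) t"
  assume "\<not> ?thesis"
  then have less: "(\<Sum>i\<in>S. w i * of_bool (\<bar>run t (p i) (q i) - mean f (p i) (q i)\<bar> \<le> \<epsilon>)) < 2 / 3 * (\<Sum>i\<in>S. w i)"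
    if "t \<in> space M" for t
    using that by (meson not_le)
  have "?F t < 2 / 3 * (\<Sum>i\<in>S. w i)" if "t \<in> space M" for t
  proof -
    have "?F t = (\<Sum>i\<in>S. w i * of_bool (\<bar>run t (p i) (q i) - mean f (p i) (q i)\<bar> \<le> \<epsilon>))"
      using that by (intro sum.cong) (auto simp: ev_def indicator_def)
    then show ?thesis using less[OF that] by simp
  qed
  moreover have int: "integrable M ?F"
    using meas by (intro Bochner_Integration.integrable_sum integrable_mult_right integrable_real_indicator)
      (auto simp: emeasure_eq_measure)
  ultimately have "expectation ?F < 2 / 3 * (\<Sum>i\<in>S. w i)"
    by (intro expectation_less) auto
  moreover have "expectation ?F = (\<Sum>i\<in>S. w i * measure M (ev i))"
    using meas by (subst Bochner_Integration.integral_sum)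
      (auto intro!: integrable_real_indicator simp: emeasure_eq_measure)
  moreover have "(\<Sum>i\<in>S. w i * (2 / 3)) \<le> (\<Sum>i\<in>S. w i * measure M (ev i))"
    using ev w by (intro sum_mono mult_left_mono) auto
  moreover have "(\<Sum>i\<in>S. w i * (2 / 3)) = 2 / 3 * (\<Sum>i\<in>S. w i)"
    unfolding sum_distrib_right[symmetric] by (rule mult.commute)
  ultimately show False by linarith
qed

text \<open>The law is built on the indices up to \<open>k\<close> and mapped to points; index
  \<open>k\<close> takes the mass missing to 1 and goes to \<open>o'\<close>. Describing it through
  expectations covers coinciding points \<open>a i\<close> as well.\<close>

lemma exists_pmf_weights:
  fixes a :: "nat \<Rightarrow> 'a"
  assumes w: "\<And>i. i < k \<Longrightarrow> 0 \<le> w i" "(\<Sum>i<k. w i) \<le> 1"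
  shows "\<exists>p. set_pmf p \<subseteq> insert o' (a ` {..<k}) \<and>
    (\<forall>F :: 'a \<Rightarrow> real. measure_pmf.expectation p F = F o' + (\<Sum>i<k. w i * (F (a i) - F o')))"
proof -
  define v where "v = (\<lambda>i. if i < k then w i else if i = k then 1 - (\<Sum>i<k. w i) else 0)"
  have v0: "0 \<le> v i" for i using w by (auto simp: v_def)
  have "(\<Sum>i<k. v i) = (\<Sum>i<k. w i)" by (intro sum.cong) (auto simp: v_def)
  then have sum_v: "(\<Sum>i\<le>k. v i) = 1"
    unfolding lessThan_Suc_atMost[symmetric] by (simp add: v_def)
  have "(\<integral>\<^sup>+ i. ennreal (v i) \<partial>count_space UNIV) = (\<Sum>i\<in>{..k}. ennreal (v i))"
    by (rule nn_integral_count_space') (auto simp: v_def)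
  also have "\<dots> = 1"
    using v0 by (subst sum_ennreal) (auto simp: sum_v)
  finally have int: "(\<integral>\<^sup>+ i. ennreal (v i) \<partial>count_space UNIV) = 1" .
  define P where "P = embed_pmf v"
  have P: "pmf P i = v i" for i
    unfolding P_def by (rule pmf_embed_pmf[OF v0 int])
  have setP: "set_pmf P \<subseteq> {..k}"
    by (auto simp: set_pmf_eq P v_def split: if_splits)
  define p where "p = map_pmf (\<lambda>i. if i < k then a i else o') P"
  have "set_pmf p \<subseteq> insert o' (a ` {..<k})"
    by (auto simp: p_def)
  moreover have "measure_pmf.expectation p F = F o' + (\<Sum>i<k. w i * (F (a i) - F o'))" for F :: "'a \<Rightarrow> real"
  proof -
    have "measure_pmf.expectation p F = (\<Sum>i\<le>k. F (if i < k then a i else o') * pmf P i)"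
      unfolding p_def integral_map_pmf using setP by (intro integral_measure_pmf_real) auto
    also have "\<dots> = (\<Sum>i<k. F (if i < k then a i else o') * v i) + F o' * v k"
      unfolding lessThan_Suc_atMost[symmetric] by (simp add: P)
    also have "(\<Sum>i<k. F (if i < k then a i else o') * v i) = (\<Sum>i<k. F (a i) * w i)"
      by (intro sum.cong) (auto simp: v_def)
    finally show ?thesis
      by (simp add: v_def algebra_simps sum_subtractf sum_distrib_left)
  qed
  ultimately show ?thesis by blast
qed

lemma mean_iterated:
  assumes "finite (set_pmf p)" "finite (set_pmf q)"
  shows "mean f p q = measure_pmf.expectation p (\<lambda>x. measure_pmf.expectation q (\<lambda>y. of_bool (f x y)))"
proof -
  have "pair_pmf p q = bind_pmf p (\<lambda>x. map_pmf (Pair x) q)"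
    by (simp add: pair_pmf_def map_pmf_def)
  then have "mean f p q = (\<Sum>x\<in>set_pmf p. pmf p x *\<^sub>R measure_pmf.expectation (map_pmf (Pair x) q) (\<lambda>(x, y). of_bool (f x y)))"
    unfolding mean_def using assms by (simp add: pmf_expectation_bind[of "set_pmf p"])
  also have "\<dots> = measure_pmf.expectation p (\<lambda>x. measure_pmf.expectation q (\<lambda>y. of_bool (f x y)))"
    using assms by (subst integral_measure_pmf_real[of "set_pmf p"]) (auto simp: mult.commute)
  finally show ?thesis .
qed

section \<open>The lower bound\<close>

lemma sum_lin_square:
  assumes "N > 0"
  shows "(\<Sum>g\<in>signs ({..<m} \<times> {..<N}). (lin m N b g)\<^sup>2) = 2 ^ (m * N) * ip m b b"
proof -
  have "(\<Sum>g\<in>signs ({..<m} \<times> {..<N}). (lin m N b g)\<^sup>2)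
      = 2 ^ (m * N) * (\<Sum>i\<in>{..<m} \<times> {..<N}. (b (fst i) / sqrt N)\<^sup>2)"
    unfolding lin_def by (subst sum_signs_square) auto
  also have "(\<Sum>i\<in>{..<m} \<times> {..<N}. (b (fst i) / sqrt N)\<^sup>2) = (\<Sum>c<m. \<Sum>s<N. (b c / sqrt N)\<^sup>2)"
    unfolding sum.cartesian_product by (simp add: case_prod_beta)
  also have "\<dots> = ip m b b"
    using assms by (simp add: ip_def power_divide power2_eq_square)
  finally show ?thesis .
qed

lemma lin_cong: "(\<And>c. c < m \<Longrightarrow> b c = b' c) \<Longrightarrow> lin m N b g = lin m N b' g"
  by (auto simp: lin_def intro!: sum.cong)

lemma ip_lin: "ip k (\<lambda>i. lin m N (\<lambda>c. u c i) g) w = lin m N (\<lambda>c. ip k (u c) w) g"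
proof -
  let ?I = "{..<m} \<times> {..<N}"
  have "ip k (\<lambda>i. lin m N (\<lambda>c. u c i) g) w = (\<Sum>i<k. \<Sum>a\<in>?I. u (fst a) i / sqrt N * g a * w i)"
    by (simp add: ip_def lin_def sum_distrib_right)
  also have "\<dots> = (\<Sum>a\<in>?I. \<Sum>i<k. u (fst a) i / sqrt N * g a * w i)"
    by (rule sum.swap)
  also have "\<dots> = lin m N (\<lambda>c. ip k (u c) w) g"
    unfolding lin_def ip_def by (intro sum.cong refl) (simp add: sum_divide_distrib sum_distrib_left mult_ac)
  finally show ?thesis .
qed

lemma Markov_card:
  fixes F :: "'a \<Rightarrow> real" and a :: real
  assumes S: "finite S" and F: "\<And>s. s \<in> S \<Longrightarrow> 0 \<le> F s" and a: "0 < a"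
    and sum: "(\<Sum>s\<in>S. F s) \<le> a * card S"
  shows "99 / 100 * card S \<le> card {s \<in> S. F s \<le> 100 * a}"
proof -
  let ?A = "{s \<in> S. F s \<le> 100 * a}" and ?B = "{s \<in> S. F s > 100 * a}"
  have "100 * a * card ?B = (\<Sum>s\<in>?B. 100 * a)" by simp
  also have "\<dots> \<le> (\<Sum>s\<in>?B. F s)" by (intro sum_mono) auto
  also have "\<dots> \<le> (\<Sum>s\<in>S. F s)" using S F by (intro sum_mono2) auto
  finally have "a * (100 * card ?B) \<le> a * card S" using sum by simp
  then have "100 * real (card ?B) \<le> card S" using a by simp
  moreover have "card S = card ?A + card ?B"
  proof -
    have "S = ?A \<union> ?B" by auto
    then show ?thesis using S card_Un_disjoint[of ?A ?B] by force
  qed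
  ultimately show ?thesis by simp
qed

lemma sum_abs_le_sqrt:
  assumes "ip k x x \<le> T"
  shows "(\<Sum>i<k. \<bar>x i\<bar>) \<le> sqrt (k * T)"
proof (rule real_le_rsqrt)
  have "(\<Sum>i<k. 1 * \<bar>x i\<bar>)\<^sup>2 \<le> (\<Sum>i<k. 1\<^sup>2) * (\<Sum>i<k. \<bar>x i\<bar>\<^sup>2)"
    by (rule Cauchy_Schwarz_ineq_sum)
  also have "\<dots> = k * ip k x x" by (simp add: ip_def power2_eq_square)
  also have "\<dots> \<le> k * T" using assms by (intro mult_left_mono) auto
  finally show "(\<Sum>i<k. \<bar>x i\<bar>)\<^sup>2 \<le> k * T" by simp
qed

text \<open>Apart from terms that depend on at most one of the two weights, the mean is a bilinear
  form in them with matrix \<open>fdiff\<close>.\<close>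

lemma mean_weights:
  fixes \<alpha> \<beta> :: "nat \<Rightarrow> real"
  assumes fin: "finite (set_pmf p)" "finite (set_pmf q)"
    and p: "\<And>F :: bool list \<Rightarrow> real. measure_pmf.expectation p F
      = F (nth_point n 0) + (\<Sum>i<k. \<alpha> i * (F (nth_point n (r i)) - F (nth_point n 0)))"
    and q: "\<And>F :: bool list \<Rightarrow> real. measure_pmf.expectation q F
      = F (nth_point n 0) + (\<Sum>j<k. \<beta> j * (F (nth_point n (c j)) - F (nth_point n 0)))"
  shows "mean f p q = fmat n f 0 0 + (\<Sum>j<k. \<beta> j * (real_of_int (fmat n f 0 (c j)) - fmat n f 0 0))
    + (\<Sum>i<k. \<alpha> i * (real_of_int (fmat n f (r i) 0) - fmat n f 0 0 + (\<Sum>j<k. \<beta> j * fdiff n f (r i) (c j))))"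
proof -
  let ?\<phi> = "\<lambda>i. fmat n f i 0 + (\<Sum>j<k. \<beta> j * (real_of_int (fmat n f i (c j)) - fmat n f i 0))"
  have diff: "?\<phi> i - ?\<phi> 0 = real_of_int (fmat n f i 0) - fmat n f 0 0 + (\<Sum>j<k. \<beta> j * fdiff n f i (c j))" for i
  proof -
    have "(\<Sum>j<k. \<beta> j * fdiff n f i (c j))
        = (\<Sum>j<k. \<beta> j * (real_of_int (fmat n f i (c j)) - fmat n f i 0)) - (\<Sum>j<k. \<beta> j * (real_of_int (fmat n f 0 (c j)) - fmat n f 0 0))"
      unfolding sum_subtractf[symmetric] by (intro sum.cong refl) (simp add: fdiff_def algebra_simps)
    then show ?thesis by simp
  qed
  have inner: "measure_pmf.expectation q (\<lambda>y. of_bool (f (nth_point n i) y)) = ?\<phi> i" for i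
    unfolding q[of "\<lambda>y. of_bool (f (nth_point n i) y)"] by (simp add: fmat_def)
  have "mean f p q = measure_pmf.expectation p (\<lambda>x. measure_pmf.expectation q (\<lambda>y. of_bool (f x y)))"
    by (rule mean_iterated[OF fin])
  also have "\<dots> = ?\<phi> 0 + (\<Sum>i<k. \<alpha> i * (?\<phi> (r i) - ?\<phi> 0))"
    unfolding p[of "\<lambda>x. measure_pmf.expectation q (\<lambda>y. of_bool (f x y))"] inner ..
  finally show ?thesis unfolding diff by simp
qed

text \<open>In the alternating sum of four such means everything that depends on only one of the two
  weights cancels. The pairs of weights will be positive and negative parts.\<close>

lemma mixed_difference:
  fixes \<alpha> \<beta> \<alpha>' \<beta>' s :: "nat \<Rightarrow> real" and C :: "nat \<Rightarrow> nat \<Rightarrow> real"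
  shows "(a + b + (\<Sum>i<k. \<alpha> i * (s i + (\<Sum>j<k. \<beta> j * C i j))))
      - (a + b' + (\<Sum>i<k. \<alpha> i * (s i + (\<Sum>j<k. \<beta>' j * C i j))))
      - (a + b + (\<Sum>i<k. \<alpha>' i * (s i + (\<Sum>j<k. \<beta> j * C i j))))
      + (a + b' + (\<Sum>i<k. \<alpha>' i * (s i + (\<Sum>j<k. \<beta>' j * C i j))))
    = (\<Sum>i<k. (\<alpha> i - \<alpha>' i) * (\<Sum>j<k. (\<beta> j - \<beta>' j) * C i j))"
  by (simp add: algebra_simps sum.distrib sum_subtractf)

text \<open>The law for \<open>g\<close> carries the positive part of \<open>x g\<close>, divided by
  \<open>X\<close>, on the points selected by \<open>r\<close>, and its remaining mass at the base
  point. Outside \<open>G\<close> only the support is prescribed, so that \<open>P g\<close> is a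
  legitimate protocol input for every \<open>g\<close>.\<close>

definition positive_part_pmfs ::
  "nat \<Rightarrow> nat \<Rightarrow> (nat \<Rightarrow> nat) \<Rightarrow> real \<Rightarrow> 'g set \<Rightarrow> ('g \<Rightarrow> nat \<Rightarrow> real) \<Rightarrow> ('g \<Rightarrow> bool list pmf) \<Rightarrow> bool" where
  "positive_part_pmfs n k r X G x P \<longleftrightarrow> (\<forall>g. set_pmf (P g) \<subseteq> cube n \<and>
    (g \<in> G \<longrightarrow> (\<forall>F :: bool list \<Rightarrow> real. measure_pmf.expectation (P g) F
      = F (nth_point n 0) + (\<Sum>i<k. max (x g i) 0 / X * (F (nth_point n (r i)) - F (nth_point n 0))))))"

lemma positive_part_pmfsD:
  assumes "positive_part_pmfs n k r X G x P"
  shows "set_pmf (P g) \<subseteq> cube n"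
    and "g \<in> G \<Longrightarrow> measure_pmf.expectation (P g) F
      = F (nth_point n 0) + (\<Sum>i<k. max (x g i) 0 / X * (F (nth_point n (r i)) - F (nth_point n 0)))"
  using assms unfolding positive_part_pmfs_def by simp_all

lemma exists_positive_part_pmfs:
  fixes x :: "'g \<Rightarrow> nat \<Rightarrow> real"
  assumes X: "X > 0" and x: "\<And>g. g \<in> G \<Longrightarrow> (\<Sum>i<k. \<bar>x g i\<bar>) \<le> X" and r: "\<And>i. i < k \<Longrightarrow> r i < 2 ^ n"
  shows "\<exists>P. positive_part_pmfs n k r X G x P"
proof -
  have pts: "nth_point n i \<in> cube n" if "i < 2 ^ n" for i
    using that bij_betw_nth_point[of n] by (auto simp: bij_betw_def)
  have "\<exists>p. set_pmf p \<subseteq> cube n \<and> (g \<in> G \<longrightarrow> (\<forall>F :: bool list \<Rightarrow> real.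
    measure_pmf.expectation p F
      = F (nth_point n 0) + (\<Sum>i<k. max (x g i) 0 / X * (F (nth_point n (r i)) - F (nth_point n 0)))))" for g
  proof (cases "g \<in> G")
    case True
    have "(\<Sum>i<k. max (x g i) 0 / X) \<le> (\<Sum>i<k. \<bar>x g i\<bar>) / X"
      unfolding sum_divide_distrib using X by (intro sum_mono divide_right_mono) auto
    also have "\<dots> \<le> 1" using x[OF True] X by (simp add: pos_divide_le_eq)
    finally have "\<exists>p. set_pmf p \<subseteq> insert (nth_point n 0) ((\<lambda>i. nth_point n (r i)) ` {..<k}) \<and>
      (\<forall>F :: bool list \<Rightarrow> real. measure_pmf.expectation p F
        = F (nth_point n 0) + (\<Sum>i<k. max (x g i) 0 / X * (F (nth_point n (r i)) - F (nth_point n 0))))"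
      using X by (intro exists_pmf_weights) auto
    moreover have "insert (nth_point n 0) ((\<lambda>i. nth_point n (r i)) ` {..<k}) \<subseteq> cube n"
      using r by (auto intro!: pts)
    ultimately show ?thesis by blast
  next
    case False
    have "set_pmf (return_pmf (nth_point n 0)) \<subseteq> cube n" using pts[of 0] by simp
    then show ?thesis using False by blast
  qed
  then show ?thesis unfolding positive_part_pmfs_def by (intro choice allI)
qed

lemma finite_cube: "finite (cube n)"
  using bij_betw_finite[OF bij_betw_nth_point[of n]] by simp

text \<open>Sign vectors \<open>g\<close> and \<open>h\<close> are encoded as \<open>x g\<close> and
  \<open>x' h\<close>, whose form under \<open>B\<close> is \<open>lin m N h g\<close>. Four runs
  estimate it on a constant fraction of the pairs, which the Fejer bound on rectangles forbids to a
  protocol with few leaves.\<close>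

lemma communication_lower_bound:
  fixes l k n Q :: nat and \<epsilon> :: real
  assumes est: "estimates n f \<epsilon> M" and cost: "\<And>t. t \<in> space M \<Longrightarrow> comm_cost t \<le> Q"
    and l: "l > 0" and k: "k > 0" and minor: "nonsingular_minor (2 ^ n) (\<lambda>i j. fdiff n f i j) k r c"
    and lk: "real (20 * l) * (2 + log 2 k) \<le> k"
    and \<epsilon>: "0 \<le> \<epsilon>" "\<epsilon> * k * sqrt (20 * l) \<le> 1 / 512000"
  shows "exp (l / 8192) \<le> 20 * 2 ^ (4 * Q)"
proof -
  \<comment> \<open>The factor 20 leaves room for a spread family of \<open>l\<close> vectors;
    \<open>N\<close> accommodates all frequencies, since \<open>l * (16 * \<theta>)\<close> will be
    at most \<open>320 * l\<close>.\<close>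
  define m where "m = 20 * l"
  define N where "N = (320 * l)\<^sup>2"
  define B where "B = (\<lambda>i j. real_of_int (fdiff n f (r i) (c j)))"
  have m: "m > 0" and N: "N > 0" using l by (auto simp: m_def N_def)
  have rc: "r i < 2 ^ n" "c i < 2 ^ n" if "i < k" for i
    using minor that by (auto simp: nonsingular_minor_def)
  have "1 \<le> (det (mat k k (\<lambda>(i, j). B i j)))\<^sup>2"
    unfolding B_def using minor by (intro det_int_minor_square_ge) (simp add: nonsingular_minor_def)
  moreover have "\<bar>B i j\<bar> \<le> 2" for i j
    using abs_fdiff_le[of n f "r i" "c j"] by (simp add: B_def flip: of_int_abs)
  ultimately obtain u y where u: "orthonormal k m u" and uy: "\<And>j. j < m \<Longrightarrow> u j = mv k B (y j)"
    and y: "\<And>j. j < m \<Longrightarrow> ip k (y j) (y j) \<le> 4"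
    using exists_well_conditioned_subspace[of k B m] k lk unfolding m_def by blast
  define G where "G = signs ({..<m} \<times> {..<N})"
  define H where "H = signs {..<m}"
  have finG: "finite G" and finH: "finite H" by (auto simp: G_def H_def)
  have cardG: "real (card G) = 2 ^ (m * N)" and cardH: "real (card H) = 2 ^ m"
    by (auto simp: G_def H_def card_signs)
  define x where "x = (\<lambda>g i. lin m N (\<lambda>c. u c i) g)"
  define x' where "x' = (\<lambda>h j. \<Sum>c<m. y c j * h c)"
  \<comment> \<open>The mean squared norms are at most \<open>m\<close> and \<open>4 * m\<close>; by
    Markov's inequality a factor 100 loses at most one hundredth of each side.\<close>
  define G0 where "G0 = {g \<in> G. ip k (x g) (x g) \<le> 100 * real m}"
  define H0 where "H0 = {h \<in> H. ip k (x' h) (x' h) \<le> 100 * (4 * real m)}"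
  have G0: "99 / 100 * card G \<le> card G0"
    unfolding G0_def
  proof (rule Markov_card)
    have "(\<Sum>g\<in>G. ip k (x g) (x g)) = (\<Sum>i<k. \<Sum>g\<in>G. (x g i)\<^sup>2)"
      unfolding ip_def power2_eq_square by (rule sum.swap)
    also have "\<dots> = (\<Sum>i<k. 2 ^ (m * N) * ip m (\<lambda>c. u c i) (\<lambda>c. u c i))"
      unfolding G_def x_def sum_lin_square[OF N] ..
    also have "\<dots> = 2 ^ (m * N) * (\<Sum>c<m. ip k (u c) (u c))"
      unfolding ip_def sum_distrib_left by (rule sum.swap)
    also have "\<dots> = m * card G"
      using u cardG by (simp add: orthonormal_def)
    finally show "(\<Sum>g\<in>G. ip k (x g) (x g)) \<le> real m * card G" by simp
  qed (use finG m ip_self_nonneg in auto)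
  have H0: "99 / 100 * card H \<le> card H0"
    unfolding H0_def
  proof (rule Markov_card)
    have "(\<Sum>h\<in>H. ip k (x' h) (x' h)) = (\<Sum>j<k. \<Sum>h\<in>H. (x' h j)\<^sup>2)"
      unfolding ip_def power2_eq_square by (rule sum.swap)
    also have "\<dots> = (\<Sum>j<k. 2 ^ m * (\<Sum>c<m. (y c j)\<^sup>2))"
      unfolding H_def x'_def by (subst sum_signs_square) auto
    also have "\<dots> = 2 ^ m * (\<Sum>c<m. ip k (y c) (y c))"
      unfolding ip_def power2_eq_square sum_distrib_left by (rule sum.swap)
    also have "\<dots> \<le> 2 ^ m * (\<Sum>c<m. 4)"
      using y by (intro mult_left_mono sum_mono) auto
    also have "\<dots> = 4 * real m * card H"
      using cardH by simp
    finally show "(\<Sum>h\<in>H. ip k (x' h) (x' h)) \<le> 4 * real m * card H" .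
  qed (use finH m ip_self_nonneg in auto)
  \<comment> \<open>Bounds for the sums of absolute values, obtained from the norms by
    Cauchy-Schwarz; dividing by them gives weights of total mass at most 1.\<close>
  define X where "X = sqrt (k * (100 * real m))"
  define Y where "Y = sqrt (k * (100 * (4 * real m)))"
  have X: "X > 0" and Y: "Y > 0" using k m by (auto simp: X_def Y_def)
  have xX: "(\<Sum>i<k. \<bar>x g i\<bar>) \<le> X" "(\<Sum>i<k. \<bar>- x g i\<bar>) \<le> X" if "g \<in> G0" for g
    unfolding X_def using that by (auto simp: G0_def intro!: sum_abs_le_sqrt)
  have yY: "(\<Sum>i<k. \<bar>x' h i\<bar>) \<le> Y" "(\<Sum>i<k. \<bar>- x' h i\<bar>) \<le> Y" if "h \<in> H0" for h
    unfolding Y_def using that by (auto simp: H0_def intro!: sum_abs_le_sqrt)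
  obtain P1 where "positive_part_pmfs n k r X G0 x P1"
    using exists_positive_part_pmfs[OF X xX(1) rc(1)] ..
  note P1 = positive_part_pmfsD[OF this]
  obtain P2 where "positive_part_pmfs n k r X G0 (\<lambda>g i. - x g i) P2"
    using exists_positive_part_pmfs[OF X xX(2) rc(1)] ..
  note P2 = positive_part_pmfsD[OF this]
  obtain Q1 where "positive_part_pmfs n k c Y H0 x' Q1"
    using exists_positive_part_pmfs[OF Y yY(1) rc(2)] ..
  note Q1 = positive_part_pmfsD[OF this]
  obtain Q2 where "positive_part_pmfs n k c Y H0 (\<lambda>h i. - x' h i) Q2"
    using exists_positive_part_pmfs[OF Y yY(2) rc(2)] ..
  note Q2 = positive_part_pmfsD[OF this]
  note fin = finite_subset[OF P1(1) finite_cube] finite_subset[OF P2(1) finite_cube]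
    finite_subset[OF Q1(1) finite_cube] finite_subset[OF Q2(1) finite_cube]
  have value_eq: "X * Y * (mean f (P1 g) (Q1 h) - mean f (P1 g) (Q2 h) - mean f (P2 g) (Q1 h) + mean f (P2 g) (Q2 h))
      = lin m N h g" if g: "g \<in> G0" and h: "h \<in> H0" for g h
  proof -
    have pm: "max t 0 / T - max (- t) 0 / T = t / T" for t T :: real
      by (simp add: max_def diff_divide_distrib[symmetric])
    have "mean f (P1 g) (Q1 h) - mean f (P1 g) (Q2 h) - mean f (P2 g) (Q1 h) + mean f (P2 g) (Q2 h)
        = (\<Sum>i<k. x g i / X * (\<Sum>j<k. x' h j / Y * B i j))"
      unfolding mean_weights[OF fin(1,3) P1(2)[OF g] Q1(2)[OF h]] mean_weights[OF fin(1,4) P1(2)[OF g] Q2(2)[OF h]]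
        mean_weights[OF fin(2,3) P2(2)[OF g] Q1(2)[OF h]] mean_weights[OF fin(2,4) P2(2)[OF g] Q2(2)[OF h]]
        mixed_difference pm B_def ..
    also have "\<dots> = (\<Sum>i<k. x g i * (\<Sum>j<k. B i j * x' h j)) / (X * Y)"
      by (simp add: sum_divide_distrib sum_distrib_left mult_ac)
    also have "(\<Sum>i<k. x g i * (\<Sum>j<k. B i j * x' h j)) = ip k (x g) (mv k B (x' h))"
      by (simp add: ip_def mv_def)
    also have "\<dots> = lin m N (\<lambda>c. ip k (u c) (mv k B (x' h))) g"
      unfolding x_def by (rule ip_lin)
    also have "\<dots> = lin m N h g"
    proof (rule lin_cong)
      fix c assume "c < m"
      \<comment> \<open>By linearity the image of \<open>x' h\<close> has the coordinates
        \<open>h\<close> in the orthonormal family \<open>u\<close>.\<close>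
      have "mv k B (x' h) i = (\<Sum>c<m. h c * u c i)" for i
      proof -
        have "mv k B (x' h) i = ip k (B i) (\<lambda>j. \<Sum>c<m. h c * y c j)"
          by (simp add: mv_def x'_def mult.commute)
        also have "\<dots> = (\<Sum>c<m. h c * ip k (B i) (y c))" by (rule ip_sum_right)
        also have "\<dots> = (\<Sum>c<m. h c * u c i)" using uy by (intro sum.cong) (auto simp: mv_def)
        finally show ?thesis .
      qed
      then have "ip k (u c) (mv k B (x' h)) = ip k (u c) (\<lambda>i. \<Sum>c<m. h c * u c i)" by (intro ip_cong)
      also have "\<dots> = (\<Sum>c'<m. h c' * ip k (u c) (u c'))" by (rule ip_sum_right)
      also have "\<dots> = (\<Sum>c'<m. if c = c' then h c' else 0)"
        using u \<open>c < m\<close> by (intro sum.cong) (auto simp: orthonormal_def)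
      also have "\<dots> = h c" using \<open>c < m\<close> by simp
      finally show "ip k (u c) (mv k B (x' h)) = h c" .
    qed
    finally show ?thesis using X Y by simp
  qed
  define W where "W = (\<lambda>(g, h). of_bool (g \<in> G0 \<and> h \<in> H0) :: real)"
  define ok where "ok = (\<lambda>t P' Q' (g :: nat \<times> nat \<Rightarrow> real, h :: nat \<Rightarrow> real). of_bool (\<bar>run t (P' g) (Q' h) - mean f (P' g) (Q' h)\<bar> \<le> \<epsilon>) :: real)"
  \<comment> \<open>Four successive averagings each retain two thirds of the weight of the pairs on
    which all earlier runs were accurate, so a fraction 16/81 survives.\<close>
  have good: "\<exists>t\<in>space M. 2 / 3 * (\<Sum>i\<in>G \<times> H. w i) \<le> (\<Sum>i\<in>G \<times> H. w i * ok t P' Q' i)"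
    if "\<And>i. 0 \<le> w i" "\<And>g. set_pmf (P' g) \<subseteq> cube n" "\<And>h. set_pmf (Q' h) \<subseteq> cube n"
    for w :: "_ \<Rightarrow> real" and P' Q'
    using exists_good_protocol[OF est, of "G \<times> H" w "\<lambda>(g, h). P' g" "\<lambda>(g, h). Q' h"] finG finH that
    by (simp add: ok_def case_prod_beta)
  have W0: "0 \<le> W i" and ok0: "0 \<le> ok t P' Q' i" for i t P' Q'
    by (auto simp: W_def ok_def case_prod_beta)
  obtain t1 where t1: "t1 \<in> space M" "2 / 3 * (\<Sum>i\<in>G \<times> H. W i) \<le> (\<Sum>i\<in>G \<times> H. W i * ok t1 P1 Q1 i)"
    using good[of W P1 Q1] W0 P1(1) Q1(1) by blast
  obtain t2 where t2: "t2 \<in> space M" "2 / 3 * (\<Sum>i\<in>G \<times> H. W i * ok t1 P1 Q1 i)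
      \<le> (\<Sum>i\<in>G \<times> H. W i * ok t1 P1 Q1 i * ok t2 P1 Q2 i)"
    using good[of "\<lambda>i. W i * ok t1 P1 Q1 i" P1 Q2] W0 ok0 P1(1) Q2(1) by (meson mult_nonneg_nonneg)
  obtain t3 where t3: "t3 \<in> space M" "2 / 3 * (\<Sum>i\<in>G \<times> H. W i * ok t1 P1 Q1 i * ok t2 P1 Q2 i)
      \<le> (\<Sum>i\<in>G \<times> H. W i * ok t1 P1 Q1 i * ok t2 P1 Q2 i * ok t3 P2 Q1 i)"
    using good[of "\<lambda>i. W i * ok t1 P1 Q1 i * ok t2 P1 Q2 i" P2 Q1] W0 ok0 P2(1) Q1(1)
    by (meson mult_nonneg_nonneg)
  obtain t4 where t4: "t4 \<in> space M" "2 / 3 * (\<Sum>i\<in>G \<times> H. W i * ok t1 P1 Q1 i * ok t2 P1 Q2 i * ok t3 P2 Q1 i)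
      \<le> (\<Sum>i\<in>G \<times> H. W i * ok t1 P1 Q1 i * ok t2 P1 Q2 i * ok t3 P2 Q1 i * ok t4 P2 Q2 i)"
    using good[of "\<lambda>i. W i * ok t1 P1 Q1 i * ok t2 P1 Q2 i * ok t3 P2 Q1 i" P2 Q2] W0 ok0 P2(1) Q2(1)
    by (meson mult_nonneg_nonneg)
  define V where "V = (\<lambda>i. W i * ok t1 P1 Q1 i * ok t2 P1 Q2 i * ok t3 P2 Q1 i * ok t4 P2 Q2 i)"
  have V: "16 / 81 * (\<Sum>i\<in>G \<times> H. W i) \<le> (\<Sum>i\<in>G \<times> H. V i)"
    using t1(2) t2(2) t3(2) t4(2) unfolding V_def by linarith
  have sumW: "(\<Sum>i\<in>G \<times> H. W i) = real (card G0) * card H0"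
  proof -
    have "(\<Sum>i\<in>G \<times> H. W i) = (\<Sum>i\<in>G0 \<times> H0. 1)"
      using finG finH by (intro sum.mono_neutral_cong_right) (auto simp: W_def G0_def H0_def)
    then show ?thesis by (simp add: card_cartesian_product)
  qed
  define T where "T = graft (pull P1 Q1 t1) (\<lambda>v1. graft (pull P1 Q2 t2) (\<lambda>v2.
    graft (pull P2 Q1 t3) (\<lambda>v3. graft (pull P2 Q2 t4) (\<lambda>v4. Output (X * Y * (v1 - v2 - v3 + v4))))))"
  have runT: "run T g h = X * Y * (run t1 (P1 g) (Q1 h) - run t2 (P1 g) (Q2 h)
      - run t3 (P2 g) (Q1 h) + run t4 (P2 g) (Q2 h))" for g h
    by (simp add: T_def run_graft run_pull)
  have costT: "comm_cost T \<le> 4 * Q"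
  proof -
    have "comm_cost T \<le> comm_cost (pull P1 Q1 t1) + (comm_cost (pull P1 Q2 t2) + (comm_cost (pull P2 Q1 t3)
        + (comm_cost (pull P2 Q2 t4) + 0)))"
      unfolding T_def by (intro comm_cost_graft) simp
    then show ?thesis
      using cost[OF t1(1)] cost[OF t2(1)] cost[OF t3(1)] cost[OF t4(1)] by (simp add: comm_cost_pull)
  qed
  \<comment> \<open>Then \<open>\<theta>\<^sup>2 * m = 400\<close>, so the decay factor is at most
    \<open>exp (- 6)\<close>, which is below 1/128.\<close>
  define \<theta> where "\<theta> = 20 / sqrt m"
  have \<theta>: "\<theta> > 0" using m by (simp add: \<theta>_def)
  \<comment> \<open>The four errors, scaled by \<open>X * Y = 200 * k * m\<close>, total at most
    \<open>800 * \<epsilon> * k * m\<close>; times \<open>16 * \<theta>\<close> this stays in the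
    range where the kernel is at least 3/4.\<close>
  have close: "real 16 * \<theta> * \<bar>lin m N h g - run T g h\<bar> \<le> 1 / 2" if "V (g, h) \<noteq> 0" for g h
  proof -
    have gh: "g \<in> G0" "h \<in> H0" and oks: "\<bar>run t1 (P1 g) (Q1 h) - mean f (P1 g) (Q1 h)\<bar> \<le> \<epsilon>"
      "\<bar>run t2 (P1 g) (Q2 h) - mean f (P1 g) (Q2 h)\<bar> \<le> \<epsilon>"
      "\<bar>run t3 (P2 g) (Q1 h) - mean f (P2 g) (Q1 h)\<bar> \<le> \<epsilon>"
      "\<bar>run t4 (P2 g) (Q2 h) - mean f (P2 g) (Q2 h)\<bar> \<le> \<epsilon>"
      using that by (auto simp: V_def W_def ok_def)
    let ?\<Delta> = "(mean f (P1 g) (Q1 h) - mean f (P1 g) (Q2 h) - mean f (P2 g) (Q1 h) + mean f (P2 g) (Q2 h))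
      - (run t1 (P1 g) (Q1 h) - run t2 (P1 g) (Q2 h) - run t3 (P2 g) (Q1 h) + run t4 (P2 g) (Q2 h))"
    have "\<bar>lin m N h g - run T g h\<bar> = X * Y * \<bar>?\<Delta>\<bar>"
      unfolding runT value_eq[OF gh, symmetric] right_diff_distrib[symmetric] abs_mult using X Y by simp
    also have "\<dots> \<le> X * Y * (4 * \<epsilon>)"
      using oks X Y by (intro mult_left_mono) auto
    also have "X * Y = 200 * k * m"
    proof -
      have "X * Y = sqrt ((200 * real k * m)\<^sup>2)"
        unfolding X_def Y_def real_sqrt_mult[symmetric] by (simp add: power2_eq_square algebra_simps)
      then show ?thesis by simp
    qed
    finally have "real 16 * \<theta> * \<bar>lin m N h g - run T g h\<bar> \<le> real 16 * \<theta> * (200 * k * m * (4 * \<epsilon>))"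
      using \<theta> by (intro mult_left_mono) auto
    also have "\<dots> = 256000 * (\<epsilon> * k * (m / sqrt m))"
      by (simp add: \<theta>_def)
    also have "m / sqrt m = sqrt (20 * l)"
      using m by (simp add: real_div_sqrt m_def)
    also have "256000 * (\<epsilon> * k * sqrt (20 * l)) \<le> 1 / 2"
      using \<epsilon>(2) by simp
    finally show ?thesis .
  qed
  let ?K = "\<lambda>g h v. fejer 16 \<theta> (lin m N h g - v)"
  have "3 / 4 * (\<Sum>i\<in>G \<times> H. V i) \<le> (\<Sum>i\<in>G \<times> H. ?K (fst i) (snd i) (run T (fst i) (snd i)))"
    unfolding sum_distrib_left
  proof (intro sum_mono)
    fix i assume "i \<in> G \<times> H"
    have "V i = 0 \<or> V i = 1" by (auto simp: V_def W_def ok_def case_prod_beta)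
    moreover have "3 / 4 \<le> ?K (fst i) (snd i) (run T (fst i) (snd i))" if "V i \<noteq> 0"
      using close[of "fst i" "snd i"] that \<theta> by (intro fejer_ge) auto
    ultimately show "3 / 4 * V i \<le> ?K (fst i) (snd i) (run T (fst i) (snd i))"
      using fejer_nonneg by auto
  qed
  also have "\<dots> = (\<Sum>g\<in>G. \<Sum>h\<in>H. ?K g h (run T g h))"
    unfolding sum.cartesian_product by (simp add: case_prod_beta)
  \<comment> \<open>Kernel length 16 and \<open>\<tau> = 1 / 32\<close>, for which
    \<open>\<tau>\<^sup>2 * l / 8\<close> is \<open>l / 8192\<close>.\<close>
  also have "\<dots> \<le> (1 / 16 + 1 / 32) * (card G * card H) + 2 ^ comm_cost T * (exp (- (l / 8192)) * (2 ^ (m * N) * 2 ^ m))"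
  proof (rule sum_protocol_le[OF finG finH])
    fix A B v assume AB: "A \<subseteq> G" "B \<subseteq> H"
    have freq: "exp (- (\<theta>\<^sup>2 * m / 64)) \<le> (1 / 32) / 4"
    proof -
      have "\<theta>\<^sup>2 * m = 400" using m by (simp add: \<theta>_def power_divide)
      then have "exp (- (\<theta>\<^sup>2 * m / 64)) \<le> exp (- 6 :: real)" by simp
      moreover have "(128 :: real) \<le> exp 6"
      proof -
        have "(13 / 8) ^ 12 \<le> exp (1 / 2 :: real) ^ 12"
          using exp_lower_Taylor_quadratic[of "1 / 2 :: real"] by (intro power_mono) (auto simp: power2_eq_square)
        also have "exp (1 / 2 :: real) ^ 12 = exp 6" by (simp add: exp_of_nat_mult[symmetric])
        finally have "(13 / 8 :: real) ^ 12 \<le> exp 6" .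
        moreover have "(128 :: real) \<le> (13 / 8) ^ 12" by (simp add: power_divide)
        ultimately show ?thesis by linarith
      qed
      then have "exp (- 6 :: real) \<le> 1 / 128"
        unfolding exp_minus inverse_eq_divide by (intro divide_left_mono) auto
      ultimately show ?thesis by linarith
    qed
    have fN: "l * (real 16 * \<theta>) \<le> sqrt N"
    proof -
      have "1 \<le> sqrt m" using m by simp
      then have "20 / sqrt m \<le> 20 / 1" by (intro divide_left_mono) auto
      then have "real l * (16 * \<theta>) \<le> real l * (16 * 20)" unfolding \<theta>_def by (intro mult_left_mono) auto
      moreover have "sqrt N = real (320 * l)"
        unfolding N_def of_nat_power real_sqrt_abs by simp
      ultimately show ?thesis by simp
    qed
    show "(\<Sum>g\<in>A. \<Sum>h\<in>B. ?K g h v) \<le> (1 / 16 + 1 / 32) * (card A * card B) + exp (- (l / 8192)) * (2 ^ (m * N) * 2 ^ m)"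
      using sum_fejer_rectangle_le[OF l m_def N _ _ _ _ freq fN, of A B v] AB \<theta>
      by (simp add: G_def H_def power2_eq_square)
  qed auto
  also have "\<dots> = (3 / 32 + 2 ^ comm_cost T * exp (- (l / 8192))) * (card G * card H)"
    using cardG cardH by (simp add: algebra_simps)
  also have "\<dots> \<le> (3 / 32 + 2 ^ (4 * Q) * exp (- (l / 8192))) * (card G * card H)"
    using costT by (intro mult_right_mono add_left_mono power_increasing) auto
  finally have up: "3 / 4 * (\<Sum>i\<in>G \<times> H. V i) \<le> (3 / 32 + 2 ^ (4 * Q) * exp (- (l / 8192))) * (card G * card H)" .
  have "(99 / 100 * card G) * (99 / 100 * card H) \<le> real (card G0) * card H0"
    using G0 H0 by (intro mult_mono) auto
  then have "9801 / 10000 * real (card G * card H) \<le> real (card G0) * card H0"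
    by simp
  \<comment> \<open>The constant on the left is about 0.145, which exceeds 3/32 by more than
    1/20.\<close>
  then have "(3 / 4 * (16 / 81 * (9801 / 10000))) * real (card G * card H) \<le> 3 / 4 * (\<Sum>i\<in>G \<times> H. V i)"
    using V unfolding sumW by linarith
  also note up
  finally have "3 / 4 * (16 / 81 * (9801 / 10000)) \<le> 3 / 32 + 2 ^ (4 * Q) * exp (- (l / 8192))"
  proof (rule mult_right_le_imp_le)
    have "real (card G) * real (card H) > 0" unfolding cardG cardH by simp
    then show "0 < real (card G * card H)" by simp
  qed
  then have "1 / 20 \<le> 2 ^ (4 * Q) * exp (- (l / 8192))" by simp
  then show ?thesis by (simp add: exp_minus field_simps)
qed

section \<open>Constants and choice of parameters\<close>

lemma cost_ge_linear:
  fixes l Q :: nat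
  assumes "exp (l / 8192) \<le> 20 * 2 ^ (4 * Q)" and Q: "Q \<ge> 1"
  shows "real l \<le> 80000 * Q"
proof -
  have e: "(2::real) \<le> exp 1" using exp_ge_add_one_self[of 1] by simp
  have "exp (l / 8192) \<le> 2 ^ 5 * 2 ^ (4 * Q)" using assms(1) by (simp add: order_trans)
  also have "\<dots> = (2::real) ^ (5 + 4 * Q)" by (simp add: power_add)
  also have "\<dots> \<le> exp 1 ^ (5 + 4 * Q)" using e by (intro power_mono) auto
  also have "\<dots> = exp (real (5 + 4 * Q))" by (simp only: exp_of_nat_mult[symmetric] mult_1_right)
  finally have "l / 8192 \<le> real (5 + 4 * Q)" by simp
  then show ?thesis using Q by simp
qed

text \<open>Without communication the output is one number for all inputs. Point masses give means 0
  and 1, no number is within \<open>\<epsilon>\<close> of both, and averaging over these two inputs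
  would require a success count of 4/3.\<close>

lemma comm_cost_pos:
  assumes est: "estimates n f \<epsilon> M" and \<epsilon>: "\<epsilon> < 1 / 2"
    and f: "\<not> (\<lambda>(x, y). f x y) constant_on (cube n \<times> cube n)"
  shows "\<exists>t\<in>space M. comm_cost t \<ge> 1"
proof -
  have "\<exists>x\<in>cube n. \<exists>y\<in>cube n. f x y = b" for b
  proof (rule ccontr)
    assume "\<not> ?thesis"
    then have "\<forall>z\<in>cube n \<times> cube n. (\<lambda>(x, y). f x y) z = (\<not> b)" by auto
    then show False using f unfolding constant_on_def by blast
  qed
  from this[of True] this[of False] obtain x y x' y' where xy: "x \<in> cube n" "y \<in> cube n"
    "x' \<in> cube n" "y' \<in> cube n" "f x y" "\<not> f x' y'"
    by auto
  define p where "p = (\<lambda>b. return_pmf (if b then x else x'))"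
  define q where "q = (\<lambda>b. return_pmf (if b then y else y'))"
  have mean: "mean f (p b) (q b) = of_bool b" for b
    using xy by (simp add: mean_def p_def q_def pair_return_pmf1)
  have "set_pmf (p b) \<subseteq> cube n" "set_pmf (q b) \<subseteq> cube n" for b
    using xy by (auto simp: p_def q_def)
  from exists_good_protocol[OF est, of UNIV "\<lambda>_. 1" p q, OF _ _ this]
  obtain t where t: "t \<in> space M" "2 / 3 * (\<Sum>b\<in>(UNIV :: bool set). 1)
      \<le> (\<Sum>b\<in>UNIV. 1 * of_bool (\<bar>run t (p b) (q b) - mean f (p b) (q b)\<bar> \<le> \<epsilon>) :: real)"
    by auto
  have "comm_cost t \<noteq> 0"
  proof
    assume "comm_cost t = 0"
    then obtain v where v: "t = Output v" by (cases t) auto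
    have "\<not> (\<bar>v - 0\<bar> \<le> \<epsilon> \<and> \<bar>v - 1\<bar> \<le> \<epsilon>)" using \<epsilon> by linarith
    then have "(\<Sum>b\<in>UNIV. 1 * of_bool (\<bar>v - of_bool b\<bar> \<le> \<epsilon>) :: real) \<le> 1"
      unfolding UNIV_bool by (cases "\<bar>v - 0\<bar> \<le> \<epsilon>"; cases "\<bar>v - 1\<bar> \<le> \<epsilon>") (simp_all del: sum_of_bool_eq)
    then show False using t(2) by (simp add: v mean UNIV_bool del: sum_of_bool_eq)
  qed
  then show ?thesis using t(1) by (intro bexI[of _ t]) auto
qed

text \<open>A large minor of the difference matrix is cut down to size exactly
  \<open>k\<close>.\<close>

lemma cost_ge:
  fixes l k n Q :: nat and \<epsilon> :: real
  assumes est: "estimates n f \<epsilon> M" and cost: "\<And>t. t \<in> space M \<Longrightarrow> comm_cost t \<le> Q" and Q: "Q \<ge> 1"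
    and k: "k > 0" and kr: "k + 2 \<le> fun_rank n f"
    and lk: "real (20 * l) * (2 + log 2 k) \<le> k"
    and \<epsilon>: "0 \<le> \<epsilon>" "\<epsilon> * k * sqrt (20 * l) \<le> 1 / 512000"
  shows "real l \<le> 80000 * Q"
proof (cases "l = 0")
  case False
  obtain K r c where K: "nonsingular_minor (2 ^ n) (\<lambda>i j. fdiff n f i j) K r c" "fun_rank n f \<le> K + 2"
    using exists_large_minor by blast
  then have "k \<le> K" using kr by simp
  then obtain r c where "nonsingular_minor (2 ^ n) (\<lambda>i j. fdiff n f i j) k r c"
    using nonsingular_minor_le[OF K(1)] by blast
  from communication_lower_bound[OF est cost _ k this lk \<epsilon>] False Q show ?thesis
    by (intro cost_ge_linear) auto
qed simp

text \<open>The hypothesis \<open>key\<close> is applied with \<open>l\<close> of order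
  \<open>k / log k\<close>. While the rank is at most of order \<open>s\<close>, \<open>k\<close> is
  the rank minus 2; beyond that the accuracy condition caps \<open>k\<close> at order
  \<open>s * \<l> powr (1 / 3)\<close>. Bounded rank or bounded \<open>s\<close> is absorbed by the
  constant, as \<open>Q \<ge> 1\<close>.\<close>

lemma parameter_choice:
  fixes R Q :: nat and \<epsilon> :: real
  assumes \<epsilon>: "0 < \<epsilon>" "\<epsilon> < 1 / 2" and Q: "Q \<ge> 1"
    and key: "\<And>k l :: nat. k > 0 \<Longrightarrow> k + 2 \<le> R \<Longrightarrow> real (20 * l) * (2 + log 2 k) \<le> k
      \<Longrightarrow> \<epsilon> * k * sqrt (20 * l) \<le> 1 / 512000 \<Longrightarrow> real l \<le> 80000 * Q"
  shows "min (((1 / \<epsilon>) / log 2 (1 / \<epsilon>)) powr (2 / 3)) (R / max 1 (log 2 R)) \<le> 10 ^ 11 * Q"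
proof -
  define D where "D = 1 / \<epsilon>"
  define \<l> where "\<l> = log 2 D"
  define s where "s = D powr (2 / 3)"
  have D: "D > 2" using \<epsilon> by (simp add: D_def field_simps)
  have \<epsilon>D: "\<epsilon> * D = 1" using \<epsilon> by (simp add: D_def)
  have \<l>: "\<l> > 1" using D by (simp add: \<l>_def less_log_iff)
  have \<l>D: "\<l> \<le> 2 * D"
  proof -
    have "ln D \<le> D" using ln_le_minus_one[of D] D by simp
    moreover have "1 / 2 \<le> ln (2::real)" using ln2_ge_two_thirds by simp
    ultimately have "ln D / ln 2 \<le> D / (1 / 2)"
      using D by (intro frac_le) auto
    then show ?thesis by (simp add: \<l>_def log_def)
  qed
  have s0: "s > 0" using D by (simp add: s_def)
  have s3: "s ^ 3 = D\<^sup>2"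
  proof -
    have "s ^ 3 = D powr (2 / 3 * 3)" using D by (simp add: s_def powr_power)
    then show ?thesis using D by simp
  qed
  have T: "((1 / \<epsilon>) / log 2 (1 / \<epsilon>)) powr (2 / 3) = s / \<l> powr (2 / 3)"
    using D \<l> by (simp add: s_def \<l>_def powr_divide flip: D_def)
  have R0: "R / max 1 (log 2 R) \<le> R"
    by (simp add: pos_divide_le_eq mult_left_le_one_le mult_le_cancel_left1 divide_le_eq)
  \<comment> \<open>For such \<open>l\<close> the accuracy condition becomes a bound on
    \<open>k ^ 3\<close>; the constant fits because
    \<open>6400 ^ 3 = 512000\<^sup>2\<close>.\<close>
  have sq: "\<epsilon> * k * sqrt (20 * l) \<le> 1 / 512000"
    if "0 < t" "real (20 * l) \<le> k / t" "real k ^ 3 \<le> D\<^sup>2 * t / 6400 ^ 3" for k l :: nat and t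
  proof (rule power2_le_imp_le)
    have "(\<epsilon> * k * sqrt (20 * l))\<^sup>2 = \<epsilon>\<^sup>2 * (real k)\<^sup>2 * real (20 * l)"
      by (simp add: power_mult_distrib)
    also have "\<dots> \<le> \<epsilon>\<^sup>2 * (real k)\<^sup>2 * (k / t)"
      using that(2) by (intro mult_left_mono) auto
    also have "\<dots> = \<epsilon>\<^sup>2 / t * real k ^ 3"
      by (simp add: power2_eq_square power3_eq_cube)
    also have "\<dots> \<le> \<epsilon>\<^sup>2 / t * (D\<^sup>2 * t / 6400 ^ 3)"
      using that by (intro mult_left_mono) auto
    also have "\<dots> = (\<epsilon> * D)\<^sup>2 / 6400 ^ 3"
      using that(1) by (simp add: power_mult_distrib)
    also have "\<dots> = (1 / 512000)\<^sup>2" by (simp add: \<epsilon>D power2_eq_square)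
    finally show "(\<epsilon> * k * sqrt (20 * l))\<^sup>2 \<le> (1 / 512000)\<^sup>2" .
  qed simp
  have nat_floor: "t - 1 \<le> real (nat \<lfloor>t\<rfloor>)" "real (nat \<lfloor>t\<rfloor>) \<le> t" if "0 \<le> t" for t :: real
    using that by linarith+
  have Q1: "1 \<le> real Q" using Q by simp
  consider "R \<le> 2" | "s < 6400\<^sup>2" | "R > 2" "s \<ge> 6400\<^sup>2" "real (R - 2) \<le> s / 6400" | "R > 2" "s \<ge> 6400\<^sup>2" "real (R - 2) > s / 6400"
    by linarith
  then show ?thesis
  proof cases
    case 1
    then have "R / max 1 (log 2 R) \<le> 2" using R0 by linarith
    then show ?thesis using Q1 by (simp add: min_le_iff_disj)
  next
    case 2
    have "1 powr (2 / 3) \<le> \<l> powr (2 / 3)" using \<l> by (intro powr_mono2) auto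
    then have "s / \<l> powr (2 / 3) \<le> s / 1" using s0 by (intro divide_left_mono) auto
    then have "s / \<l> powr (2 / 3) \<le> 6400\<^sup>2" using 2 by simp
    then show ?thesis unfolding T using Q1 by (simp add: min_le_iff_disj)
  next
    case 3
    define k where "k = R - 2"
    define t where "t = 2 + log 2 k"
    have k: "k > 0" "k + 2 \<le> R" "real R \<le> 3 * k" using 3 by (auto simp: k_def)
    have t: "t \<ge> 2" using k by (simp add: t_def)
    define l where "l = nat \<lfloor>k / (20 * t)\<rfloor>"
    have l: "k / (20 * t) - 1 \<le> l" "real l \<le> k / (20 * t)"
      unfolding l_def using t by (intro nat_floor; simp)+
    have lt: "real (20 * l) \<le> k / t" using l(2) by simp
    have "real k ^ 3 \<le> (s / 6400) ^ 3" using 3 by (intro power_mono) (auto simp: k_def)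
    also have "\<dots> = D\<^sup>2 * 1 / 6400 ^ 3" by (simp add: power_divide s3)
    also have "\<dots> \<le> D\<^sup>2 * t / 6400 ^ 3"
      using t by (intro divide_right_mono mult_left_mono) auto
    finally have "\<epsilon> * k * sqrt (20 * l) \<le> 1 / 512000"
      using t lt by (intro sq) auto
    moreover have "real (20 * l) * (2 + log 2 k) \<le> k"
      using lt t by (simp add: t_def[symmetric] pos_le_divide_eq)
    ultimately have "real l \<le> 80000 * Q" using k by (intro key)
    then have "k / (20 * t) \<le> 80001 * real Q" using l(1) Q1 by linarith
    then have kt: "k / t \<le> 20 * (80001 * real Q)" by simp
    have "log 2 k \<le> log 2 R" using k by (simp add: k_def)
    then have tR: "t \<le> 3 * max 1 (log 2 R)" unfolding t_def by linarith
    have "R / max 1 (log 2 R) \<le> (3 * k) / (t / 3)"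
      using k(3) t tR by (intro frac_le) auto
    also have "\<dots> = 9 * (k / t)" by simp
    also have "\<dots> \<le> 10 ^ 11 * Q" using kt Q1 by simp
    finally show ?thesis by simp
  next
    case 4
    \<comment> \<open>The cube root of \<open>\<l>\<close> is affordable because \<open>l\<close> is
      smaller than \<open>k\<close> by a factor of order \<open>\<l>\<close>; accordingly
      \<open>6400 * (\<kappa> / \<l>)\<close> is the first term of the minimum.\<close>
    define \<kappa> where "\<kappa> = s * \<l> powr (1 / 3) / 6400"
    define v where "v = min (real (R - 2)) \<kappa>"
    define k where "k = nat \<lfloor>v\<rfloor>"
    define l where "l = nat \<lfloor>k / (60 * \<l>)\<rfloor>"
    have \<l>3: "(\<l> powr (1 / 3)) ^ 3 = \<l>" using \<l> by (simp add: powr_power)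
    have \<kappa>3: "\<kappa> ^ 3 = D\<^sup>2 * \<l> / 6400 ^ 3"
      by (simp add: \<kappa>_def power_divide power_mult_distrib s3 \<l>3)
    have "1 powr (1 / 3) \<le> \<l> powr (1 / 3)" using \<l> by (intro powr_mono2) auto
    then have "6400\<^sup>2 * 1 / 6400 \<le> \<kappa>"
      unfolding \<kappa>_def using 4(2) by (intro divide_right_mono mult_mono) auto
    then have v: "1 \<le> v" using 4(1) by (simp add: v_def)
    have k: "v - 1 \<le> k" "real k \<le> v" unfolding k_def using v by (intro nat_floor; simp)+
    have k0: "k > 0" using v by (simp add: k_def)
    have "real k \<le> real (R - 2)" using k(2) by (simp add: v_def)
    then have kR: "k + 2 \<le> R" using 4(1) by simp
    have l: "k / (60 * \<l>) - 1 \<le> l" "real l \<le> k / (60 * \<l>)"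
      unfolding l_def using \<l> by (intro nat_floor; simp)+
    have lt: "real (20 * l) \<le> k / (3 * \<l>)" using l(2) by simp
    have "real k ^ 3 \<le> \<kappa> ^ 3" using k(2) by (intro power_mono) (auto simp: v_def)
    then have k3: "real k ^ 3 \<le> D\<^sup>2 * \<l> / 6400 ^ 3" by (simp only: \<kappa>3)
    also have "\<dots> \<le> D\<^sup>2 * (3 * \<l>) / 6400 ^ 3" using \<l> D by (intro divide_right_mono mult_left_mono) auto
    finally have "\<epsilon> * k * sqrt (20 * l) \<le> 1 / 512000" using \<l> lt by (intro sq[of "3 * \<l>"]) auto
    moreover have "real (20 * l) * (2 + log 2 k) \<le> k"
    proof -
      \<comment> \<open>This gives \<open>k \<le> D\<close>, hence
        \<open>2 + log 2 k \<le> 3 * \<l>\<close>, which explains the 60 in the definition of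
        \<open>l\<close>.\<close>
      have "D\<^sup>2 * \<l> / 6400 ^ 3 \<le> D\<^sup>2 * (2 * D) / 6400 ^ 3"
        using \<l>D by (intro divide_right_mono mult_left_mono) auto
      also have "\<dots> \<le> D ^ 3" using D by (simp add: power2_eq_square power3_eq_cube)
      finally have "real k ^ 3 \<le> D ^ 3" using k3 by linarith
      then have "real k \<le> D" using D by (simp add: power_mono_iff)
      then have "log 2 k \<le> \<l>" unfolding \<l>_def using k0 D by simp
      then have "real (20 * l) * (2 + log 2 k) \<le> real (20 * l) * (3 * \<l>)"
        using \<l> by (intro mult_left_mono) auto
      also have "\<dots> \<le> k" using lt \<l> by (simp add: pos_le_divide_eq)
      finally show ?thesis .
    qed
    ultimately have "real l \<le> 80000 * Q" using k0 kR by (intro key)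
    then have kl: "k / (60 * \<l>) \<le> 80001 * real Q" using l(1) Q1 by linarith
    have "v / \<l> \<le> (k + 1) / \<l>" using k(1) \<l> by (intro divide_right_mono) auto
    also have "\<dots> = 60 * (k / (60 * \<l>)) + 1 / \<l>" by (simp add: add_divide_distrib)
    also have "\<dots> \<le> 60 * (80001 * real Q) + 1"
      using kl \<l> by (intro add_mono mult_left_mono) auto
    finally have vl: "v / \<l> \<le> 4800061 * real Q" using Q1 by linarith
    have "s / \<l> powr (2 / 3) = 6400 * (\<kappa> / \<l>)"
    proof -
      have "\<l> powr (1 / 3) * \<l> powr (2 / 3) = \<l>" using \<l> by (simp flip: powr_add)
      then have "\<l> powr (1 / 3) / \<l> = 1 / \<l> powr (2 / 3)" using \<l> by (simp add: field_simps)
      then have "s * (\<l> powr (1 / 3) / \<l>) = s * (1 / \<l> powr (2 / 3))" by (simp only:)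
      then show ?thesis by (simp add: \<kappa>_def)
    qed
    moreover have "R / max 1 (log 2 R) \<le> 6400 * (real (R - 2) / \<l>)"
    proof -
      \<comment> \<open>As \<open>s \<ge> 6400\<^sup>2\<close>, the case assumption gives
        \<open>s \<le> (R - 2)\<^sup>2\<close>, and \<open>log 2 R\<close> is at least
        \<open>\<l> / 3\<close>.\<close>
      have "(s / 6400)\<^sup>2 \<le> (real (R - 2))\<^sup>2" using 4 s0 by (intro power_mono) auto
      moreover have "s \<le> (s / 6400)\<^sup>2"
        using 4(2) s0 by (simp add: power2_eq_square field_simps)
      ultimately have "s \<le> real (R - 2) ^ 2" by linarith
      then have "log 2 s \<le> log 2 (real (R - 2) ^ 2)" using s0 4(1) by simp
      also have "\<dots> = 2 * log 2 (real (R - 2))" using 4(1) by (subst log_nat_power) auto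
      also have "log 2 (real (R - 2)) \<le> log 2 R" using 4(1) by simp
      finally have "log 2 s \<le> 2 * log 2 R" by simp
      moreover have "log 2 s = 2 / 3 * \<l>" using D by (simp add: s_def \<l>_def log_powr)
      ultimately have "\<l> / 3 \<le> max 1 (log 2 R)" by linarith
      moreover have "real R \<le> 3 * real (R - 2)" using 4(1) by simp
      ultimately have "R / max 1 (log 2 R) \<le> (3 * real (R - 2)) / (\<l> / 3)"
        using \<l> by (intro frac_le) auto
      also have "\<dots> = 9 * (real (R - 2) / \<l>)" by simp
      also have "\<dots> \<le> 6400 * (real (R - 2) / \<l>)" using \<l> by (intro mult_right_mono) auto
      finally show ?thesis .
    qed
    ultimately have "min (s / \<l> powr (2 / 3)) (R / max 1 (log 2 R)) \<le> 6400 * (v / \<l>)"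
      unfolding v_def by (auto simp: min_def)
    also have "\<dots> \<le> 10 ^ 11 * Q" using vl Q1 by simp
    finally show ?thesis unfolding T .
  qed
qed

theorem theorem4p13:
  shows "\<exists>c::real. c > 0 \<and>
    (\<forall>(n::nat) (f::bool list \<Rightarrow> bool list \<Rightarrow> bool) (\<epsilon>::real).
       \<not> (\<lambda>(x, y). f x y) constant_on (cube n \<times> cube n) \<longrightarrow> 0 < \<epsilon> \<longrightarrow> \<epsilon> < 1 / 2 \<longrightarrow>
       ereal_of_enat (est_complexity n f \<epsilon>) \<ge>
         ereal (c * min (((1 / \<epsilon>) / log 2 (1 / \<epsilon>)) powr (2 / 3))
                        (real (fun_rank n f) / max 1 (log 2 (real (fun_rank n f))))))"
proof (intro exI conjI allI impI)
  show "(0::real) < 1 / 10 ^ 11" by simp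
  fix n :: nat and f :: "bool list \<Rightarrow> bool list \<Rightarrow> bool" and \<epsilon> :: real
  assume f: "\<not> (\<lambda>(x, y). f x y) constant_on (cube n \<times> cube n)" and \<epsilon>: "0 < \<epsilon>" "\<epsilon> < 1 / 2"
  let ?b = "min (((1 / \<epsilon>) / log 2 (1 / \<epsilon>)) powr (2 / 3)) (real (fun_rank n f) / max 1 (log 2 (real (fun_rank n f))))"
  let ?c = "\<lambda>M. SUP t\<in>space M. enat (comm_cost t)"
  show "ereal (1 / 10 ^ 11 * ?b) \<le> ereal_of_enat (est_complexity n f \<epsilon>)"
  proof (cases "est_complexity n f \<epsilon>")
    case (enat Q)
    have "{M. estimates n f \<epsilon> M} \<noteq> {}"
    proof
      assume "{M. estimates n f \<epsilon> M} = {}"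
      then have "est_complexity n f \<epsilon> = \<infinity>"
        unfolding est_complexity_def by (simp only: image_empty Inf_empty top_enat_def)
      then show False using enat by simp
    qed
    \<comment> \<open>The infimum of a nonempty set of extended naturals is attained.\<close>
    then have "Inf (?c ` {M. estimates n f \<epsilon> M}) \<in> ?c ` {M. estimates n f \<epsilon> M}"
      by (meson equals0I imageI wellorder_InfI ex_in_conv)
    then obtain M where est: "estimates n f \<epsilon> M" and M: "?c M = enat Q"
      using enat unfolding est_complexity_def by (metis (mono_tags, lifting) imageE mem_Collect_eq)
    have cost: "comm_cost t \<le> Q" if "t \<in> space M" for t
      using SUP_upper[OF that, of "\<lambda>t. enat (comm_cost t)"] M by simp
    have Q: "Q \<ge> 1"
      using comm_cost_pos[OF est \<epsilon>(2) f] cost by (meson order_trans)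
    have "?b \<le> 10 ^ 11 * Q"
      using \<epsilon> cost_ge[OF est cost Q] by (intro parameter_choice[OF \<epsilon> Q]) auto
    then show ?thesis by (simp add: enat field_simps)
  qed simp
qed

end
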